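(* Let $F\in\mathbb{K}[x_0,\ldots,x_k]$ be a concise homogeneous polynomial, let $f=F|_{x_0=1}\in\mathbb{K}[x_1,\ldots,x_k]$ be its dehomogenization, and assume that $\operatorname{Ap}(f)$ is smoothable. If $\dim_{\mathbb{K}}\operatorname{Ap}(f)=n+1$, then there exists a concise homogeneous polynomial $G\in\mathbb{K}[x_0,\ldots,x_n]$ such that $G$ restricts to $F$ (that is, $F=G|_{x_{k+1}=0,\ldots,x_n=0}$), the dehomogenization $g=G|_{x_0=1}$ is encompassing, and $\operatorname{Ap}(g)$ is smoothable. In particular, $$\operatorname{brk}\big(\mathrm{tw}(F^d)\big)\leq\binom{n+d}{d}$$ for every $d\in\mathbb{N}$. Moreover, $G$ may be chosen so that $\operatorname{Ap}(g)\simeq\operatorname{Ap}(f)$.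
   Context: $\mathbb{K}$ is an algebraically closed field of characteristic zero. Polynomial rings $\mathbb{K}[\alpha_i]$ act on the corresponding rings $\mathbb{K}[x_i]$ by letting $\alpha_i$ act as $\partial/\partial x_i$ (written $\sigma\circ f$). For $f\in\mathbb{K}[x_1,\ldots,x_m]$ let $\mathcal{D}=\mathbb{K}[\alpha_1,\ldots,\alpha_m]$, $\operatorname{Ann}(f)=\{\sigma\in\mathcal{D}:\sigma\circ f=0\}$, and $\operatorname{Ap}(f)=\mathcal{D}/\operatorname{Ann}(f)$. A polynomial is concise if its annihilator (in the dual ring on all its variables) contains no nonzero element of degree $\leq1$. A polynomial $f$ is encompassing if no nonzero $h\in\mathcal{D}\circ f$ has zero part in degrees $\le1$ (i.e. $h_{\leq 1}=0$ implies $h=0$). For $F=\sum_i\lambda_i\mathbf{x}^i$, with $i=(i_0,i_1,\ldots)$, the twist is $\mathrm{tw}(F)=\sum_i\lambda_i\frac1{i_0!}\mathbf{x}^i$. The border rank $\operatorname{brk}(H)$ of a form $H$ of degree $e$ is the least $r$ such that $H$ is in the Zariski closure of the set of forms of degree $e$ that are linear combinations of at most $r$ $e$-th powers of linear forms. A finite $\mathbb{K}$-algebra $A$ is smoothable if there is a $\mathbb{K}[[t]]$-algebra $\mathcal{A}$, free of finite rank as a $\mathbb{K}[[t]]$-module, with $\mathcal{A}/t\mathcal{A}\simeq A$ and $\mathcal{A}[t^{-1}]$ smooth over $\mathbb{K}[[t]][t^{-1}]$. *)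

theory Defs
  imports
    "HOL-Library.Poly_Mapping"
    "HOL-Computational_Algebra.Formal_Laurent_Series"
    "HOL-Algebra.QuotRing"
    "HOL-Algebra.Embedded_Algebras"
    "HOL-Algebra.Algebraic_Closure_Type"
begin

section \<open>Polynomials\<close>

text \<open>
  A polynomial is a finitely supported map from monomials to coefficients, a monomial being a
  finitely supported map from variables to exponents.  For \<open>V\<close> a set of variables, \<open>polys V\<close> is the
  polynomial ring on the variables in \<open>V\<close>.
\<close>

type_synonym ('v, 'a) mpoly = "('v \<Rightarrow>\<^sub>0 nat) \<Rightarrow>\<^sub>0 'a"

definition polys :: "'v set \<Rightarrow> ('v, 'a::zero) mpoly set" where
  "polys V = {p. \<forall>m\<in>Poly_Mapping.keys p. Poly_Mapping.keys m \<subseteq> V}"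

definition Const :: "'a::zero \<Rightarrow> ('v, 'a) mpoly" where
  "Const c = Poly_Mapping.single 0 c"

definition Var :: "'v \<Rightarrow> ('v, 'a::zero_neq_one) mpoly" where
  "Var v = Poly_Mapping.single (Poly_Mapping.single v 1) 1"

definition mon_deg :: "('v \<Rightarrow>\<^sub>0 nat) \<Rightarrow> nat" where
  "mon_deg m = (\<Sum>v\<in>Poly_Mapping.keys m. Poly_Mapping.lookup m v)"

definition tdeg :: "('v, 'a::zero) mpoly \<Rightarrow> nat" where
  "tdeg p = Max (insert 0 (mon_deg ` Poly_Mapping.keys p))"

definition forms :: "'v set \<Rightarrow> nat \<Rightarrow> ('v, 'a::zero) mpoly set" where
  "forms V e = {p \<in> polys V. \<forall>m\<in>Poly_Mapping.keys p. mon_deg m = e}"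

definition homogeneous :: "('v, 'a::zero) mpoly \<Rightarrow> bool" where
  "homogeneous p \<longleftrightarrow> (\<exists>e. \<forall>m\<in>Poly_Mapping.keys p. mon_deg m = e)"

text \<open>The value of \<open>p\<close> at the point \<open>\<xi>\<close>, coefficients being mapped by \<open>\<iota>\<close>.\<close>

definition poly_eval :: "('a::zero \<Rightarrow> 'b::comm_ring_1) \<Rightarrow> ('v \<Rightarrow> 'b) \<Rightarrow> ('v, 'a) mpoly \<Rightarrow> 'b" where
  "poly_eval \<iota> \<xi> p = (\<Sum>m\<in>Poly_Mapping.keys p.
     \<iota> (Poly_Mapping.lookup p m) * (\<Prod>v\<in>Poly_Mapping.keys m. \<xi> v ^ Poly_Mapping.lookup m v))"

definition dehomogenize :: "(nat, 'a::comm_ring_1) mpoly \<Rightarrow> (nat, 'a) mpoly" where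
  "dehomogenize F = poly_eval Const (\<lambda>i. if i = 0 then 1 else Var i) F"

definition set_zero :: "'v set \<Rightarrow> ('v, 'a::comm_ring_1) mpoly \<Rightarrow> ('v, 'a) mpoly" where
  "set_zero Z G = poly_eval Const (\<lambda>v. if v \<in> Z then 0 else Var v) G"

definition upto_deg :: "nat \<Rightarrow> ('v, 'a::zero) mpoly \<Rightarrow> ('v, 'a) mpoly" where
  "upto_deg j p = Poly_Mapping.mapp (\<lambda>m c. if mon_deg m \<le> j then c else 0) p"

definition tw :: "(nat, 'a::field_char_0) mpoly \<Rightarrow> (nat, 'a) mpoly" where
  "tw F = Poly_Mapping.mapp (\<lambda>m c. c * (1 / fact (Poly_Mapping.lookup m 0))) F"


section \<open>Algebras\<close>

text \<open>
  An algebra over a commutative ring \<open>'r\<close> is a commutative ring together with its structure map, a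
  ring homomorphism from \<open>'r\<close>.
\<close>

definition is_algebra :: "('r::comm_ring_1 \<Rightarrow> 'b) \<Rightarrow> 'b ring \<Rightarrow> bool" where
  "is_algebra \<phi> B \<longleftrightarrow> cring B \<and> \<phi> \<in> ring_hom ring_of_type_algebra B"

definition algebra_hom ::
    "('r \<Rightarrow> 'b) \<Rightarrow> 'b ring \<Rightarrow> ('r \<Rightarrow> 'c) \<Rightarrow> 'c ring \<Rightarrow> ('b \<Rightarrow> 'c) set" where
  "algebra_hom \<phi> B \<psi> C = {h \<in> ring_hom B C. \<forall>r. h (\<phi> r) = \<psi> r}"

definition algebra_iso ::
    "('r \<Rightarrow> 'b) \<Rightarrow> 'b ring \<Rightarrow> ('r \<Rightarrow> 'c) \<Rightarrow> 'c ring \<Rightarrow> bool" where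
  "algebra_iso \<phi> B \<psi> C \<longleftrightarrow> (\<exists>h \<in> ring_iso B C. \<forall>r. h (\<phi> r) = \<psi> r)"

definition quot_map :: "'b ring \<Rightarrow> 'b set \<Rightarrow> ('r \<Rightarrow> 'b) \<Rightarrow> 'r \<Rightarrow> 'b set" where
  "quot_map B I \<phi> r = I +>\<^bsub>B\<^esub> \<phi> r"

definition mpoly_ring :: "'v set \<Rightarrow> ('v, 'r::comm_ring_1) mpoly ring" where
  "mpoly_ring V = ring_of_type_algebra\<lparr>carrier := polys V\<rparr>"

definition free_of_finite_rank :: "('r \<Rightarrow> 'b) \<Rightarrow> 'b ring \<Rightarrow> bool" where
  "free_of_finite_rank \<phi> B \<longleftrightarrow> (\<exists>(r::nat) b. b \<in> {..<r} \<rightarrow> carrier B \<and>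
     (\<forall>x\<in>carrier B. \<exists>!c. c \<in> {..<r} \<rightarrow>\<^sub>E UNIV \<and>
        x = (\<Oplus>\<^bsub>B\<^esub>i\<in>{..<r}. \<phi> (c i) \<otimes>\<^bsub>B\<^esub> b i)))"


subsection \<open>Localization at the powers of an element\<close>

text \<open>The pair \<open>(a, k)\<close> represents the fraction \<open>a / s\<^sup>k\<close>.\<close>

definition loc_rel :: "'b ring \<Rightarrow> 'b \<Rightarrow> (('b \<times> nat) \<times> ('b \<times> nat)) set" where
  "loc_rel B s = {((a, k), (b, l)). a \<in> carrier B \<and> b \<in> carrier B \<and>
     (\<exists>m::nat. s [^]\<^bsub>B\<^esub> m \<otimes>\<^bsub>B\<^esub> (s [^]\<^bsub>B\<^esub> l \<otimes>\<^bsub>B\<^esub> a) = s [^]\<^bsub>B\<^esub> m \<otimes>\<^bsub>B\<^esub> (s [^]\<^bsub>B\<^esub> k \<otimes>\<^bsub>B\<^esub> b))}"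

definition loc_frac :: "'b ring \<Rightarrow> 'b \<Rightarrow> 'b \<Rightarrow> nat \<Rightarrow> ('b \<times> nat) set" where
  "loc_frac B s a k = loc_rel B s `` {(a, k)}"

definition localization :: "'b ring \<Rightarrow> 'b \<Rightarrow> ('b \<times> nat) set ring" where
  "localization B s = \<lparr>
     carrier = (carrier B \<times> UNIV) // loc_rel B s,
     monoid.mult = (\<lambda>U W. \<Union>x\<in>U. \<Union>y\<in>W. loc_frac B s (fst x \<otimes>\<^bsub>B\<^esub> fst y) (snd x + snd y)),
     one = loc_frac B s \<one>\<^bsub>B\<^esub> 0,
     ring.zero = loc_frac B s \<zero>\<^bsub>B\<^esub> 0,
     add = (\<lambda>U W. \<Union>x\<in>U. \<Union>y\<in>W. loc_frac B s
       (s [^]\<^bsub>B\<^esub> snd y \<otimes>\<^bsub>B\<^esub> fst x \<oplus>\<^bsub>B\<^esub> s [^]\<^bsub>B\<^esub> snd x \<otimes>\<^bsub>B\<^esub> fst y) (snd x + snd y))\<rparr>"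

text \<open>
  For a \<open>K[[t]]\<close>-algebra \<open>B\<close> with structure map \<open>\<phi>\<close>, the structure map of \<open>B[1/t]\<close> over
  \<open>K[[t]][1/t] = K((t))\<close>: a Laurent series \<open>g\<close> of order at least \<open>-k\<close> is sent to \<open>\<phi>(t\<^sup>k g) / t\<^sup>k\<close>.
\<close>

definition laurent_map ::
    "('a::comm_ring_1 fps \<Rightarrow> 'b) \<Rightarrow> 'b ring \<Rightarrow> 'a fls \<Rightarrow> ('b \<times> nat) set" where
  "laurent_map \<phi> B g =
     (let k = nat (- fls_subdegree g)
      in loc_frac B (\<phi> fps_X) (\<phi> (fls_regpart (fls_shift (- int k) g))) k)"


subsection \<open>Smooth algebras\<close>

text \<open>
  Smooth means finitely presented and formally smooth.  Formal smoothness is the lifting of algebra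
  homomorphisms along quotients by ideals of square zero.  HOL cannot quantify over all types in a
  definition, so the test algebras \<open>C\<close> live on the type of sets of polynomials over \<open>'r\<close>.  For a
  finitely presented \<open>B\<close> this is no restriction: if \<open>B = P / I\<close> with \<open>P\<close> a polynomial ring over \<open>'r\<close>,
  then \<open>C = P / I\<^sup>2\<close> lives on this type, and lifting the identity of \<open>B\<close> along
  \<open>P / I\<^sup>2 \<rightarrow> P / I\<close> yields all other lifts.
\<close>

definition formally_smooth :: "('r::comm_ring_1 \<Rightarrow> 'b) \<Rightarrow> 'b ring \<Rightarrow> bool" where
  "formally_smooth \<phi> B \<longleftrightarrow>
     (\<forall>(C :: (nat, 'r) mpoly set ring) \<psi> J.
        is_algebra \<psi> C \<and> ideal J C \<and> (\<forall>x\<in>J. \<forall>y\<in>J. x \<otimes>\<^bsub>C\<^esub> y = \<zero>\<^bsub>C\<^esub>) \<longrightarrow>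
        (\<forall>u \<in> algebra_hom \<phi> B (quot_map C J \<psi>) (C Quot J).
           \<exists>v \<in> algebra_hom \<phi> B \<psi> C. \<forall>b\<in>carrier B. J +>\<^bsub>C\<^esub> v b = u b))"

definition finitely_presented :: "('r::comm_ring_1 \<Rightarrow> 'b) \<Rightarrow> 'b ring \<Rightarrow> bool" where
  "finitely_presented \<phi> B \<longleftrightarrow>
     (\<exists>(m::nat) S. let P = mpoly_ring {..<m}; I = genideal P S in
        finite S \<and> S \<subseteq> carrier P \<and> algebra_iso (quot_map P I Const) (P Quot I) \<phi> B)"

definition smooth :: "('r::comm_ring_1 \<Rightarrow> 'b) \<Rightarrow> 'b ring \<Rightarrow> bool" where
  "smooth \<phi> B \<longleftrightarrow> is_algebra \<phi> B \<and> finitely_presented \<phi> B \<and> formally_smooth \<phi> B"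


subsection \<open>Smoothable algebras\<close>

text \<open>
  Every \<open>K[[t]]\<close>-algebra that is free of finite rank \<open>r\<close> is isomorphic to one with underlying set
  \<open>K[[t]]\<^sup>r\<close>, so it is enough to let the total algebra live on the type \<open>nat \<Rightarrow> 'a fps\<close>.  The special
  fibre condition forces \<open>A\<close> to be a finite algebra.
\<close>

definition smoothable :: "('a::field \<Rightarrow> 'b) \<Rightarrow> 'b ring \<Rightarrow> bool" where
  "smoothable \<iota> A \<longleftrightarrow> is_algebra \<iota> A \<and>
     (\<exists>(B :: (nat \<Rightarrow> 'a fps) ring) \<phi>. let I = cgenideal B (\<phi> fps_X) in
        is_algebra \<phi> B \<and> free_of_finite_rank \<phi> B \<and>
        algebra_iso (quot_map B I (\<lambda>c. \<phi> (fps_const c))) (B Quot I) \<iota> A \<and>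
        smooth (laurent_map \<phi> B) (localization B (\<phi> fps_X)))"


section \<open>Apolar algebras\<close>

text \<open>
  The dual ring \<open>K[\<alpha>\<^sub>i | i \<in> V]\<close> is represented by \<open>polys V\<close> as well, \<open>\<alpha>\<^sub>i\<close> being \<open>Var i\<close>.
\<close>

definition partial :: "nat \<Rightarrow> (nat, 'a::comm_ring_1) mpoly \<Rightarrow> (nat, 'a) mpoly" where
  "partial i f = (\<Sum>m\<in>Poly_Mapping.keys f.
     Poly_Mapping.single (m - Poly_Mapping.single i 1)
       (of_nat (Poly_Mapping.lookup m i) * Poly_Mapping.lookup f m))"

definition mon_act :: "(nat \<Rightarrow>\<^sub>0 nat) \<Rightarrow> (nat, 'a::comm_ring_1) mpoly \<Rightarrow> (nat, 'a) mpoly" where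
  "mon_act a f = foldr (\<lambda>i. partial i ^^ Poly_Mapping.lookup a i)
     (sorted_list_of_set (Poly_Mapping.keys a)) f"

definition act :: "(nat, 'a::comm_ring_1) mpoly \<Rightarrow> (nat, 'a) mpoly \<Rightarrow> (nat, 'a) mpoly" where
  "act \<sigma> f = (\<Sum>a\<in>Poly_Mapping.keys \<sigma>. Const (Poly_Mapping.lookup \<sigma> a) * mon_act a f)"

definition Ann :: "nat set \<Rightarrow> (nat, 'a::comm_ring_1) mpoly \<Rightarrow> (nat, 'a) mpoly set" where
  "Ann V f = {\<sigma> \<in> polys V. act \<sigma> f = 0}"

definition Ap :: "nat set \<Rightarrow> (nat, 'a::comm_ring_1) mpoly \<Rightarrow> (nat, 'a) mpoly set ring" where
  "Ap V f = mpoly_ring V Quot Ann V f"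

definition Ap_scalar :: "nat set \<Rightarrow> (nat, 'a::comm_ring_1) mpoly \<Rightarrow> 'a \<Rightarrow> (nat, 'a) mpoly set" where
  "Ap_scalar V f = quot_map (mpoly_ring V) (Ann V f) Const"

definition concise :: "nat set \<Rightarrow> (nat, 'a::comm_ring_1) mpoly \<Rightarrow> bool" where
  "concise V F \<longleftrightarrow> \<not> (\<exists>\<sigma>\<in>Ann V F. \<sigma> \<noteq> 0 \<and> tdeg \<sigma> \<le> 1)"

definition encompassing :: "nat set \<Rightarrow> (nat, 'a::comm_ring_1) mpoly \<Rightarrow> bool" where
  "encompassing V f \<longleftrightarrow> (\<forall>h \<in> (\<lambda>\<sigma>. act \<sigma> f) ` polys V. upto_deg 1 h = 0 \<longrightarrow> h = 0)"


section \<open>Border rank\<close>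

definition powersum_le :: "nat set \<Rightarrow> nat \<Rightarrow> nat \<Rightarrow> (nat, 'a::comm_ring_1) mpoly set" where
  "powersum_le V e r = {H. \<exists>s\<le>r. \<exists>c l. (\<forall>i<s. l i \<in> forms V 1) \<and> H = (\<Sum>i<s. Const (c i) * l i ^ e)}"

text \<open>
  Zariski closure in the affine space of forms of degree \<open>e\<close>.  The polynomial functions on it are
  the polynomials \<open>P\<close> in the coefficients, so the variables of \<open>P\<close> are monomials.
\<close>

definition zariski_closure ::
    "nat set \<Rightarrow> nat \<Rightarrow> (nat, 'a::comm_ring_1) mpoly set \<Rightarrow> (nat, 'a) mpoly set" where
  "zariski_closure V e S = {H \<in> forms V e. \<forall>P :: (nat \<Rightarrow>\<^sub>0 nat, 'a) mpoly.
     (\<forall>H'\<in>S. poly_eval id (Poly_Mapping.lookup H') P = 0) \<longrightarrow>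
     poly_eval id (Poly_Mapping.lookup H) P = 0}"

definition border_rank :: "nat set \<Rightarrow> (nat, 'a::comm_ring_1) mpoly \<Rightarrow> nat" where
  "border_rank V H = (LEAST r. H \<in> zariski_closure V (tdeg H) (powersum_le V (tdeg H) r))"

end

theory Submission
  imports Defs
begin

text \<open>
  Let \<open>\<phi>\<close> be the functional \<open>\<sigma> \<mapsto> (\<sigma> \<circ> f)(0)\<close> on the apolar algebra \<open>A\<close> of \<open>f\<close>; then \<open>f = \<phi> (exp (\<Sum>i. x\<^sub>i \<alpha>\<^sub>i))\<close>.
  Conciseness of \<open>F\<close> says that \<open>1, \<alpha>\<^sub>1, \<dots>, \<alpha>\<^sub>k\<close> are linearly independent in \<open>A\<close>, so they extend to a basis
  \<open>1, \<sigma>\<^sub>1, \<dots>, \<sigma>\<^sub>n\<close> with all \<open>\<sigma>\<^sub>i\<close> in the maximal ideal.  The polynomial \<open>g = \<phi> (exp (\<Sum>i. x\<^sub>i \<sigma>\<^sub>i))\<close> has the same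
  apolar algebra as \<open>f\<close>, restricts to \<open>f\<close>, and is encompassing because the linear part of \<open>\<tau> \<circ> g\<close> records the
  values of \<open>\<phi>\<close> at the products of \<open>\<tau>\<close> with a basis; its homogenization is \<open>G\<close>.

  For the border rank let \<open>B\<close> be a smoothing of \<open>A\<close>.  Formal smoothness in characteristic zero forces the
  tangent spaces of the finite algebra \<open>B[1/t]\<close> at its geometric points to vanish, so over the algebraic
  closure of \<open>K((t))\<close> every functional on it is a combination of at most \<open>n + 1\<close> evaluations at points.  Lifting
  \<open>\<phi>\<close> to \<open>B\<close> therefore deforms \<open>f\<close> to a combination of \<open>n + 1\<close> exponentials of linear forms, \<open>f\<^sup>d\<close> to one of
  \<open>(n + d) choose d\<close> exponentials, and \<open>tw (F\<^sup>d)\<close> to a combination of as many powers of linear forms.  A polynomial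
  vanishing on all such combinations over \<open>K\<close> vanishes on those over the big field, hence at \<open>t = 0\<close>.
\<close>

section \<open>Polynomials\<close>

text \<open>The points \<open>\<xi> j\<close> and the weights \<open>l j\<close> live in an
  algebraic closure of K((t)) and may have poles at t = 0, so the summands of the deformed form
  cannot be specialised one by one. Only the moments \<open>\<Phi> \<beta>\<close> which they add up
  to lie in K[[t]]; the limit is therefore taken on the coefficients of the whole form, through the
  injection of K[[t]] into the big field. The twist enters because the part of degree D of exp (x_0
  + L) is (x_0 + L)^D / D!: homogenising exp L and dividing by the factorial of the exponent of x_0
  yields exactly a power of a linear form. The number (n + d) choose d counts the multisets of d
  exponentials out of n + 1. In the construction of \<open>G\<close> the delicate property is
  conciseness. Independence of the \<open>\<sigma> i\<close> controls the derivatives by x_1, ...,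
  x_n only; the derivative by x_0 acts like a degree operator and is excluded by nilpotency of the
  maximal ideal, an argument for degree at least 2. Lower degrees are settled separately.\<close>

declare One_nat_def [simp del]

abbreviation lookup where "lookup \<equiv> Poly_Mapping.lookup"
abbreviation keys where "keys \<equiv> Poly_Mapping.keys"
abbreviation single where "single \<equiv> Poly_Mapping.single"

text \<open>Homomorphisms of type-class rings as a predicate: evaluations, coefficient maps and
  specialisations all depend on parameters and share these few transfer rules.\<close>

locale ring_map =
  fixes h :: "'a::comm_ring_1 \<Rightarrow> 'b::comm_ring_1"
  assumes add: "h (x + y) = h x + h y"
    and mult: "h (x * y) = h x * h y"
    and one: "h 1 = 1"
begin

lemma zero: "h 0 = 0"
  using add[of 0 0] by simp

lemma uminus: "h (- x) = - h x"
  using add[of x "- x"] zero by (simp add: eq_neg_iff_add_eq_0 add.commute)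

lemma diff: "h (x - y) = h x - h y"
  using add[of x "- y"] uminus by simp

lemma sum: "h (\<Sum>i\<in>A. f i) = (\<Sum>i\<in>A. h (f i))"
  by (induction A rule: infinite_finite_induct) (auto simp: zero add)

lemma prod: "h (\<Prod>i\<in>A. f i) = (\<Prod>i\<in>A. h (f i))"
  by (induction A rule: infinite_finite_induct) (auto simp: one mult)

lemma power: "h (x ^ n) = h x ^ n"
  by (induction n) (auto simp: one mult)

lemma of_nat: "h (of_nat n) = of_nat n"
  by (induction n) (auto simp: zero one add)

end

lemma ring_map_comp: "ring_map g \<Longrightarrow> ring_map h \<Longrightarrow> ring_map (\<lambda>x. g (h x))"
  unfolding ring_map_def by simp

lemma ring_map_id: "ring_map id" "ring_map (\<lambda>x. x)"
  by unfold_locales auto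

section \<open>Monomials: evaluation, degree, induction\<close>

lemma keys_add_nat: "keys (a + b) = keys a \<union> keys b" for a b :: "'v \<Rightarrow>\<^sub>0 nat"
  by (auto simp: in_keys_iff lookup_add)

definition mon_eval :: "('v \<Rightarrow> 'b::comm_ring_1) \<Rightarrow> ('v \<Rightarrow>\<^sub>0 nat) \<Rightarrow> 'b" where
  "mon_eval \<xi> m = (\<Prod>v\<in>keys m. \<xi> v ^ lookup m v)"

lemma mon_eval_superset:
  assumes "finite A" "keys m \<subseteq> A"
  shows "mon_eval \<xi> m = (\<Prod>v\<in>A. \<xi> v ^ lookup m v)"
  unfolding mon_eval_def by (rule prod.mono_neutral_left) (use assms in \<open>auto simp: in_keys_iff\<close>)

lemma mon_eval_add: "mon_eval \<xi> (a + b) = mon_eval \<xi> a * mon_eval \<xi> b"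
proof -
  let ?A = "keys a \<union> keys b"
  have "mon_eval \<xi> (a + b) = (\<Prod>v\<in>?A. \<xi> v ^ lookup (a + b) v)"
    by (rule mon_eval_superset) (auto simp: keys_add_nat)
  also have "\<dots> = (\<Prod>v\<in>?A. \<xi> v ^ lookup a v) * (\<Prod>v\<in>?A. \<xi> v ^ lookup b v)"
    by (simp add: lookup_add power_add prod.distrib)
  also have "\<dots> = mon_eval \<xi> a * mon_eval \<xi> b"
    by (simp add: mon_eval_superset[of ?A])
  finally show ?thesis .
qed

lemma mon_eval_0 [simp]: "mon_eval \<xi> 0 = 1"
  by (simp add: mon_eval_def)

lemma mon_eval_single [simp]: "mon_eval \<xi> (single v n) = \<xi> v ^ n"
  by (cases "n = 0") (simp_all add: mon_eval_def)

lemma mon_eval_cong: "(\<And>v. v \<in> keys m \<Longrightarrow> \<xi> v = \<xi>' v) \<Longrightarrow> mon_eval \<xi> m = mon_eval \<xi>' m"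
  unfolding mon_eval_def by (intro prod.cong) auto

lemma (in ring_map) mon_eval: "h (mon_eval \<xi> m) = mon_eval (\<lambda>v. h (\<xi> v)) m"
  by (simp add: mon_eval_def prod power)

lemma mon_deg_superset:
  assumes "finite A" "keys m \<subseteq> A"
  shows "mon_deg m = (\<Sum>v\<in>A. lookup m v)"
  unfolding mon_deg_def by (rule sum.mono_neutral_left) (use assms in \<open>auto simp: in_keys_iff\<close>)

lemma mon_deg_add: "mon_deg (a + b) = mon_deg a + mon_deg b"
proof -
  let ?A = "keys a \<union> keys b"
  have "mon_deg (a + b) = (\<Sum>v\<in>?A. lookup (a + b) v)"
    by (rule mon_deg_superset) (auto simp: keys_add_nat)
  also have "\<dots> = mon_deg a + mon_deg b"
    by (simp add: lookup_add sum.distrib mon_deg_superset[of ?A])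
  finally show ?thesis .
qed

lemma mon_deg_0 [simp]: "mon_deg 0 = 0"
  by (simp add: mon_deg_def)

lemma mon_deg_single [simp]: "mon_deg (single v n) = n"
  by (cases "n = 0") (simp_all add: mon_deg_def)

lemma mon_deg_eq_0_iff: "mon_deg m = 0 \<longleftrightarrow> m = 0"
proof
  assume "mon_deg m = 0"
  hence "\<And>v. lookup m v = 0" by (auto simp: mon_deg_def in_keys_iff)
  thus "m = 0" by (intro poly_mapping_eqI) simp
qed simp

lemma mon_split:
  assumes "v \<in> keys m"
  obtains m' where "m = m' + single v (1::nat)"
proof
  show "m = (m - single v 1) + single v 1"
    using assms by (intro poly_mapping_eqI) (auto simp: lookup_add lookup_minus lookup_single in_keys_iff when_def)
qed

lemma mon_induct [case_names zero add]:
  assumes "P 0" "\<And>m v. P m \<Longrightarrow> P (m + single v 1)"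
  shows "P (m :: 'v \<Rightarrow>\<^sub>0 nat)"
proof (induction "mon_deg m" arbitrary: m)
  case 0
  thus ?case using assms(1) by (simp add: mon_deg_eq_0_iff)
next
  case (Suc n)
  then obtain v where "v \<in> keys m" by (metis Zero_not_Suc equals0I keys_eq_empty mon_deg_0)
  then obtain m' where m': "m = m' + single v 1" by (rule mon_split)
  hence "P m'" using Suc by (simp add: mon_deg_add)
  thus ?case using assms(2) m' by simp
qed

subsection \<open>Evaluation\<close>

lemma poly_eval_def': "poly_eval \<iota> \<xi> p = (\<Sum>m\<in>keys p. \<iota> (lookup p m) * mon_eval \<xi> m)"
  by (simp add: poly_eval_def mon_eval_def)

lemma poly_eval_superset:
  assumes "\<iota> 0 = 0" "finite A" "keys p \<subseteq> A"
  shows "poly_eval \<iota> \<xi> p = (\<Sum>m\<in>A. \<iota> (lookup p m) * mon_eval \<xi> m)"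
  unfolding poly_eval_def' by (rule sum.mono_neutral_left) (use assms in \<open>auto simp: in_keys_iff\<close>)

lemma poly_eval_cong:
  assumes "\<And>m v. m \<in> keys p \<Longrightarrow> v \<in> keys m \<Longrightarrow> \<xi> v = \<xi>' v"
  shows "poly_eval \<iota> \<xi> p = poly_eval \<iota> \<xi>' p"
  unfolding poly_eval_def' using assms by (intro sum.cong refl arg_cong2[where f="(*)"] mon_eval_cong) auto

lemma poly_eval_cong_polys:
  "p \<in> polys V \<Longrightarrow> (\<And>v. v \<in> V \<Longrightarrow> \<xi> v = \<xi>' v) \<Longrightarrow> poly_eval \<iota> \<xi> p = poly_eval \<iota> \<xi>' p"
  by (rule poly_eval_cong) (auto simp: polys_def)

lemma poly_sum_monomials: "p = (\<Sum>m\<in>keys p. single m (lookup p m))"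
  by (rule poly_mapping_eqI) (auto simp: lookup_sum lookup_single when_def in_keys_iff)

lemma mpoly_induct [case_names zero single add]:
  fixes p :: "('v, 'a::comm_ring_1) mpoly"
  assumes "P 0" and "\<And>m c. P (single m c)" and "\<And>p q. P p \<Longrightarrow> P q \<Longrightarrow> P (p + q)"
  shows "P p"
proof -
  have "P (\<Sum>m\<in>A. single m (lookup p m))" if "finite A" for A
    using that by (induction A) (auto intro: assms)
  from this[of "keys p"] show ?thesis using poly_sum_monomials[of p] by simp
qed

context ring_map
begin

lemma poly_eval_single: "poly_eval h \<xi> (single m c) = h c * mon_eval \<xi> m"
  by (cases "c = 0") (simp_all add: poly_eval_def' zero)

lemma poly_eval_add: "poly_eval h \<xi> (p + q) = poly_eval h \<xi> p + poly_eval h \<xi> q"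
proof -
  let ?A = "keys p \<union> keys q"
  have "poly_eval h \<xi> (p + q) = (\<Sum>m\<in>?A. h (lookup (p + q) m) * mon_eval \<xi> m)"
    by (rule poly_eval_superset) (auto simp: zero keys_add)
  also have "\<dots> = poly_eval h \<xi> p + poly_eval h \<xi> q"
    by (simp add: lookup_add add sum.distrib poly_eval_superset[of h ?A] zero distrib_right)
  finally show ?thesis .
qed

lemma poly_eval_0: "poly_eval h \<xi> 0 = 0"
  by (simp add: poly_eval_def)

lemma poly_eval_mult: "poly_eval h \<xi> (p * q) = poly_eval h \<xi> p * poly_eval h \<xi> q"
proof (induction p rule: mpoly_induct)
  case (single m c)
  show ?case
  proof (induction q rule: mpoly_induct)
    case (single m' c')
    show ?case by (simp add: mult_single poly_eval_single mult mon_eval_add mult_ac)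
  qed (simp_all add: poly_eval_0 poly_eval_add distrib_left)
qed (simp_all add: poly_eval_0 poly_eval_add distrib_right)

lemma poly_eval_1: "poly_eval h \<xi> 1 = 1"
  using poly_eval_single[of \<xi> 0 1] by (simp add: one)

lemma ring_map_poly_eval: "ring_map (poly_eval h \<xi>)"
  by unfold_locales (simp_all add: poly_eval_add poly_eval_mult poly_eval_1)

lemma poly_eval_Const [simp]: "poly_eval h \<xi> (Const c) = h c"
  by (simp add: Const_def poly_eval_single)

lemma poly_eval_Var [simp]: "poly_eval h \<xi> (Var v) = \<xi> v"
  by (simp add: Var_def poly_eval_single one)

end

lemma (in ring_map) hom_poly_eval:
  "h (poly_eval \<iota> \<xi> p) = poly_eval (\<lambda>c. h (\<iota> c)) (\<lambda>v. h (\<xi> v)) p"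
  by (simp add: poly_eval_def' sum mult mon_eval)

lemma Const_0 [simp]: "Const 0 = 0"
  by (simp add: Const_def)

lemma Const_1 [simp]: "Const 1 = 1"
  by (simp add: Const_def)

lemma ring_map_Const: "ring_map (Const :: 'a::comm_ring_1 \<Rightarrow> ('v, 'a) mpoly)"
  by unfold_locales (simp_all add: Const_def single_add mult_single)

lemma Const_add: "Const (a + b) = Const a + Const (b::'a::comm_ring_1)"
  and Const_mult: "Const (a * b) = Const a * Const (b::'a::comm_ring_1)"
  by (simp_all add: ring_map.add[OF ring_map_Const] ring_map.mult[OF ring_map_Const])

lemma lookup_Const_mult [simp]: "lookup (Const c * p) m = c * lookup p m" for c :: "'a::comm_ring_1"
proof (induction p rule: mpoly_induct)
  case (single m' d)
  show ?case by (simp add: Const_def mult_single lookup_single when_def)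
qed (simp_all add: distrib_left lookup_add)

lemma lookup_Const: "lookup (Const c) m = (if m = 0 then c else 0)"
  by (simp add: Const_def lookup_single when_def)

lemma lookup_Var: "lookup (Var v) m = (if m = single v 1 then 1 else 0)"
  by (simp add: Var_def lookup_single when_def)

lemma lookup_single_mult:
  fixes p :: "('v, 'a::comm_ring_1) mpoly"
  shows "lookup (single a c * p) (a + m) = c * lookup p m"
proof (induction p rule: mpoly_induct)
  case (single m' d)
  show ?case by (simp add: mult_single lookup_single when_def)
qed (simp_all add: distrib_left lookup_add)

lemma mon_eval_Var: "mon_eval Var m = (single m 1 :: ('v, 'a::comm_ring_1) mpoly)"
proof (induction m rule: mon_induct)
  case (add m v)
  thus ?case by (simp add: mon_eval_add Var_def mult_single)
qed simp

lemma poly_eval_Const_Var: "poly_eval Const Var p = (p :: ('v, 'a::comm_ring_1) mpoly)"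
proof -
  have "poly_eval Const Var p = (\<Sum>m\<in>keys p. single m (lookup p m))"
    by (simp add: poly_eval_def' mon_eval_Var Const_def mult_single)
  thus ?thesis using poly_sum_monomials[of p] by simp
qed

subsection \<open>Polynomials on a set of variables\<close>

lemma polys_0 [simp]: "0 \<in> polys V"
  by (simp add: polys_def)

lemma polys_single: "keys m \<subseteq> V \<Longrightarrow> single m c \<in> polys V"
  by (cases "c = 0") (simp_all add: polys_def)

lemma polys_Const [simp]: "Const c \<in> polys V"
  unfolding Const_def by (rule polys_single) simp

lemma polys_1 [simp]: "(1::('v, 'a::zero_neq_one) mpoly) \<in> polys V"
  using polys_Const[of "1::'a" V] by simp

lemma polys_Var: "v \<in> V \<Longrightarrow> Var v \<in> polys V"
  unfolding Var_def by (rule polys_single) simp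

lemma polys_add: "p \<in> polys V \<Longrightarrow> q \<in> polys V \<Longrightarrow> p + q \<in> polys V"
  using keys_add[of p q] unfolding polys_def by blast

lemma polys_uminus: "p \<in> polys V \<Longrightarrow> - p \<in> polys V" for p :: "('v, 'a::comm_ring_1) mpoly"
  by (simp add: polys_def in_keys_iff)

lemma polys_diff: "p \<in> polys V \<Longrightarrow> q \<in> polys V \<Longrightarrow> p - q \<in> polys V"
  for p :: "('v, 'a::comm_ring_1) mpoly"
  using polys_add[of p V "- q"] polys_uminus[of q V] by simp

lemma polys_mult: "p \<in> polys V \<Longrightarrow> q \<in> polys V \<Longrightarrow> p * q \<in> polys V"
  for p :: "('v, 'a::comm_ring_1) mpoly"
  using keys_mult[of p q] unfolding polys_def by (fastforce simp: keys_add_nat)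

lemma polys_power: "p \<in> polys V \<Longrightarrow> p ^ n \<in> polys V" for p :: "('v, 'a::comm_ring_1) mpoly"
  by (induction n) (auto intro: polys_mult)

lemma polys_sum: "(\<And>i. i \<in> A \<Longrightarrow> p i \<in> polys V) \<Longrightarrow> (\<Sum>i\<in>A. p i) \<in> polys V"
  by (induction A rule: infinite_finite_induct) (auto intro: polys_add)

lemma polys_prod: "(\<And>i. i \<in> A \<Longrightarrow> p i \<in> polys V) \<Longrightarrow> (\<Prod>i\<in>A. p i) \<in> polys V"
  for p :: "'i \<Rightarrow> ('v, 'a::comm_ring_1) mpoly"
  by (induction A rule: infinite_finite_induct) (auto intro: polys_mult)

lemma polys_mon_eval: "(\<And>v. v \<in> keys m \<Longrightarrow> \<xi> v \<in> polys W) \<Longrightarrow> mon_eval \<xi> m \<in> polys W"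
  for \<xi> :: "'w \<Rightarrow> ('v, 'a::comm_ring_1) mpoly"
  unfolding mon_eval_def by (intro polys_prod polys_power)

lemma polys_poly_eval:
  fixes \<xi> :: "'w \<Rightarrow> ('v, 'a::comm_ring_1) mpoly"
  assumes "p \<in> polys V" "\<And>v. v \<in> V \<Longrightarrow> \<xi> v \<in> polys W"
  shows "poly_eval Const \<xi> p \<in> polys W"
  unfolding poly_eval_def'
proof (intro polys_sum polys_mult polys_mon_eval polys_Const)
  fix m v assume "m \<in> keys p" "v \<in> keys m"
  thus "\<xi> v \<in> polys W" using assms(1) by (intro assms(2)) (auto simp: polys_def)
qed

lemma polys_mono: "V \<subseteq> W \<Longrightarrow> polys V \<subseteq> polys W"
  by (auto simp: polys_def)

lemma polys_lookup: "p \<in> polys V \<Longrightarrow> lookup p m \<noteq> 0 \<Longrightarrow> keys m \<subseteq> V"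
  by (auto simp: polys_def in_keys_iff)

lemma polysI: "(\<And>m. lookup p m \<noteq> 0 \<Longrightarrow> keys m \<subseteq> V) \<Longrightarrow> p \<in> polys V"
  by (auto simp: polys_def in_keys_iff)

lemma forms_lookup: "p \<in> forms V e \<Longrightarrow> lookup p m \<noteq> 0 \<Longrightarrow> keys m \<subseteq> V \<and> mon_deg m = e"
  by (auto simp: forms_def polys_def in_keys_iff)

lemma formsI: "(\<And>m. lookup p m \<noteq> 0 \<Longrightarrow> keys m \<subseteq> V \<and> mon_deg m = e) \<Longrightarrow> p \<in> forms V e"
  by (auto simp: forms_def polys_def in_keys_iff)

lemma forms_1: "(1::('v,'a::comm_ring_1) mpoly) \<in> forms V 0"
  by (rule formsI) (auto simp: lookup_one when_def split: if_splits)

lemma lookup_mult_nonzeroE: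
  assumes "lookup (p * q) m \<noteq> 0"
  obtains a b where "m = a + b" "lookup p a \<noteq> 0" "lookup q b \<noteq> 0"
  using assms keys_mult[of p q] by (auto simp: in_keys_iff)

lemma forms_mult: "p \<in> forms V d \<Longrightarrow> q \<in> forms V e \<Longrightarrow> p * q \<in> forms V (d + e)"
  for p :: "('v, 'a::comm_ring_1) mpoly"
proof (rule formsI)
  fix m assume p: "p \<in> forms V d" "q \<in> forms V e" and "lookup (p * q) m \<noteq> 0"
  then obtain a b where "m = a + b" "lookup p a \<noteq> 0" "lookup q b \<noteq> 0" by (elim lookup_mult_nonzeroE)
  thus "keys m \<subseteq> V \<and> mon_deg m = d + e"
    using forms_lookup p by (auto simp: keys_add_nat mon_deg_add dest!: forms_lookup)
qed

lemma forms_power: "p \<in> forms V e \<Longrightarrow> p ^ n \<in> forms V (e * n)"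
  for p :: "('v, 'a::comm_ring_1) mpoly"
proof (induction n)
  case (Suc n)
  thus ?case using forms_mult[of p V e "p ^ n" "e * n"] by simp
qed (simp add: forms_1)

lemma tdeg_forms: "p \<in> forms V e \<Longrightarrow> p \<noteq> 0 \<Longrightarrow> tdeg p = e"
proof -
  assume p: "p \<in> forms V e" "p \<noteq> 0"
  hence "mon_deg ` keys p = {e}" by (force simp: forms_def image_iff simp flip: keys_eq_empty)
  thus ?thesis by (simp add: tdeg_def)
qed

lemma tdeg_le_iff: "tdeg p \<le> n \<longleftrightarrow> (\<forall>m. lookup p m \<noteq> 0 \<longrightarrow> mon_deg m \<le> n)"
  by (auto simp: tdeg_def in_keys_iff)

lemma finite_monomials:
  assumes "finite W"
  shows "finite {m :: 'v \<Rightarrow>\<^sub>0 nat. keys m \<subseteq> W \<and> mon_deg m \<le> s}"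
proof (induction s)
  case 0
  have "{m :: 'v \<Rightarrow>\<^sub>0 nat. keys m \<subseteq> W \<and> mon_deg m \<le> 0} \<subseteq> {0}"
    by (auto simp: mon_deg_eq_0_iff)
  thus ?case by (rule finite_subset) simp
next
  case (Suc s)
  let ?M = "\<lambda>s. {m :: 'v \<Rightarrow>\<^sub>0 nat. keys m \<subseteq> W \<and> mon_deg m \<le> s}"
  have "?M (Suc s) \<subseteq> insert 0 ((\<lambda>(m, v). m + single v 1) ` (?M s \<times> W))"
  proof
    fix m assume m: "m \<in> ?M (Suc s)"
    show "m \<in> insert 0 ((\<lambda>(m, v). m + single v 1) ` (?M s \<times> W))"
    proof (cases "m = 0")
      case False
      then obtain v where v: "v \<in> keys m" by (metis equals0I keys_eq_empty)
      then obtain m' where m': "m = m' + single v 1" by (rule mon_split)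
      have "(m', v) \<in> ?M s \<times> W" using m v m' by (auto simp: mon_deg_add keys_add_nat)
      thus ?thesis using m' by (auto simp: image_iff)
    qed simp
  qed
  thus ?case by (rule finite_subset) (use Suc assms in auto)
qed

text \<open>The multi-index factorial, which is the value of the operator monomial \<open>m\<close>
  on the monomial \<open>m\<close> itself and hence the normalisation of the apolarity
  pairing.\<close>

definition mfact :: "('v \<Rightarrow>\<^sub>0 nat) \<Rightarrow> nat" where
  "mfact m = (\<Prod>v\<in>keys m. fact (lookup m v))"

lemma mfact_superset:
  assumes "finite A" "keys m \<subseteq> A"
  shows "mfact m = (\<Prod>v\<in>A. fact (lookup m v))"
  unfolding mfact_def by (rule prod.mono_neutral_left) (use assms in \<open>auto simp: in_keys_iff\<close>)

lemma mfact_0 [simp]: "mfact 0 = 1"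
  by (simp add: mfact_def)

lemma mfact_pos: "mfact m > 0"
  by (simp add: mfact_def prod_pos)

lemma mfact_nz [simp]: "mfact m \<noteq> 0"
  using mfact_pos[of m] by simp

lemma mfact_single [simp]: "mfact (single v n) = fact n"
  by (cases "n = 0") (simp_all add: mfact_def)

lemma mfact_add_disjoint:
  assumes "keys a \<inter> keys b = {}"
  shows "mfact (a + b) = mfact a * mfact b"
proof -
  have 0: "lookup a v = 0 \<or> lookup b v = 0" for v
    using assms by (auto simp: in_keys_iff)
  have "mfact (a + b) = (\<Prod>v\<in>keys a \<union> keys b. fact (lookup (a + b) v))"
    by (rule mfact_superset) (auto simp: keys_add_nat)
  also have "\<dots> = (\<Prod>v\<in>keys a \<union> keys b. fact (lookup a v) * fact (lookup b v))"
    by (intro prod.cong refl) (metis 0 lookup_add add.right_neutral add_0 fact_0 mult_1 mult_1_right)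
  finally show ?thesis by (simp add: prod.distrib mfact_superset[of "keys a \<union> keys b"])
qed

lemma mfact_add_single: "mfact (m + single v 1) = (lookup m v + 1) * mfact m"
proof -
  let ?A = "insert v (keys m)"
  have "mfact (m + single v 1) = (\<Prod>w\<in>?A. fact (lookup (m + single v 1) w))"
    by (rule mfact_superset) (auto simp: keys_add_nat)
  also have "\<dots> = (\<Prod>w\<in>?A. (if w = v then lookup m v + 1 else 1) * fact (lookup m w))"
    by (rule prod.cong) (auto simp: lookup_add lookup_single when_def simp flip: Suc_eq_plus1)
  also have "\<dots> = (lookup m v + 1) * (\<Prod>w\<in>?A. fact (lookup m w))"
    by (simp add: prod.distrib)
  also have "(\<Prod>w\<in>?A. fact (lookup m w)) = mfact m" by (rule mfact_superset[symmetric]) auto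
  finally show ?thesis .
qed

section \<open>The apolarity pairing\<close>

lemma lookup_partial:
  "lookup (partial i f) b = of_nat (lookup b i + 1) * lookup f (b + single i 1)"
proof -
  \<comment> \<open>Exponent subtraction is truncated, so a monomial \<open>b\<close> without x_i is
    also sent to \<open>b\<close>; such terms carry the factor \<open>lookup m i\<close> =
    0.\<close>
  have eq: "(m - single i 1 = b \<and> lookup m i \<noteq> 0) \<longleftrightarrow> m = b + single i 1" for m :: "nat \<Rightarrow>\<^sub>0 nat"
  proof (intro iffI conjI; (elim conjE)?)
    assume b: "m - single i 1 = b" and "lookup m i \<noteq> 0"
    then obtain m' where "m = m' + single i 1" by (metis in_keys_iff mon_split)
    thus "m = b + single i 1" using b by simp
  qed (simp_all add: lookup_add)
  have tm: "lookup (single (m - single i 1) (of_nat (lookup m i) * lookup f m)) b =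
      (if m = b + single i 1 then of_nat (lookup m i) * lookup f m else 0)" for m
    using eq[of m] by (cases "lookup m i = 0") (auto simp: lookup_single when_def)
  have "lookup (partial i f) b = (\<Sum>m\<in>keys f. if m = b + single i 1 then
     of_nat (lookup m i) * lookup f m else 0)"
    unfolding partial_def lookup_sum tm ..
  also have "\<dots> = of_nat (lookup b i + 1) * lookup f (b + single i 1)"
    by (simp add: lookup_add in_keys_iff)
  finally show ?thesis .
qed

text \<open>In the divided power basis x^b / b! differentiation is a plain shift of coefficients.
  The later formulas keep this normalisation, which composes without correction factors.\<close>

lemma lookup_partial_mfact:
  "of_nat (mfact b) * lookup (partial i f) b = of_nat (mfact (b + single i 1)) * lookup f (b + single i 1)"
  unfolding lookup_partial mfact_add_single by (simp add: mult_ac)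

lemma lookup_partial_pow_mfact:
  "of_nat (mfact b) * lookup ((partial i ^^ n) f) b = of_nat (mfact (b + single i n)) * lookup f (b + single i n)"
proof (induction n arbitrary: b)
  case (Suc n)
  have "of_nat (mfact b) * lookup ((partial i ^^ Suc n) f) b
     = of_nat (mfact (b + single i 1)) * lookup ((partial i ^^ n) f) (b + single i 1)"
    using lookup_partial_mfact[of b i "(partial i ^^ n) f"] by simp
  also have "\<dots> = of_nat (mfact (b + single i 1 + single i n)) * lookup f (b + single i 1 + single i n)"
    by (rule Suc)
  also have "b + single i 1 + single i n = b + single i (Suc n)"
    by (simp add: add.assoc flip: single_add Suc_eq_plus1_left)
  finally show ?case .
qed simp

lemma lookup_mon_act_mfact:
  "of_nat (mfact b) * lookup (mon_act a f) b = of_nat (mfact (a + b)) * lookup f (a + b)"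
proof -
  have *: "of_nat (mfact b) * lookup (foldr (\<lambda>i. partial i ^^ lookup a i) xs f) b
     = of_nat (mfact ((\<Sum>i\<in>set xs. single i (lookup a i)) + b)) *
       lookup f ((\<Sum>i\<in>set xs. single i (lookup a i)) + b)" if "distinct xs" for xs
    using that
  proof (induction xs arbitrary: b)
    case (Cons x xs)
    let ?s = "\<Sum>i\<in>set xs. single i (lookup a i)"
    have eq: "?s + (b + single x (lookup a x)) = (\<Sum>i\<in>set (x # xs). single i (lookup a i)) + b"
      using Cons.prems by (simp add: add_ac)
    have "of_nat (mfact b) * lookup (foldr (\<lambda>i. partial i ^^ lookup a i) (x # xs) f) b
      = of_nat (mfact (b + single x (lookup a x))) *
        lookup (foldr (\<lambda>i. partial i ^^ lookup a i) xs f) (b + single x (lookup a x))"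
      by (simp add: lookup_partial_pow_mfact)
    also have "\<dots> = of_nat (mfact (?s + (b + single x (lookup a x)))) *
       lookup f (?s + (b + single x (lookup a x)))"
      using Cons by auto
    finally show ?case unfolding eq .
  qed simp
  have "(\<Sum>i\<in>keys a. single i (lookup a i)) = a"
    using poly_sum_monomials[of a] by simp
  with *[of "sorted_list_of_set (keys a)"] show ?thesis by (simp add: mon_act_def)
qed

text \<open>The constant term of \<open>\<sigma> \<circ> f\<close>; as a functional of \<open>\<sigma>\<close> it generates the module dual to \<open>Ap f\<close>.\<close>

definition apair :: "('v, 'a::comm_ring_1) mpoly \<Rightarrow> ('v, 'a) mpoly \<Rightarrow> 'a" where
  "apair f \<sigma> = (\<Sum>a\<in>keys \<sigma>. lookup \<sigma> a * (of_nat (mfact a) * lookup f a))"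

lemma apair_superset:
  assumes "finite A" "keys \<sigma> \<subseteq> A"
  shows "apair f \<sigma> = (\<Sum>a\<in>A. lookup \<sigma> a * (of_nat (mfact a) * lookup f a))"
  unfolding apair_def by (rule sum.mono_neutral_left) (use assms in \<open>auto simp: in_keys_iff\<close>)

lemma apair_0 [simp]: "apair f 0 = 0"
  by (simp add: apair_def)

lemma apair_add: "apair f (\<sigma> + \<tau>) = apair f \<sigma> + apair f \<tau>"
proof -
  let ?A = "keys \<sigma> \<union> keys \<tau>"
  have "apair f (\<sigma> + \<tau>) = (\<Sum>a\<in>?A. lookup (\<sigma> + \<tau>) a * (of_nat (mfact a) * lookup f a))"
    by (rule apair_superset) (auto simp: keys_add)
  thus ?thesis by (simp add: lookup_add sum.distrib distrib_right apair_superset[of ?A])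
qed

lemma apair_sum: "apair f (\<Sum>i\<in>A. \<sigma> i) = (\<Sum>i\<in>A. apair f (\<sigma> i))"
  by (induction A rule: infinite_finite_induct) (auto simp: apair_add)

lemma apair_single [simp]: "apair f (single a c) = c * (of_nat (mfact a) * lookup f a)"
  by (simp add: apair_superset[of "{a}"])

lemma apair_Const_mult [simp]: "apair f (Const c * \<sigma>) = c * apair f \<sigma>"
proof (induction \<sigma> rule: mpoly_induct)
  case (single m d)
  show ?case by (simp add: Const_def mult_single mult_ac)
qed (simp_all add: distrib_left apair_add)

lemma apair_uminus: "apair f (- \<sigma>) = - apair f \<sigma>"
  using apair_add[of f \<sigma> "- \<sigma>"] by (simp add: eq_neg_iff_add_eq_0 add.commute)

lemma apair_diff: "apair f (\<sigma> - \<tau>) = apair f \<sigma> - apair f \<tau>"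
  using apair_add[of f \<sigma> "- \<tau>"] by (simp add: apair_uminus)

lemma lookup_act_mfact:
  "of_nat (mfact b) * lookup (act \<sigma> f) b = apair f (\<sigma> * single b 1)"
proof -
  have "of_nat (mfact b) * lookup (act \<sigma> f) b
    = (\<Sum>a\<in>keys \<sigma>. lookup \<sigma> a * (of_nat (mfact b) * lookup (mon_act a f) b))"
    by (simp add: act_def lookup_sum sum_distrib_left mult.left_commute)
  also have "\<dots> = (\<Sum>a\<in>keys \<sigma>. apair f (single a (lookup \<sigma> a) * single b 1))"
    by (simp add: lookup_mon_act_mfact mult_single)
  also have "\<dots> = apair f ((\<Sum>a\<in>keys \<sigma>. single a (lookup \<sigma> a)) * single b 1)"
    by (simp only: apair_sum sum_distrib_right)
  finally show ?thesis using poly_sum_monomials[of \<sigma>] by simp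
qed

lemma lookup_act:
  fixes f :: "(nat, 'a::field_char_0) mpoly"
  shows "lookup (act \<sigma> f) b = apair f (\<sigma> * single b 1) / of_nat (mfact b)"
  using lookup_act_mfact[of b \<sigma> f] by (simp add: field_simps)

text \<open>Pairings with monomials are the coefficients of \<open>act \<sigma> f\<close> up to
  factorials, which are invertible in characteristic zero; arbitrary \<open>\<tau>\<close> follow by
  linearity.\<close>

lemma act_eq_0_iff:
  fixes f :: "(nat, 'a::field_char_0) mpoly"
  shows "act \<sigma> f = 0 \<longleftrightarrow> (\<forall>\<tau>. apair f (\<sigma> * \<tau>) = 0)"
proof safe
  fix \<tau> assume "act \<sigma> f = 0"
  hence *: "apair f (\<sigma> * single b 1) = 0" for b using lookup_act_mfact[of b \<sigma> f] by simp
  show "apair f (\<sigma> * \<tau>) = 0"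
  proof (induction \<tau> rule: mpoly_induct)
    case (single m c)
    have "\<sigma> * single m c = Const c * (\<sigma> * single m 1)"
      by (simp add: Const_def mult_single mult.left_commute[of _ \<sigma>])
    thus ?case using *[of m] by (simp only: apair_Const_mult mult_zero_right)
  qed (simp_all add: distrib_left apair_add)
next
  assume "\<forall>\<tau>. apair f (\<sigma> * \<tau>) = 0"
  thus "act \<sigma> f = 0" by (intro poly_mapping_eqI) (simp add: lookup_act)
qed

text \<open>A monomial with a variable outside \<open>V\<close> divides no monomial of
  \<open>f\<close>, so pairing with it gives 0 and tests inside \<open>polys V\<close>
  decide.\<close>

lemma Ann_iff:
  fixes f :: "(nat, 'a::field_char_0) mpoly"
  assumes "f \<in> polys V"
  shows "\<sigma> \<in> Ann V f \<longleftrightarrow> \<sigma> \<in> polys V \<and> (\<forall>\<tau>\<in>polys V. apair f (\<sigma> * \<tau>) = 0)"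
proof safe
  assume s: "\<sigma> \<in> polys V" "\<forall>\<tau>\<in>polys V. apair f (\<sigma> * \<tau>) = 0"
  have "apair f (\<sigma> * single m c) = 0" for m c
  proof (cases "keys m \<subseteq> V")
    case False
    have "apair f (single a d * single m c) = 0" for a d
      using polys_lookup[OF assms, of "a + m"] False by (auto simp: mult_single keys_add_nat)
    hence "apair f (p * single m c) = 0" for p
      by (induction p rule: mpoly_induct) (simp_all add: distrib_right apair_add)
    thus ?thesis .
  qed (use s polys_single in blast)
  hence "apair f (\<sigma> * \<tau>) = 0" for \<tau>
    by (induction \<tau> rule: mpoly_induct) (simp_all add: distrib_left apair_add)
  thus "\<sigma> \<in> Ann V f" using s by (simp add: Ann_def act_eq_0_iff)
qed (auto simp: Ann_def act_eq_0_iff)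

lemma AnnD: "\<sigma> \<in> Ann V f \<Longrightarrow> apair f (\<sigma> * \<tau>) = 0" for f :: "(nat, 'a::field_char_0) mpoly"
  by (simp add: Ann_def act_eq_0_iff)

lemma Ann_polys: "\<sigma> \<in> Ann V f \<Longrightarrow> \<sigma> \<in> polys V"
  by (simp add: Ann_def)

lemma Ann_0 [simp]: "0 \<in> Ann V (f :: (nat, 'a::field_char_0) mpoly)"
  by (simp add: Ann_def act_eq_0_iff)

lemma Ann_add: "\<sigma> \<in> Ann V f \<Longrightarrow> \<tau> \<in> Ann V f \<Longrightarrow> \<sigma> + \<tau> \<in> Ann V f"
  for f :: "(nat, 'a::field_char_0) mpoly"
  by (simp add: Ann_def act_eq_0_iff polys_add distrib_right apair_add)

lemma Ann_mult: "\<sigma> \<in> Ann V f \<Longrightarrow> \<tau> \<in> polys V \<Longrightarrow> \<sigma> * \<tau> \<in> Ann V f"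
  for f :: "(nat, 'a::field_char_0) mpoly"
  by (simp add: Ann_def act_eq_0_iff polys_mult mult.assoc)

text \<open>The d-th power of the ideal generated by the variables, described by coefficients. This
  filtration is the measure of nilpotency in the apolar algebra.\<close>

definition low_deg :: "nat \<Rightarrow> ('v, 'a::zero) mpoly set" where
  "low_deg d = {p. \<forall>m. lookup p m \<noteq> 0 \<longrightarrow> d \<le> mon_deg m}"

lemma low_deg_mult: "p \<in> low_deg d \<Longrightarrow> q \<in> low_deg e \<Longrightarrow> p * q \<in> low_deg (d + e)"
  for p :: "('v, 'a::comm_ring_1) mpoly"
proof -
  assume p: "p \<in> low_deg d" "q \<in> low_deg e"
  have "d + e \<le> mon_deg m" if m: "lookup (p * q) m \<noteq> 0" for m
  proof -
    from m obtain a b where "m = a + b" "lookup p a \<noteq> 0" "lookup q b \<noteq> 0" by (rule lookup_mult_nonzeroE)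
    thus ?thesis using p by (auto simp: mon_deg_add low_deg_def intro!: add_mono)
  qed
  thus ?thesis by (simp add: low_deg_def)
qed

lemma low_deg_0: "p \<in> low_deg 0"
  by (simp add: low_deg_def)

lemma low_deg_mono: "p \<in> low_deg d \<Longrightarrow> e \<le> d \<Longrightarrow> p \<in> low_deg e"
  by (force simp: low_deg_def)

lemma low_deg_1_iff: "p \<in> low_deg 1 \<longleftrightarrow> lookup p 0 = 0"
proof -
  have "1 \<le> mon_deg m \<longleftrightarrow> m \<noteq> 0" for m :: "'a \<Rightarrow>\<^sub>0 nat"
    using mon_deg_eq_0_iff[of m] by linarith
  thus ?thesis by (auto simp: low_deg_def)
qed

lemma low_deg_power: "p \<in> low_deg d \<Longrightarrow> p ^ n \<in> low_deg (d * n)"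
  for p :: "('v, 'a::comm_ring_1) mpoly"
proof (induction n)
  case (Suc n)
  thus ?case using low_deg_mult[of p d "p ^ n" "d * n"] by simp
qed (simp add: low_deg_0)

lemma low_deg_mon_eval:
  fixes \<sigma> :: "'w \<Rightarrow> ('v, 'a::comm_ring_1) mpoly"
  assumes "\<And>v. v \<in> keys m \<Longrightarrow> \<sigma> v \<in> low_deg 1"
  shows "mon_eval \<sigma> m \<in> low_deg (mon_deg m)"
  using assms
proof (induction m rule: mon_induct)
  case (add m v)
  thus ?case using low_deg_mult[of "mon_eval \<sigma> m" "mon_deg m" "\<sigma> v" 1]
    by (simp add: mon_eval_add mon_deg_add keys_add_nat)
qed (simp add: low_deg_0)

lemma apair_low_deg:
  assumes "p \<in> low_deg d" "\<And>m. lookup f m \<noteq> 0 \<Longrightarrow> mon_deg m < d"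
  shows "apair f p = 0"
  unfolding apair_def
proof (rule sum.neutral, rule ballI)
  fix a assume "a \<in> keys p"
  hence "d \<le> mon_deg a" using assms(1) by (auto simp: low_deg_def in_keys_iff)
  hence "lookup f a = 0" using assms(2)[of a] by force
  thus "lookup p a * (of_nat (mfact a) * lookup f a) = 0" by simp
qed

text \<open>Multiplication keeps the order above the degree of \<open>f\<close>. Consequently every
  element of \<open>low_deg 1\<close> is nilpotent in the apolar algebra.\<close>

lemma low_deg_Ann:
  fixes f :: "(nat, 'a::field_char_0) mpoly"
  assumes "p \<in> low_deg d" "p \<in> polys V" "\<And>m. lookup f m \<noteq> 0 \<Longrightarrow> mon_deg m < d"
  shows "p \<in> Ann V f"
proof -
  have "apair f (p * \<tau>) = 0" for \<tau>
    using apair_low_deg[of "p * \<tau>" d f] low_deg_mult[of p d \<tau> 0] assms low_deg_0 by auto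
  thus ?thesis using assms(2) by (simp add: Ann_def act_eq_0_iff)
qed

text \<open>Test against a monomial of top degree of \<open>f\<close>.\<close>

lemma Ann_const_term:
  fixes f :: "(nat, 'a::field_char_0) mpoly"
  assumes "f \<noteq> 0" "\<sigma> \<in> Ann V f"
  shows "lookup \<sigma> 0 = 0"
proof -
  have ne: "keys f \<noteq> {}" using assms(1) by simp
  hence "Max (mon_deg ` keys f) \<in> mon_deg ` keys f" by (intro Max_in) auto
  then obtain b where b: "b \<in> keys f" "Max (mon_deg ` keys f) = mon_deg b" by blast
  have b_max: "mon_deg m \<le> mon_deg b" if "m \<in> keys f" for m
    unfolding b(2)[symmetric] using that by (intro Max_ge) auto
  define \<sigma>' where "\<sigma>' = \<sigma> - Const (lookup \<sigma> 0)"
  have "\<sigma>' \<in> low_deg 1" by (simp add: low_deg_1_iff \<sigma>'_def lookup_minus lookup_Const)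
  moreover have "single b 1 \<in> low_deg (mon_deg b)" by (auto simp: low_deg_def lookup_single when_def)
  ultimately have "\<sigma>' * single b 1 \<in> low_deg (mon_deg b + 1)" using low_deg_mult[of "\<sigma>'" 1 "single b 1" "mon_deg b"] by (simp add: add.commute)
  hence "apair f (\<sigma>' * single b 1) = 0"
    by (rule apair_low_deg) (use b_max in \<open>auto simp: in_keys_iff less_Suc_eq_le simp flip: Suc_eq_plus1\<close>)
  moreover have "\<sigma> * single b 1 = Const (lookup \<sigma> 0) * single b 1 + \<sigma>' * single b 1"
    by (simp add: \<sigma>'_def algebra_simps)
  ultimately have "apair f (\<sigma> * single b 1) = lookup \<sigma> 0 * (of_nat (mfact b) * lookup f b)"
    by (simp add: apair_add)
  thus ?thesis using AnnD[OF assms(2)] b(1) by (simp add: in_keys_iff)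
qed

section \<open>Change of generators\<close>

text \<open>
  The dual generator of the algebra \<open>Ap V f\<close> with respect to the generators \<open>\<sigma> w\<close>, \<open>w \<in> W\<close>:
  formally it is \<open>\<phi> (exp (\<Sum>w. x\<^sub>w \<sigma>\<^sub>w))\<close>, where \<open>\<phi>\<close> is the functional \<open>apair f\<close>.
\<close>

definition dual_gen ::
    "'w set \<Rightarrow> ('w \<Rightarrow> ('v, 'a) mpoly) \<Rightarrow> ('v, 'a::field_char_0) mpoly \<Rightarrow> ('w, 'a) mpoly" where
  "dual_gen W \<sigma> f = (\<Sum>b | keys b \<subseteq> W \<and> mon_deg b \<le> tdeg f.
     single b (apair f (mon_eval \<sigma> b) / of_nat (mfact b)))"

text \<open>The cutoff at \<open>tdeg f\<close> in the definition loses nothing: a product of more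
  than \<open>tdeg f\<close> elements of the maximal ideal pairs to 0 with \<open>f\<close>.\<close>

lemma lookup_dual_gen:
  assumes "finite W" "\<And>w. w \<in> W \<Longrightarrow> \<sigma> w \<in> low_deg 1"
  shows "lookup (dual_gen W \<sigma> f) b =
    (if keys b \<subseteq> W then apair f (mon_eval \<sigma> b) / of_nat (mfact b) else 0)"
proof -
  have "lookup (dual_gen W \<sigma> f) b =
    (if keys b \<subseteq> W \<and> mon_deg b \<le> tdeg f then apair f (mon_eval \<sigma> b) / of_nat (mfact b) else 0)"
    using finite_monomials[OF assms(1), of "tdeg f"]
    by (simp add: dual_gen_def lookup_sum lookup_single when_def)
  moreover have "apair f (mon_eval \<sigma> b) = 0" if "keys b \<subseteq> W" "\<not> mon_deg b \<le> tdeg f"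
  proof (rule apair_low_deg)
    show "mon_eval \<sigma> b \<in> low_deg (mon_deg b)" using that assms by (intro low_deg_mon_eval) auto
    fix m assume "lookup f m \<noteq> 0"
    hence "mon_deg m \<le> tdeg f" using tdeg_le_iff[of f "tdeg f"] by simp
    thus "mon_deg m < mon_deg b" using that by simp
  qed
  ultimately show ?thesis by auto
qed

lemma dual_gen_polys: "dual_gen W \<sigma> f \<in> polys W"
  unfolding dual_gen_def by (intro polys_sum polys_single) auto

text \<open>The characteristic property of the dual generator: its functional is the pullback of
  \<open>apair f\<close> along the substitution of \<open>\<sigma> w\<close> for the variable
  \<open>w\<close>.\<close>

lemma apair_dual_gen:
  assumes "finite W" "\<And>w. w \<in> W \<Longrightarrow> \<sigma> w \<in> low_deg 1" "\<tau> \<in> polys W"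
  shows "apair (dual_gen W \<sigma> f) \<tau> = apair f (poly_eval Const \<sigma> \<tau>)"
proof -
  have "apair f (poly_eval Const \<sigma> \<tau>) = (\<Sum>b\<in>keys \<tau>. lookup \<tau> b * apair f (mon_eval \<sigma> b))"
    by (simp add: poly_eval_def' apair_sum)
  also have "\<dots> = apair (dual_gen W \<sigma> f) \<tau>"
    unfolding apair_def[of _ \<tau>]
  proof (intro sum.cong refl)
    fix b assume "b \<in> keys \<tau>"
    hence "keys b \<subseteq> W" using assms(3) by (auto simp: polys_def)
    thus "lookup \<tau> b * apair f (mon_eval \<sigma> b) = lookup \<tau> b * (of_nat (mfact b) * lookup (dual_gen W \<sigma> f) b)"
      by (simp add: lookup_dual_gen[OF assms(1,2)])
  qed
  finally show ?thesis by simp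
qed

text \<open>Each variable of \<open>V\<close> is its own \<open>\<sigma> v\<close>, so the
  substitution is onto \<open>polys V\<close> and the test operators on the two sides
  correspond.\<close>

lemma Ann_dual_gen:
  fixes f :: "(nat, 'a::field_char_0) mpoly"
  assumes "finite W" "\<And>w. w \<in> W \<Longrightarrow> \<sigma> w \<in> low_deg 1" "\<And>w. w \<in> W \<Longrightarrow> \<sigma> w \<in> polys V"
    and "V \<subseteq> W" "\<And>v. v \<in> V \<Longrightarrow> \<sigma> v = Var v" "f \<in> polys V" "\<tau> \<in> polys W"
  shows "\<tau> \<in> Ann W (dual_gen W \<sigma> f) \<longleftrightarrow> poly_eval Const \<sigma> \<tau> \<in> Ann V f"
proof -
  note hom = ring_map.poly_eval_mult[OF ring_map_Const]
  have surj: "poly_eval Const \<sigma> p = p" if "p \<in> polys V" for p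
    using poly_eval_cong_polys[OF that, of \<sigma> Var] assms(5) by (simp add: poly_eval_Const_Var)
  have pe: "poly_eval Const \<sigma> p \<in> polys V" if "p \<in> polys W" for p
    using polys_poly_eval[OF that] assms(3) by auto
  have ap: "apair (dual_gen W \<sigma> f) (\<tau> * \<tau>') = apair f (poly_eval Const \<sigma> \<tau> * poly_eval Const \<sigma> \<tau>')"
    if "\<tau>' \<in> polys W" for \<tau>'
    using apair_dual_gen[OF assms(1,2), where \<tau> = "\<tau> * \<tau>'" and f = f] that assms(7) by (simp add: polys_mult hom)
  show ?thesis
    unfolding Ann_iff[OF assms(6)] Ann_iff[OF dual_gen_polys]
  proof safe
    fix p :: "(nat, 'a) mpoly"
    assume "\<forall>\<tau>'\<in>polys W. apair (dual_gen W \<sigma> f) (\<tau> * \<tau>') = 0" "p \<in> polys V"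
    thus "apair f (poly_eval Const \<sigma> \<tau> * p) = 0"
      using ap[of p] surj[of p] polys_mono[OF assms(4)] by auto
  qed (use assms(7) pe ap in auto)
qed

section \<open>Polynomial rings and their quotients\<close>

lemma mpoly_ring_simps [simp]:
  "carrier (mpoly_ring V) = polys V"
  "x \<otimes>\<^bsub>mpoly_ring V\<^esub> y = x * y"
  "x \<oplus>\<^bsub>mpoly_ring V\<^esub> y = x + y"
  "\<one>\<^bsub>mpoly_ring V\<^esub> = 1"
  "\<zero>\<^bsub>mpoly_ring V\<^esub> = 0"
  by (simp_all add: mpoly_ring_def ring_of_type_algebra_def)

lemma ring_of_type_simps [simp]:
  "carrier ring_of_type_algebra = UNIV"
  "x \<otimes>\<^bsub>ring_of_type_algebra\<^esub> y = x * y"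
  "x \<oplus>\<^bsub>ring_of_type_algebra\<^esub> y = x + y"
  "\<one>\<^bsub>ring_of_type_algebra\<^esub> = 1"
  "\<zero>\<^bsub>ring_of_type_algebra\<^esub> = 0"
  by (simp_all add: ring_of_type_algebra_def)

lemma cring_mpoly_ring: "cring (mpoly_ring V :: ('v, 'a::comm_ring_1) mpoly ring)"
proof -
  have "\<exists>q\<in>polys V. q + p = 0 \<and> p + q = 0" if "p \<in> polys V" for p :: "('v, 'a) mpoly"
    by (rule bexI[of _ "- p"]) (use that polys_uminus in auto)
  thus ?thesis
    by unfold_locales (auto simp: Units_def polys_add polys_mult algebra_simps)
qed

lemma ring_mpoly_ring: "ring (mpoly_ring V :: ('v, 'a::comm_ring_1) mpoly ring)"
  using cring_mpoly_ring cring.axioms(1) by blast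

lemma mpoly_ring_a_inv [simp]:
  assumes "p \<in> polys V"
  shows "\<ominus>\<^bsub>mpoly_ring V\<^esub> p = - (p :: ('v, 'a::comm_ring_1) mpoly)"
proof -
  interpret R: cring "mpoly_ring V :: ('v, 'a) mpoly ring" by (rule cring_mpoly_ring)
  have "p \<in> carrier (mpoly_ring V)" "- p \<in> carrier (mpoly_ring V)" using assms polys_uminus by auto
  from R.minus_equality[OF _ this] show ?thesis by simp
qed

lemma mpoly_ring_minus [simp]:
  assumes "p \<in> polys V" "q \<in> polys V"
  shows "p \<ominus>\<^bsub>mpoly_ring V\<^esub> q = p - (q :: ('v, 'a::comm_ring_1) mpoly)"
  using assms by (simp add: a_minus_def)

lemma ideal_mpolyI:
  fixes I :: "('v, 'a::comm_ring_1) mpoly set"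
  assumes "I \<subseteq> polys V" "0 \<in> I" "\<And>p q. p \<in> I \<Longrightarrow> q \<in> I \<Longrightarrow> p + q \<in> I"
    and "\<And>p q. p \<in> I \<Longrightarrow> q \<in> polys V \<Longrightarrow> p * q \<in> I"
  shows "ideal I (mpoly_ring V)"
proof (rule idealI)
  interpret R: cring "mpoly_ring V :: ('v, 'a) mpoly ring" by (rule cring_mpoly_ring)
  show "subgroup I (add_monoid (mpoly_ring V))"
  proof (rule R.add.subgroupI)
    fix p assume "p \<in> I"
    moreover have "p * (- 1) \<in> I" using assms(4)[OF \<open>p \<in> I\<close>, of "- 1"] polys_uminus[OF polys_1] by blast
    ultimately show "\<ominus>\<^bsub>mpoly_ring V\<^esub> p \<in> I" using assms(1) by auto
  qed (use assms in auto)
qed (use assms in \<open>auto simp: ring_mpoly_ring mult.commute\<close>)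

lemma ideal_Ann: "ideal (Ann V f) (mpoly_ring V)" for f :: "(nat, 'a::field_char_0) mpoly"
  by (rule ideal_mpolyI) (auto intro: Ann_polys Ann_add Ann_mult)

lemma quot_cong:
  assumes "ideal I R" "a \<in> carrier R" "b \<in> carrier R"
  shows "I +>\<^bsub>R\<^esub> a = I +>\<^bsub>R\<^esub> b \<longleftrightarrow> a \<ominus>\<^bsub>R\<^esub> b \<in> I"
proof -
  interpret ideal I R by fact
  show ?thesis using quotient_eq_iff_same_a_r_cos assms by auto
qed

lemma quot_zero:
  assumes "ideal I R" "a \<in> carrier R"
  shows "I +>\<^bsub>R\<^esub> a = \<zero>\<^bsub>R Quot I\<^esub> \<longleftrightarrow> a \<in> I"
proof -
  interpret ideal I R by fact
  show ?thesis
    using quotient_eq_iff_same_a_r_cos[OF assms zero_closed] assms(2)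
    by (auto simp: FactRing_def minus_eq a_coset_add_zero a_subset)
qed

lemma quot_carrier: "carrier (R Quot I) = (\<lambda>a. I +>\<^bsub>R\<^esub> a) ` carrier R"
  by (auto simp: FactRing_def A_RCOSETS_def')

lemma is_algebra_quot:
  assumes "is_algebra \<phi> R" "ideal I R"
  shows "is_algebra (quot_map R I \<phi>) (R Quot I)"
proof -
  interpret ideal I R by fact
  have c: "cring R" and h: "\<phi> \<in> ring_hom ring_of_type_algebra R" using assms(1) by (auto simp: is_algebra_def)
  have "quot_map R I \<phi> = (\<lambda>a. I +>\<^bsub>R\<^esub> a) \<circ> \<phi>" by (auto simp: quot_map_def)
  hence "quot_map R I \<phi> \<in> ring_hom ring_of_type_algebra (R Quot I)"
    using ring_hom_trans[OF h rcos_ring_hom] by simp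
  thus ?thesis using quotient_is_cring[OF c] by (simp add: is_algebra_def)
qed

lemma is_algebra_mpoly: "is_algebra Const (mpoly_ring V)"
  unfolding is_algebra_def
  by (auto intro!: cring_mpoly_ring ring_hom_memI simp: Const_add Const_mult)

lemma algebra_iso_of_surj:
  assumes "ring R" "ring S" "h \<in> ring_hom R S" "h ` carrier R = carrier S"
    and "\<And>x. x \<in> carrier R \<Longrightarrow> h x = \<zero>\<^bsub>S\<^esub> \<longleftrightarrow> x \<in> I" "I \<subseteq> carrier R"
    and "\<And>r. \<phi> r \<in> carrier R" "\<And>r. \<psi> r = h (\<phi> r)"
  shows "algebra_iso (quot_map R I \<phi>) (R Quot I) \<psi> S"
proof -
  interpret hom: ring_hom_ring R S h by (rule ring_hom_ringI2[OF assms(1-3)])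
  have ker: "a_kernel R S h = I" unfolding a_kernel_def' using assms(5,6) by blast
  have "(\<lambda>Y. the_elem (h ` Y)) \<in> ring_iso (R Quot I) S"
    using hom.FactRing_iso_set[OF assms(4)] by (simp add: ker)
  moreover have "the_elem (h ` (I +>\<^bsub>R\<^esub> x)) = h x" if "x \<in> carrier R" for x
    using hom.the_elem_simp[OF that] by (simp add: ker)
  ultimately show ?thesis
    unfolding algebra_iso_def quot_map_def using assms(7,8) by (intro bexI[of _ "\<lambda>Y. the_elem (h ` Y)"]) auto
qed

lemma algebra_iso_trans:
  assumes "algebra_iso \<phi> A \<psi> B" "algebra_iso \<psi> B \<chi> C"
  shows "algebra_iso \<phi> A \<chi> C"
proof -
  from assms obtain h g where hg: "h \<in> ring_iso A B" "\<forall>r. h (\<phi> r) = \<psi> r" "g \<in> ring_iso B C" "\<forall>r. g (\<psi> r) = \<chi> r"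
    by (auto simp: algebra_iso_def)
  thus ?thesis using ring_iso_set_trans[OF hg(1,3)] unfolding algebra_iso_def by (intro bexI[of _ "g \<circ> h"]) auto
qed

lemma algebra_iso_sym:
  assumes "algebra_iso \<phi> A \<psi> B" "ring A" "\<And>r. \<phi> r \<in> carrier A"
  shows "algebra_iso \<psi> B \<phi> A"
proof -
  from assms obtain h where h: "h \<in> ring_iso A B" "\<forall>r. h (\<phi> r) = \<psi> r" by (auto simp: algebra_iso_def)
  have "inv_into (carrier A) h (\<psi> r) = \<phi> r" for r
    using h assms(3)[of r] by (metis bij_betw_imp_inj_on inv_into_f_f ring_iso_memE(5))
  thus ?thesis unfolding algebra_iso_def using ring_iso_set_sym[OF assms(2) h(1)] by blast
qed

lemma is_algebra_closed: "is_algebra \<phi> B \<Longrightarrow> \<phi> r \<in> carrier B"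
  unfolding is_algebra_def using ring_hom_closed[of \<phi> ring_of_type_algebra B r] by simp

text \<open>The smoothing family stays the same; only the identification of its special fibre is
  composed with the isomorphism.\<close>

lemma smoothable_iso:
  fixes \<iota> :: "'a::field \<Rightarrow> 'b"
  assumes "smoothable \<iota> A" "algebra_iso \<iota> A \<iota>' A'" "is_algebra \<iota>' A'"
  shows "smoothable \<iota>' A'"
proof -
  from assms(1) obtain B :: "(nat \<Rightarrow> 'a fps) ring" and \<phi> where B: "is_algebra \<phi> B" "free_of_finite_rank \<phi> B"
      "algebra_iso (quot_map B (cgenideal B (\<phi> fps_X)) (\<lambda>c. \<phi> (fps_const c)))
        (B Quot cgenideal B (\<phi> fps_X)) \<iota> A" "smooth (laurent_map \<phi> B) (localization B (\<phi> fps_X))"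
    unfolding smoothable_def Let_def by blast
  show ?thesis unfolding smoothable_def Let_def
    by (intro conjI assms(3) exI[of _ B] exI[of _ \<phi>] B algebra_iso_trans[OF B(3) assms(2)])
qed

section \<open>Bases of apolar algebras\<close>

lemma Ap_algebra: "is_algebra (Ap_scalar V f) (Ap V f)" for f :: "(nat, 'a::field_char_0) mpoly"
  unfolding Ap_scalar_def Ap_def by (rule is_algebra_quot[OF is_algebra_mpoly ideal_Ann])

lemma Ap_hom: "ring_hom_ring (mpoly_ring V) (Ap V f) (\<lambda>p. Ann V f +>\<^bsub>mpoly_ring V\<^esub> p)"
  for f :: "(nat, 'a::field_char_0) mpoly"
  unfolding Ap_def by (rule ideal.rcos_ring_hom_ring[OF ideal_Ann])

lemma combine_mpoly:
  assumes "set cs \<subseteq> polys V" "set ps \<subseteq> polys V" "length cs = length ps"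
  shows "ring.combine (mpoly_ring V) cs ps = (\<Sum>i<length ps. cs ! i * (ps ! i :: ('v, 'a::comm_ring_1) mpoly))"
proof -
  interpret R: ring "mpoly_ring V :: ('v, 'a) mpoly ring" by (rule ring_mpoly_ring)
  from assms(3,1,2) show ?thesis
    by (induction cs ps rule: list_induct2) (auto simp: sum.lessThan_Suc_shift simp del: sum.lessThan_Suc)
qed

text \<open>Independence in the quotient expressed by representatives, as is spanning in
  \<open>spans_mod\<close>; this separates the later arguments from the list-based dimension
  theory.\<close>

definition indep_mod :: "('v, 'a::comm_ring_1) mpoly set \<Rightarrow> nat \<Rightarrow> (nat \<Rightarrow> ('v, 'a) mpoly) \<Rightarrow> bool" where
  "indep_mod I N b \<longleftrightarrow> (\<forall>c. (\<Sum>i<N. Const (c i) * b i) \<in> I \<longrightarrow> (\<forall>i<N. c i = 0))"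

definition spans_mod :: "'v set \<Rightarrow> ('v, 'a::comm_ring_1) mpoly set \<Rightarrow> nat \<Rightarrow> (nat \<Rightarrow> ('v, 'a) mpoly) \<Rightarrow> bool" where
  "spans_mod V I N b \<longleftrightarrow> (\<forall>p\<in>polys V. \<exists>c. p - (\<Sum>i<N. Const (c i) * b i) \<in> I)"

context
  fixes V :: "nat set" and f :: "(nat, 'a::field_char_0) mpoly"
  assumes nz: "f \<noteq> 0"
begin

private abbreviation (input) "q \<equiv> (\<lambda>p. Ann V f +>\<^bsub>mpoly_ring V\<^esub> p)"
private abbreviation (input) "K \<equiv> range (Ap_scalar V f)"

text \<open>The dimension theory takes its scalars from a subfield of the ring itself. The image of
  K is one because 1 does not annihilate a nonzero \<open>f\<close>.\<close>

lemma Ap_subfield: "subfield (range (Ap_scalar V f)) (Ap V f)"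
proof -
  interpret F: field "ring_of_type_algebra :: 'a ring" by (rule field_from_type_algebra)
  have alg: "is_algebra (Ap_scalar V f) (Ap V f)" by (rule Ap_algebra)
  interpret h: ring_hom_ring "ring_of_type_algebra :: 'a ring" "Ap V f" "Ap_scalar V f"
    using alg cring.axioms(1) by (auto simp: is_algebra_def intro!: ring_hom_ringI2 F.ring_axioms)
  have "\<one>\<^bsub>Ap V f\<^esub> \<noteq> \<zero>\<^bsub>Ap V f\<^esub>"
  proof
    assume eq: "\<one>\<^bsub>Ap V f\<^esub> = \<zero>\<^bsub>Ap V f\<^esub>"
    interpret g: ring_hom_ring "mpoly_ring V" "Ap V f" q by (rule Ap_hom)
    have "q 1 = \<zero>\<^bsub>Ap V f\<^esub>" using g.hom_one eq by simp
    hence "1 \<in> Ann V f" using quot_zero[OF ideal_Ann, of 1 V f] by (simp add: Ap_def)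
    from Ann_const_term[OF nz this] show False by simp
  qed
  thus ?thesis using h.img_is_subfield[of UNIV] F.carrier_is_subfield by simp
qed

lemma Ap_combine:
  assumes "set ps \<subseteq> polys V" "length cs = length ps"
  shows "ring.combine (Ap V f) (map (Ap_scalar V f) cs) (map q ps) = q (\<Sum>i<length ps. Const (cs ! i) * ps ! i)"
proof -
  interpret g: ring_hom_ring "mpoly_ring V" "Ap V f" q by (rule Ap_hom)
  have "g.S.combine (map q (map Const cs)) (map q ps) = q (g.R.combine (map Const cs) ps)"
    using assms by (intro g.combine_hom) auto
  also have "g.R.combine (map Const cs) ps = (\<Sum>i<length ps. Const (cs ! i) * ps ! i)"
    using assms by (subst combine_mpoly) (auto intro!: sum.cong)
  also have "map q (map Const cs) = map (Ap_scalar V f) cs"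
    by (simp add: Ap_scalar_def quot_map_def)
  finally show ?thesis .
qed

lemma list_in_K: "set Ks \<subseteq> K \<Longrightarrow> \<exists>cs. Ks = map (Ap_scalar V f) cs"
  by (induction Ks) (auto, metis list.simps(9))

lemma list_in_Ap: "set Us \<subseteq> carrier (Ap V f) \<Longrightarrow> \<exists>ps. set ps \<subseteq> polys V \<and> Us = map q ps"
proof (induction Us)
  case (Cons u Us)
  then obtain ps p where "set ps \<subseteq> polys V" "Us = map q ps" "p \<in> polys V" "u = q p"
    by (auto simp: Ap_def quot_carrier)
  thus ?case by (intro exI[of _ "p # ps"]) auto
qed simp

lemma Ap_independent_iff:
  assumes "set ps \<subseteq> polys V"
  shows "ring.independent (Ap V f) K (map q ps) \<longleftrightarrow> indep_mod (Ann V f) (length ps) (\<lambda>i. ps ! i)"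
proof -
  interpret g: ring_hom_ring "mpoly_ring V" "Ap V f" q by (rule Ap_hom)
  have car: "set (map q ps) \<subseteq> carrier (Ap V f)" using assms by auto
  have sum_closed: "(\<Sum>i<length ps. Const (c i) * ps ! i) \<in> polys V" for c
    using assms by (intro polys_sum polys_mult) auto
  have zero_iff: "q (\<Sum>i<length ps. Const (c i) * ps ! i) = \<zero>\<^bsub>Ap V f\<^esub> \<longleftrightarrow>
      (\<Sum>i<length ps. Const (c i) * ps ! i) \<in> Ann V f" for c
    using quot_zero[OF ideal_Ann, of "\<Sum>i<length ps. Const (c i) * ps ! i" V f] sum_closed by (simp add: Ap_def)
  have inj: "Ap_scalar V f c = \<zero>\<^bsub>Ap V f\<^esub> \<longleftrightarrow> c = 0" for c
  proof -
    have "Ap_scalar V f c = \<zero>\<^bsub>Ap V f\<^esub> \<longleftrightarrow> Const c \<in> Ann V f"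
      using quot_zero[OF ideal_Ann, of "Const c" V f] by (simp add: Ap_def Ap_scalar_def quot_map_def)
    thus ?thesis using Ann_const_term[OF nz, of "Const c" V] by (auto simp: lookup_Const)
  qed
  show ?thesis
  proof
    assume ind: "g.S.independent K (map q ps)"
    show "indep_mod (Ann V f) (length ps) (\<lambda>i. ps ! i)"
      unfolding indep_mod_def
    proof (intro allI impI)
      fix c i assume c: "(\<Sum>i<length ps. Const (c i) * ps ! i) \<in> Ann V f" and i: "i < length ps"
      let ?cs = "map c [0..<length ps]"
      have "(\<Sum>i<length ps. Const (?cs ! i) * ps ! i) = (\<Sum>i<length ps. Const (c i) * ps ! i)"
        by (intro sum.cong) auto
      hence "g.S.combine (map (Ap_scalar V f) ?cs) (map q ps) = \<zero>\<^bsub>Ap V f\<^esub>"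
        using Ap_combine[OF assms, of ?cs] zero_iff[of c] c by simp
      from g.S.independent_imp_trivial_combine[OF Ap_subfield ind _ this]
      have "set (take (length (map q ps)) (map (Ap_scalar V f) ?cs)) \<subseteq> {\<zero>\<^bsub>Ap V f\<^esub>}" by auto
      moreover have "Ap_scalar V f (c i) \<in> set (take (length (map q ps)) (map (Ap_scalar V f) ?cs))"
        using i by simp
      ultimately have "Ap_scalar V f (c i) = \<zero>\<^bsub>Ap V f\<^esub>" by blast
      thus "c i = 0" by (simp add: inj)
    qed
  next
    assume ind: "indep_mod (Ann V f) (length ps) (\<lambda>i. ps ! i)"
    show "g.S.independent K (map q ps)"
    proof (rule g.S.trivial_combine_imp_independent[OF Ap_subfield car])
      fix Ks assume Ks: "set Ks \<subseteq> K" "g.S.combine Ks (map q ps) = \<zero>\<^bsub>Ap V f\<^esub>"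
      obtain cs where cs: "Ks = map (Ap_scalar V f) cs" using list_in_K[OF Ks(1)] by blast
      \<comment> \<open>\<open>combine\<close> stops at the shorter of its two lists. Reading
        missing scalars as 0 and dropping surplus ones gives coefficients indexed by
        \<open>ps\<close>.\<close>
      define c where "c = (\<lambda>i. if i < length cs then cs ! i else 0)"
      let ?ds = "map c [0..<length ps]"
      have "map (Ap_scalar V f) ?ds = (if length cs < length ps then
          Ks @ replicate (length ps - length cs) \<zero>\<^bsub>Ap V f\<^esub> else take (length ps) Ks)"
        by (intro nth_equalityI) (auto simp: c_def nth_append cs inj)
      hence "g.S.combine (map (Ap_scalar V f) ?ds) (map q ps) = g.S.combine Ks (map q ps)"
        using g.S.combine_append_replicate[OF car, of Ks] g.S.combine_take[of "map q ps" Ks] by auto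
      moreover have "(\<Sum>i<length ps. Const (?ds ! i) * ps ! i) = (\<Sum>i<length ps. Const (c i) * ps ! i)"
        by (intro sum.cong) auto
      ultimately have "(\<Sum>i<length ps. Const (c i) * ps ! i) \<in> Ann V f"
        using Ap_combine[OF assms, of ?ds] Ks(2) zero_iff[of c] by simp
      hence c0: "c i = 0" if "i < length ps" for i using ind that by (auto simp: indep_mod_def)
      have "cs ! i = 0" if "i < length ps" "i < length cs" for i
        using c0[OF that(1)] that(2) by (simp add: c_def)
      hence "Ap_scalar V f (cs ! i) = \<zero>\<^bsub>Ap V f\<^esub>" if "i < length ps" "i < length cs" for i
        using that inj by blast
      thus "set (take (length (map q ps)) Ks) \<subseteq> {\<zero>\<^bsub>Ap V f\<^esub>}"
        unfolding cs set_conv_nth by auto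
    qed
  qed
qed

lemma Ap_Span_imp_spans_mod:
  assumes "set ps \<subseteq> polys V" "ring.Span (Ap V f) K (map q ps) = carrier (Ap V f)"
  shows "spans_mod V (Ann V f) (length ps) (\<lambda>i. ps ! i)"
  unfolding spans_mod_def
proof
  fix p :: "(nat, 'a) mpoly" assume p: "p \<in> polys V"
  interpret g: ring_hom_ring "mpoly_ring V" "Ap V f" q by (rule Ap_hom)
  have car: "set (map q ps) \<subseteq> carrier (Ap V f)" using assms(1) by auto
  have "q p \<in> g.S.Span K (map q ps)" unfolding assms(2) using p by simp
  then obtain Ks where Ks: "q p = g.S.combine Ks (map q ps)" "length Ks = length ps" "set Ks \<subseteq> K"
    unfolding g.S.Span_eq_combine_set_length_version[OF Ap_subfield car] by auto
  then obtain cs where cs: "Ks = map (Ap_scalar V f) cs" using list_in_K by blast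
  have "q p = q (\<Sum>i<length ps. Const (cs ! i) * ps ! i)"
    using Ks cs Ap_combine[OF assms(1), of cs] by simp
  moreover have cl: "(\<Sum>i<length ps. Const (cs ! i) * ps ! i) \<in> polys V"
    using assms by (intro polys_sum polys_mult) auto
  ultimately have "p - (\<Sum>i<length ps. Const (cs ! i) * ps ! i) \<in> Ann V f"
    using quot_cong[OF ideal_Ann, of p V] p by simp
  thus "\<exists>c. p - (\<Sum>i<length ps. Const (c i) * ps ! i) \<in> Ann V f" by blast
qed

lemma Ap_basis_extension:
  assumes "ring.dimension (Ap V f) N K (carrier (Ap V f))"
    and "indep_mod (Ann V f) M b" "\<And>i. i < M \<Longrightarrow> b i \<in> polys V"
  obtains b' where "M \<le> N" "\<And>i. i < M \<Longrightarrow> b' i = b i" "\<And>i. i < N \<Longrightarrow> b' i \<in> polys V"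
    "indep_mod (Ann V f) N b'" "spans_mod V (Ann V f) N b'"
proof -
  interpret g: ring_hom_ring "mpoly_ring V" "Ap V f" q by (rule Ap_hom)
  \<comment> \<open>\<open>complete_base\<close> puts the new vectors in front of the given ones.
    Everything is reversed so that the given \<open>b i\<close> keep the initial indices.\<close>
  have rev_sum: "(\<Sum>i<length ps. Const (c i) * rev ps ! i) =
      (\<Sum>i<length ps. Const (c (length ps - Suc i)) * ps ! i)" for c and ps :: "(nat, 'a) mpoly list"
    by (subst sum.nat_diff_reindex[symmetric]) (auto intro!: sum.cong simp: rev_nth)
  have indep_rev: "indep_mod I (length ps) (\<lambda>i. rev ps ! i)" if ind: "indep_mod I (length ps) (\<lambda>i. ps ! i)"
    for I and ps :: "(nat, 'a) mpoly list"
    unfolding indep_mod_def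
  proof (intro allI impI)
    fix c i assume "(\<Sum>i<length ps. Const (c i) * rev ps ! i) \<in> I" and i: "i < length ps"
    hence "\<forall>i<length ps. c (length ps - Suc i) = 0"
      using ind[unfolded indep_mod_def, THEN spec, of "\<lambda>i. c (length ps - Suc i)"] by (simp add: rev_sum)
    from this[rule_format, of "length ps - Suc i"] show "c i = 0" using i by simp
  qed
  let ?L = "rev (map b [0..<M])"
  have ind0: "indep_mod (Ann V f) (length (map b [0..<M])) (\<lambda>i. map b [0..<M] ! i)"
    using assms(2) unfolding indep_mod_def by (auto simp: cong: sum.cong_simp)
  have L: "set ?L \<subseteq> polys V" using assms(3) by auto
  have "g.S.independent K (map q ?L)"
    using Ap_independent_iff[OF L] indep_rev[OF ind0] by simp
  moreover have "set (map q ?L) \<subseteq> carrier (Ap V f)" using L by auto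
  ultimately obtain Vs where Vs: "length (Vs @ map q ?L) = N" "g.S.independent K (Vs @ map q ?L)"
      "g.S.Span K (Vs @ map q ?L) = carrier (Ap V f)"
    using g.S.complete_base[OF Ap_subfield assms(1)] by blast
  have "set Vs \<subseteq> carrier (Ap V f)" using g.S.independent_in_carrier[OF Vs(2)] by auto
  then obtain vs where vs: "set vs \<subseteq> polys V" "Vs = map q vs" using list_in_Ap by blast
  define xs where "xs = vs @ ?L"
  have xs: "set xs \<subseteq> polys V" "length xs = N" "map q xs = Vs @ map q ?L"
    using vs L Vs(1) by (auto simp: xs_def)
  show ?thesis
  proof (rule that[of "\<lambda>i. rev xs ! i"])
    show "M \<le> N" using xs(2) by (simp add: xs_def)
    show "rev xs ! i = b i" if "i < M" for i using that by (simp add: xs_def nth_append)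
    show "rev xs ! i \<in> polys V" if "i < N" for i
      using that xs(1,2) nth_mem[of i "rev xs"] by (auto simp del: nth_mem)
    show "indep_mod (Ann V f) N (\<lambda>i. rev xs ! i)"
      using Ap_independent_iff[OF xs(1)] Vs(2) xs indep_rev[of "Ann V f" xs] by simp
    show "spans_mod V (Ann V f) N (\<lambda>i. rev xs ! i)"
      unfolding spans_mod_def
    proof
      fix p :: "(nat, 'a) mpoly" assume "p \<in> polys V"
      then obtain c where c: "p - (\<Sum>i<length xs. Const (c i) * xs ! i) \<in> Ann V f"
        using Ap_Span_imp_spans_mod[OF xs(1)] Vs(3) xs by (auto simp: spans_mod_def)
      have "(\<Sum>i<length xs. Const (c (length xs - Suc i)) * rev xs ! i) =
            (\<Sum>i<length xs. Const (c i) * xs ! i)"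
        unfolding rev_sum by (intro sum.cong refl) simp
      thus "\<exists>c. p - (\<Sum>i<N. Const (c i) * rev xs ! i) \<in> Ann V f"
        using c by (intro exI[of _ "\<lambda>i. c (length xs - Suc i)"]) (simp add: xs(2))
    qed
  qed
qed

end

section \<open>Homogenization\<close>

definition mon_rest :: "(nat \<Rightarrow>\<^sub>0 nat) \<Rightarrow> (nat \<Rightarrow>\<^sub>0 nat)" where
  "mon_rest m = m - single 0 (lookup m 0)"

lemma lookup_mon_rest: "lookup (mon_rest m) v = (if v = 0 then 0 else lookup m v)"
  by (simp add: mon_rest_def lookup_minus lookup_single when_def)

lemma mon_rest_split: "m = mon_rest m + single 0 (lookup m 0)"
  by (rule poly_mapping_eqI) (simp add: lookup_add lookup_mon_rest lookup_single when_def)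

text \<open>Once the total degree is known, the exponent of x_0 is determined by the other
  exponents; this is why dehomogenising a form loses no coefficient.\<close>

lemma mon_rest_eq_iff:
  "mon_rest m = b \<longleftrightarrow> lookup b 0 = 0 \<and> mon_deg b \<le> mon_deg m \<and> m = b + single 0 (mon_deg m - mon_deg b)"
proof
  assume "mon_rest m = b"
  hence b: "lookup b 0 = 0" "m = b + single 0 (lookup m 0)"
    using lookup_mon_rest[of m 0] mon_rest_split[of m] by auto
  have "mon_deg m = mon_deg b + lookup m 0" by (subst b(2)) (simp add: mon_deg_add)
  hence "mon_deg b \<le> mon_deg m" "lookup m 0 = mon_deg m - mon_deg b" by auto
  thus "lookup b 0 = 0 \<and> mon_deg b \<le> mon_deg m \<and> m = b + single 0 (mon_deg m - mon_deg b)"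
    using b by metis
next
  assume b: "lookup b 0 = 0 \<and> mon_deg b \<le> mon_deg m \<and> m = b + single 0 (mon_deg m - mon_deg b)"
  define j where "j = mon_deg m - mon_deg b"
  have m: "m = b + single 0 j" and b0: "lookup b 0 = 0" unfolding j_def using b by blast+
  show "mon_rest m = b" unfolding m
    by (rule poly_mapping_eqI) (use b0 in \<open>auto simp: lookup_mon_rest lookup_add lookup_single when_def\<close>)
qed

lemma mon_eval_dehomogenize:
  "mon_eval (\<lambda>i. if i = 0 then 1 else Var i) m = (single (mon_rest m) 1 :: (nat, 'a::comm_ring_1) mpoly)"
proof -
  let ?\<xi> = "\<lambda>i. if i = 0 then 1 else Var i :: (nat, 'a) mpoly"
  have "mon_eval ?\<xi> m = mon_eval ?\<xi> (mon_rest m) * mon_eval ?\<xi> (single 0 (lookup m 0))"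
    using mon_eval_add[of ?\<xi> "mon_rest m" "single 0 (lookup m 0)"] unfolding mon_rest_split[symmetric] .
  also have "mon_eval ?\<xi> (mon_rest m) = mon_eval Var (mon_rest m)"
    by (rule mon_eval_cong) (auto simp: in_keys_iff lookup_mon_rest split: if_splits)
  finally show ?thesis by (simp add: mon_eval_Var)
qed

lemma lookup_dehomogenize:
  assumes "H \<in> forms V e"
  shows "lookup (dehomogenize H) b =
    (if lookup b 0 = 0 \<and> mon_deg b \<le> e then lookup H (b + single 0 (e - mon_deg b)) else 0)"
proof -
  let ?m = "b + single 0 (e - mon_deg b)"
  have "lookup (dehomogenize H) b = (\<Sum>m\<in>keys H. if mon_rest m = b then lookup H m else 0)"
    by (simp add: dehomogenize_def poly_eval_def' lookup_sum mon_eval_dehomogenize lookup_single when_def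
        if_distrib cong: if_cong)
  also have "\<dots> = (\<Sum>m\<in>keys H. if m = ?m then (if lookup b 0 = 0 \<and> mon_deg b \<le> e then lookup H m else 0) else 0)"
  proof (intro sum.cong refl)
    fix m assume "m \<in> keys H"
    hence "mon_deg m = e" using assms forms_lookup by (auto simp: in_keys_iff)
    thus "(if mon_rest m = b then lookup H m else 0) =
       (if m = ?m then (if lookup b 0 = 0 \<and> mon_deg b \<le> e then lookup H m else 0) else 0)"
      using mon_rest_eq_iff[of m b] by auto
  qed
  also have "\<dots> = (if lookup b 0 = 0 \<and> mon_deg b \<le> e then lookup H ?m else 0)"
    by (simp add: in_keys_iff)
  finally show ?thesis .
qed

lemma ring_map_dehomogenize: "ring_map dehomogenize"
  unfolding dehomogenize_def[abs_def] by (rule ring_map.ring_map_poly_eval[OF ring_map_Const])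

lemma dehomogenize_polys: "H \<in> polys V \<Longrightarrow> dehomogenize H \<in> polys (V - {0})"
  unfolding dehomogenize_def by (rule polys_poly_eval) (auto intro: polys_Var)

lemma lookup_form_dehomogenize:
  assumes "H \<in> forms V e" "mon_deg m = e"
  shows "lookup H m = lookup (dehomogenize H) (mon_rest m)"
proof -
  have "mon_rest m = mon_rest m" ..
  hence "lookup (mon_rest m) 0 = 0" "mon_deg (mon_rest m) \<le> e" "m = mon_rest m + single 0 (e - mon_deg (mon_rest m))"
    unfolding mon_rest_eq_iff assms(2) by auto
  thus ?thesis using lookup_dehomogenize[OF assms(1), of "mon_rest m"] by simp
qed

lemma dehomogenize_nonzero:
  assumes "H \<in> forms V e" "H \<noteq> 0"
  shows "dehomogenize H \<noteq> 0"
proof -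
  obtain m where "lookup H m \<noteq> 0" using assms(2) by (metis lookup_zero poly_mapping_eqI)
  thus ?thesis using lookup_form_dehomogenize[OF assms(1), of m] forms_lookup[OF assms(1), of m] by auto
qed

definition homogenize :: "nat \<Rightarrow> (nat, 'a::comm_ring_1) mpoly \<Rightarrow> (nat, 'a) mpoly" where
  "homogenize e g = (\<Sum>b\<in>keys g. single (b + single 0 (e - mon_deg b)) (lookup g b))"

lemma lookup_homogenize:
  assumes "g \<in> polys W" "0 \<notin> W" "\<And>m. lookup g m \<noteq> 0 \<Longrightarrow> mon_deg m \<le> e"
  shows "lookup (homogenize e g) m = (if mon_deg m = e then lookup g (mon_rest m) else 0)"
proof -
  have "lookup (homogenize e g) m = (\<Sum>b\<in>keys g. if b = mon_rest m then (if mon_deg m = e then lookup g b else 0) else 0)"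
    unfolding homogenize_def lookup_sum
  proof (intro sum.cong refl)
    fix b assume "b \<in> keys g"
    hence b: "lookup b 0 = 0" "mon_deg b \<le> e"
      using assms(2) polys_lookup[OF assms(1), of b] assms(3)[of b] by (auto simp: in_keys_iff)
    have "b + single 0 (e - mon_deg b) = m \<longleftrightarrow> mon_rest m = b \<and> mon_deg m = e"
      unfolding mon_rest_eq_iff using b by (auto simp: mon_deg_add)
    thus "lookup (single (b + single 0 (e - mon_deg b)) (lookup g b)) m =
        (if b = mon_rest m then (if mon_deg m = e then lookup g b else 0) else 0)"
      by (auto simp: lookup_single when_def)
  qed
  also have "\<dots> = (if mon_deg m = e then lookup g (mon_rest m) else 0)"
    by (simp add: in_keys_iff)
  finally show ?thesis .
qed

lemma homogenize_forms:
  assumes "g \<in> polys W" "0 \<notin> W" "\<And>m. lookup g m \<noteq> 0 \<Longrightarrow> mon_deg m \<le> e"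
  shows "homogenize e g \<in> forms (insert 0 W) e"
proof (rule formsI)
  fix m assume "lookup (homogenize e g) m \<noteq> 0"
  hence m: "mon_deg m = e" "lookup g (mon_rest m) \<noteq> 0"
    using lookup_homogenize[OF assms, of m] by (auto split: if_splits)
  hence "keys (mon_rest m) \<subseteq> W" using polys_lookup[OF assms(1)] by blast
  moreover have "keys m \<subseteq> insert 0 (keys (mon_rest m))" by (auto simp: in_keys_iff lookup_mon_rest split: if_splits)
  ultimately show "keys m \<subseteq> insert 0 W \<and> mon_deg m = e" using m by auto
qed

lemma dehomogenize_homogenize:
  assumes "g \<in> polys W" "0 \<notin> W" "\<And>m. lookup g m \<noteq> 0 \<Longrightarrow> mon_deg m \<le> e"
  shows "dehomogenize (homogenize e g) = g"
proof (rule poly_mapping_eqI)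
  fix b
  have eq: "mon_rest (b + single 0 (e - mon_deg b)) = b" if "lookup b 0 = 0" "mon_deg b \<le> e"
    unfolding mon_rest_eq_iff using that by (simp add: mon_deg_add)
  show "lookup (dehomogenize (homogenize e g)) b = lookup g b"
  proof (cases "lookup b 0 = 0 \<and> mon_deg b \<le> e")
    case True
    thus ?thesis
      by (simp add: lookup_dehomogenize[OF homogenize_forms[OF assms]] lookup_homogenize[OF assms] mon_deg_add eq)
  next
    case False
    hence "lookup g b = 0"
      using assms(2) polys_lookup[OF assms(1), of b] assms(3)[of b] by (metis in_keys_iff subsetD)
    thus ?thesis using False by (auto simp: lookup_dehomogenize[OF homogenize_forms[OF assms]])
  qed
qed

lemma lookup_set_zero:
  fixes G :: "('v, 'a::comm_ring_1) mpoly"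
  shows "lookup (set_zero Z G) m = (if keys m \<inter> Z = {} then lookup G m else 0)"
proof -
  let ?\<xi> = "\<lambda>v. if v \<in> Z then 0 else Var v :: ('v, 'a) mpoly"
  have ev: "mon_eval ?\<xi> b = (if keys b \<inter> Z = {} then single b 1 else 0)" for b
  proof (cases "keys b \<inter> Z = {}")
    case True
    hence "mon_eval ?\<xi> b = mon_eval Var b" by (intro mon_eval_cong) auto
    thus ?thesis using True by (simp add: mon_eval_Var)
  next
    case False
    then obtain v where "v \<in> keys b" "v \<in> Z" by blast
    thus ?thesis using False unfolding mon_eval_def
      by (auto intro!: prod_zero bexI[of _ v] simp: in_keys_iff zero_power)
  qed
  have "lookup (set_zero Z G) m = (\<Sum>b\<in>keys G. if b = m then (if keys m \<inter> Z = {} then lookup G m else 0) else 0)"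
    unfolding set_zero_def poly_eval_def' lookup_sum ev
    by (intro sum.cong refl) (auto simp: lookup_single when_def)
  thus ?thesis by (simp add: in_keys_iff)
qed

lemma lookup_upto_deg: "lookup (upto_deg j p) m = (if mon_deg m \<le> j then lookup p m else 0)"
  by (auto simp: upto_deg_def lookup_mapp when_def in_keys_iff)

lemma tdeg_le_1_split:
  fixes \<tau> :: "('v, 'a::comm_ring_1) mpoly"
  assumes "\<tau> \<in> polys V" "finite V" "tdeg \<tau> \<le> 1"
  shows "\<tau> = Const (lookup \<tau> 0) + (\<Sum>v\<in>V. Const (lookup \<tau> (single v 1)) * Var v)"
proof (rule poly_mapping_eqI)
  fix m :: "'v \<Rightarrow>\<^sub>0 nat"
  have inj: "single v (1::nat) = single w 1 \<longleftrightarrow> v = w" for v w :: 'v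
    by (metis lookup_single_eq lookup_single_not_eq zero_neq_one)
  consider "m = 0" | v where "m = single v 1" | "mon_deg m > 1"
  proof (cases "m = 0")
    case False
    then obtain v where "v \<in> keys m" by (metis equals0I keys_eq_empty)
    then obtain m' where m': "m = m' + single v 1" by (rule mon_split)
    show ?thesis
    proof (cases "m' = 0")
      case False
      hence "mon_deg m' > 0" using mon_deg_eq_0_iff[of m'] by simp
      hence "mon_deg m > 1" using m' by (simp add: mon_deg_add)
      thus ?thesis using that(3) by blast
    qed (use that(2) m' in auto)
  qed (use that in auto)
  thus "lookup \<tau> m = lookup (Const (lookup \<tau> 0) + (\<Sum>v\<in>V. Const (lookup \<tau> (single v 1)) * Var v)) m"
  proof cases
    case 1
    have "0 \<noteq> single v (1::nat)" for v :: 'v by (metis lookup_single_eq lookup_zero zero_neq_one)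
    thus ?thesis using 1 by (simp add: lookup_add lookup_sum lookup_Const lookup_Var)
  next
    case (2 v)
    have "single v (1::nat) \<noteq> 0" by (metis lookup_single_eq lookup_zero zero_neq_one)
    moreover have "lookup \<tau> (single v 1) = 0" if "v \<notin> V"
      using polys_lookup[OF assms(1), of "single v 1"] that by auto
    ultimately show ?thesis using 2 assms(2)
      by (simp add: lookup_add lookup_sum lookup_Const lookup_Var inj if_distrib cong: if_cong)
  next
    case 3
    hence "lookup \<tau> m = 0" using assms(3) by (auto simp: tdeg_le_iff)
    moreover have "m \<noteq> 0" "m \<noteq> single v 1" for v using 3 by auto
    ultimately show ?thesis by (simp add: lookup_add lookup_sum lookup_Const lookup_Var)
  qed
qed

section \<open>Construction of the encompassing form\<close>

lemma tdeg_Const_mult_Var: "tdeg (Const c * Var v) \<le> 1" for c :: "'a::comm_ring_1"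
  by (auto simp: tdeg_le_iff lookup_Var split: if_splits)

lemma tdeg_add_le: "tdeg p \<le> d \<Longrightarrow> tdeg q \<le> d \<Longrightarrow> tdeg (p + q) \<le> d"
  by (auto simp: tdeg_le_iff lookup_add) (metis add.right_neutral)

lemma tdeg_sum_le: "(\<And>i. i \<in> A \<Longrightarrow> tdeg (p i) \<le> d) \<Longrightarrow> tdeg (\<Sum>i\<in>A. p i) \<le> d"
proof (induction A rule: infinite_finite_induct)
  case (insert x A)
  thus ?case by (simp add: tdeg_add_le)
qed (simp_all add: tdeg_le_iff)

section \<open>Linear relations among first partial derivatives\<close>

lemma apair_Var_single:
  "apair F (Const c * Var v * single b 1) = c * (of_nat (mfact (b + single v 1)) * lookup F (b + single v 1))"
  by (simp add: mult.assoc Var_def mult_single add.commute)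

text \<open>Up to factorials, the sums on the right are the coefficients of the combination of first
  partials of \<open>F\<close>.\<close>

lemma Ann_linear_iff:
  fixes F :: "(nat, 'a::field_char_0) mpoly"
  assumes "finite U" "U \<subseteq> V"
  shows "(\<Sum>v\<in>U. Const (c v) * Var v) \<in> Ann V F \<longleftrightarrow>
    (\<forall>b. (\<Sum>v\<in>U. c v * (of_nat (mfact (b + single v 1)) * lookup F (b + single v 1))) = 0)"
proof -
  let ?s = "\<Sum>v\<in>U. Const (c v) * Var v :: (nat, 'a) mpoly"
  have eq: "apair F (?s * single b 1) =
     (\<Sum>v\<in>U. c v * (of_nat (mfact (b + single v 1)) * lookup F (b + single v 1)))" for b
    by (simp add: sum_distrib_right apair_sum apair_Var_single del: apair_Const_mult)
  have "?s \<in> polys V" using assms by (intro polys_sum polys_mult polys_Const polys_Var) auto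
  moreover have "act ?s F = 0 \<longleftrightarrow> (\<forall>b. apair F (?s * single b 1) = 0)"
    by (auto simp: lookup_act poly_mapping_eq_iff fun_eq_iff)
  ultimately show ?thesis by (simp add: Ann_def eq)
qed

lemma concise_linear_zero:
  fixes F :: "(nat, 'a::field_char_0) mpoly"
  assumes "concise V F" "finite U" "U \<subseteq> V" "(\<Sum>v\<in>U. Const (c v) * Var v) \<in> Ann V F" "v \<in> U"
  shows "c v = 0"
proof -
  let ?s = "\<Sum>v\<in>U. Const (c v) * Var v :: (nat, 'a) mpoly"
  have inj: "single v (1::nat) = single w 1 \<longleftrightarrow> v = w" for v w :: nat
    by (metis lookup_single_eq lookup_single_not_eq zero_neq_one)
  have "tdeg ?s \<le> 1" by (intro tdeg_sum_le tdeg_Const_mult_Var)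
  hence "?s = 0" using assms(1,4) by (auto simp: concise_def)
  hence "lookup ?s (single v 1) = 0" by simp
  thus ?thesis using assms(2,5) by (simp add: lookup_sum lookup_Var inj if_distrib cong: if_cong)
qed

lemma concise_nonzero: "concise V F \<Longrightarrow> F \<noteq> 0" for F :: "(nat, 'a::field_char_0) mpoly"
proof
  assume "concise V F" "F = 0"
  moreover have "(1::(nat, 'a) mpoly) \<in> Ann V 0" by (simp add: Ann_def act_eq_0_iff apair_def)
  moreover have "tdeg (1::(nat, 'a) mpoly) \<le> 1" by (auto simp: tdeg_le_iff lookup_one when_def)
  ultimately show False unfolding concise_def by (metis zero_neq_one)
qed

text \<open>The linear operators killing a linear form make up at least a hyperplane, so conciseness
  leaves room for a single variable. This disposes of degree 1 in the construction of
  \<open>G\<close>.\<close>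

lemma concise_linear_form:
  fixes F :: "(nat, 'a::field_char_0) mpoly"
  assumes "F \<in> forms V 1" "concise V F" "u \<in> V" "v \<in> V"
  shows "u = v"
proof (rule ccontr)
  assume uv: "u \<noteq> v"
  have vanish: "lookup F (b + single w 1) = 0" if "b \<noteq> 0" for b w
    using forms_lookup[OF assms(1), of "b + single w 1"] that by (auto simp: mon_deg_add mon_deg_eq_0_iff)
  have *: "c u = 0 \<and> c v = 0" if "c u * lookup F (single u 1) + c v * lookup F (single v 1) = 0" for c
  proof -
    have "(\<Sum>w\<in>{u, v}. Const (c w) * Var w) \<in> Ann V F"
    proof (subst Ann_linear_iff)
      show "\<forall>b. (\<Sum>w\<in>{u, v}. c w * (of_nat (mfact (b + single w 1)) * lookup F (b + single w 1))) = 0"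
      proof
        fix b
        show "(\<Sum>w\<in>{u, v}. c w * (of_nat (mfact (b + single w 1)) * lookup F (b + single w 1))) = 0"
          using that uv vanish[of b] by (cases "b = 0") auto
      qed
    qed (use assms in auto)
    from concise_linear_zero[OF assms(2) _ _ this] assms show ?thesis by auto
  qed
  \<comment> \<open>This vector always kills \<open>F\<close>. Being 0 by conciseness, it shows that
    \<open>F\<close> has no term in x_u or x_v; then every \<open>c\<close> kills \<open>F\<close>,
    even the constant 1.\<close>
  define c where "c = (\<lambda>w. if w = u then lookup F (single v 1) else - lookup F (single u 1))"
  have "lookup F (single v 1) = 0" "lookup F (single u 1) = 0"
    using *[of c] uv by (auto simp: c_def)
  with *[of "\<lambda>_. 1"] show False by simp
qed

text \<open>Substitution followed by the quotient map is onto \<open>Ap V f\<close>, and by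
  \<open>Ann_dual_gen\<close> its kernel is the annihilator of the dual generator.\<close>

lemma Ap_dual_gen_iso:
  fixes f :: "(nat, 'a::field_char_0) mpoly"
  assumes "finite W" "\<And>w. w \<in> W \<Longrightarrow> \<sigma> w \<in> low_deg 1" "\<And>w. w \<in> W \<Longrightarrow> \<sigma> w \<in> polys V"
    and "V \<subseteq> W" "\<And>v. v \<in> V \<Longrightarrow> \<sigma> v = Var v" "f \<in> polys V"
  shows "algebra_iso (Ap_scalar W (dual_gen W \<sigma> f)) (Ap W (dual_gen W \<sigma> f)) (Ap_scalar V f) (Ap V f)"
proof -
  let ?\<Theta> = "poly_eval Const \<sigma>" and ?q = "\<lambda>p. Ann V f +>\<^bsub>mpoly_ring V\<^esub> p"
  interpret g: ring_hom_ring "mpoly_ring V" "Ap V f" ?q by (rule Ap_hom)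
  note T = ring_map.ring_map_poly_eval[OF ring_map_Const, of \<sigma>]
  have pe: "?\<Theta> p \<in> polys V" if "p \<in> polys W" for p
    using polys_poly_eval[OF that] assms(3) by auto
  have "?\<Theta> \<in> ring_hom (mpoly_ring W) (mpoly_ring V)"
    using pe ring_map.add[OF T] ring_map.mult[OF T] ring_map.one[OF T] by (intro ring_hom_memI) auto
  hence h: "?q \<circ> ?\<Theta> \<in> ring_hom (mpoly_ring W) (Ap V f)"
    using ring_hom_trans g.homh by blast
  show ?thesis
    unfolding Ap_def[of W] Ap_scalar_def[of W]
  proof (rule algebra_iso_of_surj[OF ring_mpoly_ring _ h])
    have surj: "?\<Theta> p = p" if "p \<in> polys V" for p
      using poly_eval_cong_polys[OF that, of \<sigma> Var] assms(5) by (simp add: poly_eval_Const_Var)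
    show "(?q \<circ> ?\<Theta>) ` carrier (mpoly_ring W) = carrier (Ap V f)"
    proof
      show "carrier (Ap V f) \<subseteq> (?q \<circ> ?\<Theta>) ` carrier (mpoly_ring W)"
      proof
        fix x assume "x \<in> carrier (Ap V f)"
        then obtain p where p: "p \<in> polys V" "x = ?q p" by (auto simp: Ap_def quot_carrier)
        hence "x = (?q \<circ> ?\<Theta>) p" "p \<in> polys W" using surj polys_mono[OF assms(4)] by auto
        thus "x \<in> (?q \<circ> ?\<Theta>) ` carrier (mpoly_ring W)" by auto
      qed
    qed (use pe in auto)
    show "(?q \<circ> ?\<Theta>) x = \<zero>\<^bsub>Ap V f\<^esub> \<longleftrightarrow> x \<in> Ann W (dual_gen W \<sigma> f)" if "x \<in> carrier (mpoly_ring W)" for x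
      using that quot_zero[OF ideal_Ann, of "?\<Theta> x" V f] pe[of x] Ann_dual_gen[OF assms, of x] by (auto simp: Ap_def)
    show "Ap_scalar V f r = (?q \<circ> ?\<Theta>) (Const r)" for r
      by (simp add: Ap_scalar_def quot_map_def ring_map.poly_eval_Const[OF ring_map_Const])
  qed (auto simp: g.S.ring_axioms Ann_polys)
qed

lemma sum_split_first: "(\<Sum>i<n + 1. h i) = h 0 + (\<Sum>i\<in>{1..n}. h i)" for h :: "nat \<Rightarrow> 'b::comm_monoid_add"
proof -
  have "{..<n + 1} = insert 0 {1..n}" by auto
  thus ?thesis by simp
qed

lemma apair_mult_Const_mult: "apair f (s * (Const c * p)) = c * apair f (s * p)"
  by (simp add: mult.left_commute[of s])

lemma single_1_neq_0: "single v (1::nat) \<noteq> 0" "0 \<noteq> single v (1::nat)"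
  by (metis mon_deg_0 mon_deg_single zero_neq_one)+

lemma Ap_generators:
  fixes f :: "(nat, 'a::field_char_0) mpoly"
  assumes f: "f \<noteq> 0" "f \<in> polys {1..k}"
    and dim: "ring.dimension (Ap {1..k} f) (n + 1) (range (Ap_scalar {1..k} f)) (carrier (Ap {1..k} f))"
    and indep: "\<And>c. (\<Sum>i\<in>{1..k}. Const (c i) * Var i) \<in> Ann {1..k} f \<Longrightarrow> \<forall>i\<in>{1..k}. c i = 0"
  obtains \<sigma> where "k \<le> n" "\<And>i. i \<in> {1..n} \<Longrightarrow> \<sigma> i \<in> polys {1..k}" "\<And>i. i \<in> {1..n} \<Longrightarrow> \<sigma> i \<in> low_deg 1"
    "\<And>i. i \<in> {1..k} \<Longrightarrow> \<sigma> i = Var i"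
    "\<And>c. (\<Sum>i\<in>{1..n}. Const (c i) * \<sigma> i) \<in> Ann {1..k} f \<Longrightarrow> \<forall>i\<in>{1..n}. c i = 0"
    "\<And>p. p \<in> polys {1..k} \<Longrightarrow> \<exists>c0 c. p - (Const c0 + (\<Sum>i\<in>{1..n}. Const (c i) * \<sigma> i)) \<in> Ann {1..k} f"
proof -
  let ?V = "{1..k}"
  define b0 :: "nat \<Rightarrow> (nat, 'a) mpoly" where "b0 = (\<lambda>i. if i = 0 then 1 else Var i)"
  \<comment> \<open>An operator annihilating \<open>f\<close> has constant term 0, which separates 1
    from the variables; the variables among themselves are covered by \<open>indep\<close>.\<close>
  have b0: "indep_mod (Ann ?V f) (k + 1) b0"
    unfolding indep_mod_def
  proof (intro allI impI)
    fix c i assume "(\<Sum>i<k + 1. Const (c i) * b0 i) \<in> Ann ?V f" and i: "i < k + 1"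
    hence *: "Const (c 0) + (\<Sum>i\<in>{1..k}. Const (c i) * Var i) \<in> Ann ?V f"
      unfolding sum_split_first by (simp add: b0_def)
    have "lookup (Const (c 0) + (\<Sum>i\<in>{1..k}. Const (c i) * Var i)) 0 = c 0"
      by (simp add: lookup_add lookup_sum lookup_Const lookup_Var single_1_neq_0)
    with Ann_const_term[OF f(1) *] have c0: "c 0 = 0" by simp
    with * indep have "\<forall>i\<in>{1..k}. c i = 0" by simp
    thus "c i = 0" using c0 i by (cases "i = 0") auto
  qed
  have b0V: "b0 i \<in> polys ?V" if "i < k + 1" for i using that by (auto simp: b0_def polys_Var)
  obtain b where b: "k + 1 \<le> n + 1" "\<And>i. i < k + 1 \<Longrightarrow> b i = b0 i" "\<And>i. i < n + 1 \<Longrightarrow> b i \<in> polys ?V"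
    "indep_mod (Ann ?V f) (n + 1) b" "spans_mod ?V (Ann ?V f) (n + 1) b"
    using Ap_basis_extension[OF f(1) dim b0 b0V] by blast
  have b_0: "b 0 = 1" using b(2)[of 0] by (simp add: b0_def)
  \<comment> \<open>As 1 = \<open>b 0\<close> is in the basis, subtracting constant terms preserves
    independence and span, leaves the variables alone and moves the other elements into the maximal
    ideal.\<close>
  define \<sigma> where "\<sigma> i = b i - Const (lookup (b i) 0)" for i
  have sum_\<sigma>: "(\<Sum>i\<in>{1..n}. Const (c i) * \<sigma> i) =
      (\<Sum>i\<in>{1..n}. Const (c i) * b i) - Const (\<Sum>i\<in>{1..n}. c i * lookup (b i) 0)" for c
    by (simp add: \<sigma>_def right_diff_distrib sum_subtractf ring_map.sum[OF ring_map_Const] Const_mult)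
  show ?thesis
  proof (rule that[of \<sigma>])
    show "k \<le> n" using b(1) by simp
    show "\<sigma> i \<in> polys ?V" if "i \<in> {1..n}" for i
      using that b(3)[of i] by (auto simp: \<sigma>_def intro: polys_diff)
    show "\<sigma> i \<in> low_deg 1" for i by (simp add: low_deg_1_iff \<sigma>_def lookup_minus lookup_Const)
    show "\<sigma> i = Var i" if "i \<in> ?V" for i
    proof -
      have "single i (1::nat) \<noteq> 0" by (metis mon_deg_0 mon_deg_single zero_neq_one)
      thus ?thesis using that b(2)[of i] by (simp add: \<sigma>_def b0_def lookup_Var)
    qed
    show "\<forall>i\<in>{1..n}. c i = 0" if "(\<Sum>i\<in>{1..n}. Const (c i) * \<sigma> i) \<in> Ann ?V f" for c
    proof -
      define c' where "c' i = (if i = 0 then - (\<Sum>i\<in>{1..n}. c i * lookup (b i) 0) else c i)" for i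
      have "(\<Sum>i<n + 1. Const (c' i) * b i) = (\<Sum>i\<in>{1..n}. Const (c i) * \<sigma> i)"
        unfolding sum_split_first sum_\<sigma> by (simp add: c'_def b_0 ring_map.uminus[OF ring_map_Const])
      hence "\<forall>i<n + 1. c' i = 0" using b(4) that by (simp add: indep_mod_def)
      show ?thesis
      proof
        fix i assume "i \<in> {1..n}"
        hence "i < n + 1" "i \<noteq> 0" by auto
        thus "c i = 0" using \<open>\<forall>i<n + 1. c' i = 0\<close> by (auto simp: c'_def)
      qed
    qed
    show "\<exists>c0 c. p - (Const c0 + (\<Sum>i\<in>{1..n}. Const (c i) * \<sigma> i)) \<in> Ann ?V f" if p: "p \<in> polys ?V"
      for p :: "(nat, 'a) mpoly"
    proof -
      obtain c where c: "p - (\<Sum>i<n + 1. Const (c i) * b i) \<in> Ann ?V f"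
        using b(5) p by (auto simp: spans_mod_def)
      have "(\<Sum>i<n + 1. Const (c i) * b i) =
        Const (c 0 + (\<Sum>i\<in>{1..n}. c i * lookup (b i) 0)) + (\<Sum>i\<in>{1..n}. Const (c i) * \<sigma> i)"
        unfolding sum_split_first sum_\<sigma> by (simp add: b_0 Const_add)
      with c have "p - (Const (c 0 + (\<Sum>i\<in>{1..n}. c i * lookup (b i) 0)) +
          (\<Sum>i\<in>{1..n}. Const (c i) * \<sigma> i)) \<in> Ann ?V f" by (simp only:)
      thus ?thesis by blast
    qed
  qed
qed

context
  fixes f :: "(nat, 'a::field_char_0) mpoly" and k n :: nat and \<sigma> :: "nat \<Rightarrow> (nat, 'a) mpoly"
  assumes f: "f \<noteq> 0" "f \<in> polys {1..k}"
    and \<sigma>_polys: "\<And>i. i \<in> {1..n} \<Longrightarrow> \<sigma> i \<in> polys {1..k}"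
    and \<sigma>_low: "\<And>i. i \<in> {1..n} \<Longrightarrow> \<sigma> i \<in> low_deg 1"
    and span: "\<And>p. p \<in> polys {1..k} \<Longrightarrow>
      \<exists>c0 c. p - (Const c0 + (\<Sum>i\<in>{1..n}. Const (c i) * \<sigma> i)) \<in> Ann {1..k} f"
begin

text \<open>Modulo the annihilator every \<open>p\<close> is a combination of 1 and the
  \<open>\<sigma> i\<close>, so these finitely many tests decide.\<close>

lemma apair_eq_0_if_gens:
  assumes "apair f s = 0" "\<And>i. i \<in> {1..n} \<Longrightarrow> apair f (s * \<sigma> i) = 0" "p \<in> polys {1..k}"
  shows "apair f (s * p) = 0"
proof -
  obtain c0 c where c: "p - (Const c0 + (\<Sum>i\<in>{1..n}. Const (c i) * \<sigma> i)) \<in> Ann {1..k} f"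
    using span[OF assms(3)] by blast
  have "apair f (s * Const c0) = 0" using assms(1) by (simp add: mult.commute[of s])
  moreover have "apair f (s * (\<Sum>i\<in>{1..n}. Const (c i) * \<sigma> i)) = 0"
    using assms(2) by (simp add: sum_distrib_left apair_sum apair_mult_Const_mult)
  moreover have "apair f (s * (p - (Const c0 + (\<Sum>i\<in>{1..n}. Const (c i) * \<sigma> i)))) = 0"
    using AnnD[OF c, of s] by (simp add: mult.commute)
  ultimately show ?thesis by (simp add: right_diff_distrib distrib_left apair_diff apair_add)
qed

text \<open>For \<open>p\<close> in the maximal ideal the coefficient of 1 in its expansion is 0,
  because annihilators and the \<open>\<sigma> i\<close> have no constant term; hence the test
  against 1 drops out.\<close>

lemma apair_eq_0_if_gens_low:
  assumes "\<And>i. i \<in> {1..n} \<Longrightarrow> apair f (s * \<sigma> i) = 0" "p \<in> polys {1..k}" "p \<in> low_deg 1"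
  shows "apair f (s * p) = 0"
proof -
  obtain c0 c where c: "p - (Const c0 + (\<Sum>i\<in>{1..n}. Const (c i) * \<sigma> i)) \<in> Ann {1..k} f"
    using span[OF assms(2)] by blast
  have "lookup (p - (Const c0 + (\<Sum>i\<in>{1..n}. Const (c i) * \<sigma> i))) 0 = - c0"
    using assms(3) \<sigma>_low by (simp add: low_deg_1_iff lookup_minus lookup_add lookup_Const lookup_sum)
  with Ann_const_term[OF f(1) c] have "c0 = 0" by simp
  moreover have "apair f (s * (\<Sum>i\<in>{1..n}. Const (c i) * \<sigma> i)) = 0"
    using assms(1) by (simp add: sum_distrib_left apair_sum apair_mult_Const_mult)
  moreover have "apair f (s * (p - (Const c0 + (\<Sum>i\<in>{1..n}. Const (c i) * \<sigma> i)))) = 0"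
    using AnnD[OF c, of s] by (simp add: mult.commute)
  ultimately show ?thesis by (simp add: right_diff_distrib distrib_left apair_diff apair_add)
qed

lemma encompassing_dual_gen:
  assumes "k \<le> n" "\<And>i. i \<in> {1..k} \<Longrightarrow> \<sigma> i = Var i"
  shows "encompassing {1..n} (dual_gen {1..n} \<sigma> f)"
proof -
  let ?g = "dual_gen {1..n} \<sigma> f" and ?\<Theta> = "poly_eval Const \<sigma>"
  have "act \<tau> ?g = 0" if \<tau>: "\<tau> \<in> polys {1..n}" "upto_deg 1 (act \<tau> ?g) = 0" for \<tau>
  proof -
    have z: "apair ?g (\<tau> * single b 1) = 0" if "mon_deg b \<le> 1" for b
    proof -
      have "lookup (act \<tau> ?g) b = lookup (upto_deg 1 (act \<tau> ?g)) b" using that by (simp add: lookup_upto_deg)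
      thus ?thesis using \<tau>(2) by (simp add: lookup_act)
    qed
    have ap: "apair ?g (\<tau> * \<rho>) = apair f (?\<Theta> \<tau> * ?\<Theta> \<rho>)" if "\<rho> \<in> polys {1..n}" for \<rho>
      using apair_dual_gen[of "{1..n}" \<sigma> "\<tau> * \<rho>" f] that \<tau>(1) \<sigma>_low
      by (simp add: polys_mult ring_map.poly_eval_mult[OF ring_map_Const])
    have "apair f (?\<Theta> \<tau>) = 0"
      using z[of 0] ap[of 1] by (simp add: ring_map.poly_eval_1[OF ring_map_Const])
    moreover have "apair f (?\<Theta> \<tau> * \<sigma> i) = 0" if "i \<in> {1..n}" for i
      using z[of "single i 1"] ap[of "Var i"] that
      by (simp add: ring_map.poly_eval_Var[OF ring_map_Const] polys_Var flip: Var_def)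
    moreover have "?\<Theta> \<tau> \<in> polys {1..k}" using polys_poly_eval[OF \<tau>(1)] \<sigma>_polys by auto
    ultimately have "?\<Theta> \<tau> \<in> Ann {1..k} f"
      using apair_eq_0_if_gens[of "?\<Theta> \<tau>"] by (simp add: Ann_iff[OF f(2)])
    hence "\<tau> \<in> Ann {1..n} ?g"
      using Ann_dual_gen[of "{1..n}" \<sigma> "{1..k}" f \<tau>] assms \<sigma>_low \<sigma>_polys f(2) \<tau>(1) by auto
    thus ?thesis by (simp add: Ann_def)
  qed
  thus ?thesis by (auto simp: encompassing_def)
qed

text \<open>
  A linear relation \<open>c\<^sub>0 \<partial>\<^sub>0 G + \<Sum> c\<^sub>i \<partial>\<^sub>i G = 0\<close> says that \<open>w = c\<^sub>0 (e - 1) + \<Sum> c\<^sub>i \<sigma>\<^sub>i\<close> kills the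
  maximal ideal of \<open>Ap f\<close>; if \<open>c\<^sub>0 \<noteq> 0\<close> then \<open>w\<close> is a unit, because \<open>\<Sum> c\<^sub>i \<sigma>\<^sub>i\<close> is nilpotent.
\<close>

lemma concise_homogenize_dual_gen:
  assumes indep: "\<And>c. (\<Sum>i\<in>{1..n}. Const (c i) * \<sigma> i) \<in> Ann {1..k} f \<Longrightarrow> \<forall>i\<in>{1..n}. c i = 0"
    and deg: "\<And>m. lookup f m \<noteq> 0 \<Longrightarrow> mon_deg m \<le> e" and e: "e \<ge> 2" and n: "n \<ge> 1"
    and g: "dual_gen {1..n} \<sigma> f \<noteq> 0"
    and gdeg: "\<And>m. lookup (dual_gen {1..n} \<sigma> f) m \<noteq> 0 \<Longrightarrow> mon_deg m \<le> e"
  shows "concise {0..n} (homogenize e (dual_gen {1..n} \<sigma> f))"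
  unfolding concise_def
proof (intro notI, elim bexE conjE)
  let ?g = "dual_gen {1..n} \<sigma> f"
  let ?G = "homogenize e ?g"
  fix \<tau> assume \<tau>: "\<tau> \<in> Ann {0..n} ?G" "\<tau> \<noteq> 0" "tdeg \<tau> \<le> 1"
  define t where "t = lookup \<tau> 0"
  define c where "c i = lookup \<tau> (single i 1)" for i
  have \<tau>_eq: "\<tau> = Const t + (\<Sum>i\<in>{0..n}. Const (c i) * Var i)"
    unfolding t_def c_def by (rule tdeg_le_1_split[OF Ann_polys[OF \<tau>(1)] _ \<tau>(3)]) simp
  have lG: "lookup ?G m = (if mon_deg m = e then lookup ?g (mon_rest m) else 0)" for m
    by (rule lookup_homogenize[OF dual_gen_polys]) (use gdeg in auto)
  have lg: "of_nat (mfact b) * lookup ?g b = apair f (mon_eval \<sigma> b)" if "keys b \<subseteq> {1..n}" for b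
    by (subst lookup_dual_gen) (use that \<sigma>_low in auto)
  have rel: "t * (of_nat (mfact b) * lookup ?G b) +
      (\<Sum>i\<in>{0..n}. c i * (of_nat (mfact (b + single i 1)) * lookup ?G (b + single i 1))) = 0" for b
  proof -
    have "apair ?G (\<tau> * single b 1) = 0" by (rule AnnD[OF \<tau>(1)])
    thus ?thesis
      by (simp add: \<tau>_eq distrib_right sum_distrib_right apair_add apair_sum apair_Var_single del: apair_Const_mult)
        (simp add: apair_Const_mult)
  qed
  obtain b where b: "lookup ?G b \<noteq> 0"
  proof -
    obtain b where "lookup ?g b \<noteq> 0" using g by (metis lookup_zero poly_mapping_eqI)
    moreover from this have "lookup b 0 = 0" "mon_deg b \<le> e"
      using gdeg polys_lookup[OF dual_gen_polys, of "{1..n}" \<sigma> f b] by (auto simp: in_keys_iff)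
    ultimately have "lookup ?G (b + single 0 (e - mon_deg b)) \<noteq> 0"
      using lG mon_rest_eq_iff[of "b + single 0 (e - mon_deg b)" b] by (simp add: mon_deg_add)
    thus ?thesis by (rule that)
  qed
  \<comment> \<open>\<open>G\<close> has no terms of degree e + 1, so at a monomial of
    \<open>G\<close> only the constant part \<open>t\<close> of the relation survives.\<close>
  have "lookup ?G (b + single i 1) = 0" for i
    using b lG[of b] lG[of "b + single i 1"] by (auto simp: mon_deg_add split: if_splits)
  with rel[of b] b have t0: "t = 0" by simp
  define B where "B = (\<Sum>i\<in>{1..n}. Const (c i) * \<sigma> i)"
  have B: "B \<in> polys {1..k}" "B \<in> low_deg 1"
    unfolding B_def low_deg_1_iff using \<sigma>_polys \<sigma>_low
    by (auto intro!: polys_sum polys_mult simp: lookup_sum low_deg_1_iff)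
  have rel': "c 0 * of_nat (e - mon_deg \<beta>) * apair f (mon_eval \<sigma> \<beta>) + apair f (mon_eval \<sigma> \<beta> * B) = 0"
    if \<beta>: "keys \<beta> \<subseteq> {1..n}" "mon_deg \<beta> < e" for \<beta>
  proof -
    \<comment> \<open>The relation is read at x_0^j x^\<beta>, where one more variable leads to
      degree e. The derivative by x_0 contributes (j + 1)! against j! for the others, whence the
      factor j + 1 = e - \<open>mon_deg \<beta>\<close>.\<close>
    define j where "j = e - 1 - mon_deg \<beta>"
    define b where "b = \<beta> + single 0 j"
    have \<beta>0: "lookup \<beta> 0 = 0" using \<beta>(1) by (auto simp: subset_iff in_keys_iff)
    have j: "e - mon_deg \<beta> = Suc j" using \<beta>(2) by (simp add: j_def)
    have mr: "mon_rest (\<gamma> + single 0 l) = \<gamma>" if "lookup \<gamma> 0 = 0" for \<gamma> l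
      unfolding mon_rest_eq_iff using that by (simp add: mon_deg_add)
    have mf: "mfact (\<gamma> + single 0 l) = mfact \<gamma> * fact l" if "lookup \<gamma> 0 = 0" for \<gamma> l
      using that mfact_add_disjoint[of \<gamma> "single 0 l"] by (cases "l = 0") (auto simp: in_keys_iff)
    have t0: "of_nat (mfact (b + single 0 1)) * lookup ?G (b + single 0 1)
        = of_nat (Suc j) * fact j * apair f (mon_eval \<sigma> \<beta>)"
    proof -
      have "single 0 (Suc j) = single (0::nat) j + single 0 (1::nat)"
        by (simp only: Suc_eq_plus1 single_add)
      hence eq: "b + single 0 1 = \<beta> + single 0 (Suc j)" by (simp only: b_def add.assoc)
      have d: "mon_deg (\<beta> + single 0 (Suc j)) = e" using j \<beta>(2) by (simp add: mon_deg_add)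
      show ?thesis unfolding eq lg[OF \<beta>(1), symmetric]
        by (simp add: lG d mr[OF \<beta>0] mf[OF \<beta>0] algebra_simps)
    qed
    have ti: "of_nat (mfact (b + single i 1)) * lookup ?G (b + single i 1)
        = fact j * apair f (mon_eval \<sigma> \<beta> * \<sigma> i)" if i: "i \<in> {1..n}" for i
    proof -
      have eq: "b + single i 1 = (\<beta> + single i 1) + single 0 j" by (simp add: b_def add_ac)
      have z: "lookup (\<beta> + single i 1) 0 = 0" using i \<beta>0 by (auto simp: lookup_add lookup_single when_def)
      have ky: "keys (\<beta> + single i 1) \<subseteq> {1..n}" using \<beta>(1) i by (auto simp: keys_add_nat)
      have d: "mon_deg (\<beta> + single i 1 + single 0 j) = e" using j \<beta>(2) by (simp add: mon_deg_add)
      show ?thesis unfolding eq using lg[OF ky]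
        by (simp add: lG d mr[OF z] mf[OF z] mon_eval_add mult_ac)
    qed
    have "{0..n} = insert 0 {1..n}" by auto
    hence "c 0 * (of_nat (Suc j) * fact j * apair f (mon_eval \<sigma> \<beta>)) +
        (\<Sum>i\<in>{1..n}. c i * (fact j * apair f (mon_eval \<sigma> \<beta> * \<sigma> i))) = 0"
      using rel[of b] t0 ti \<open>t = 0\<close> by simp
    moreover have "(\<Sum>i\<in>{1..n}. c i * (fact j * apair f (mon_eval \<sigma> \<beta> * \<sigma> i))) = fact j * apair f (mon_eval \<sigma> \<beta> * B)"
      by (simp add: B_def sum_distrib_left apair_sum apair_mult_Const_mult mult.left_commute)
    ultimately have "fact j * (c 0 * of_nat (Suc j) * apair f (mon_eval \<sigma> \<beta>) + apair f (mon_eval \<sigma> \<beta> * B)) = 0"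
      by (simp add: algebra_simps)
    thus ?thesis unfolding j by simp
  qed
  \<comment> \<open>A single variable as \<open>\<beta>\<close> in \<open>rel'\<close> produces the
    factor e - 1, so \<open>w\<close> is orthogonal to every \<open>\<sigma> i\<close>.\<close>
  define w where "w = Const (c 0 * of_nat (e - 1)) + B"
  have w: "apair f (w * \<sigma> i) = 0" if "i \<in> {1..n}" for i
    using rel'[of "single i 1"] that e by (simp add: w_def distrib_right apair_add mult.commute[of B])
  have c0: "c 0 = 0"
  proof (rule ccontr)
    assume nz: "c 0 \<noteq> 0"
    define a where "a = c 0 * of_nat (e - 1)"
    have a: "a \<noteq> 0" using nz e by (simp add: a_def)
    have 1: "1 \<in> {1..n}" using n by simp
    \<comment> \<open>\<open>\<sigma> 1 * p\<close> lies in the maximal ideal, where orthogonality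
      to the generators is enough; thus \<open>w * \<sigma> 1\<close> annihilates
      \<open>f\<close>.\<close>
    have "apair f (w * \<sigma> 1 * p) = 0" if "p \<in> polys {1..k}" for p
      using apair_eq_0_if_gens_low[OF w, of "\<sigma> 1 * p"] that \<sigma>_polys[OF 1] \<sigma>_low[OF 1]
        low_deg_mult[OF \<sigma>_low[OF 1] low_deg_0, of p] by (simp add: polys_mult mult.assoc)
    moreover have "w * \<sigma> 1 \<in> polys {1..k}"
      unfolding w_def using B \<sigma>_polys[OF 1] by (intro polys_mult polys_add) auto
    ultimately have w1: "w * \<sigma> 1 \<in> Ann {1..k} f" by (simp add: Ann_iff[OF f(2)])
    \<comment> \<open>M exceeds the degree of \<open>f\<close>, so B^M annihilates \<open>f\<close>.
      Since w = a + B divides a^M - (-B)^M, also a^M times \<open>\<sigma> 1\<close> annihilates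
      \<open>f\<close>, against independence.\<close>
    define M where "M = e + 1"
    have "Const a ^ M - (- B) ^ M = w * (\<Sum>i<M. (- B) ^ (M - Suc i) * Const a ^ i)"
      using power_diff_sumr2[of "Const a" M "- B"] by (simp add: w_def a_def add.commute)
    hence "(Const a ^ M - (- B) ^ M) * \<sigma> 1 = (w * \<sigma> 1) * (\<Sum>i<M. (- B) ^ (M - Suc i) * Const a ^ i)"
      by (simp add: mult_ac)
    also have "\<dots> \<in> Ann {1..k} f"
      using B(1) by (intro Ann_mult[OF w1] polys_sum polys_mult polys_power polys_uminus polys_Const)
    finally have "(Const a ^ M - (- B) ^ M) * \<sigma> 1 \<in> Ann {1..k} f" .
    moreover have "(- B) ^ M * \<sigma> 1 \<in> Ann {1..k} f"
    proof (intro Ann_mult low_deg_Ann[where d = M] polys_power polys_uminus B(1) \<sigma>_polys[OF 1])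
      have "- B \<in> low_deg 1" using B(2) by (simp add: low_deg_1_iff)
      from low_deg_power[OF this, of M] show "(- B) ^ M \<in> low_deg M" by simp
      show "mon_deg m < M" if "lookup f m \<noteq> 0" for m using deg[OF that] by (simp add: M_def)
    qed
    ultimately have "(Const a ^ M - (- B) ^ M) * \<sigma> 1 + (- B) ^ M * \<sigma> 1 \<in> Ann {1..k} f" by (rule Ann_add)
    hence "Const (a ^ M) * \<sigma> 1 \<in> Ann {1..k} f"
      by (simp add: algebra_simps ring_map.power[OF ring_map_Const])
    moreover have "(\<Sum>i\<in>{1..n}. Const (if i = 1 then a ^ M else 0) * \<sigma> i) = Const (a ^ M) * \<sigma> 1"
      using n by (subst sum.remove[of _ 1]) (auto intro!: sum.neutral)
    ultimately have "\<forall>i\<in>{1..n}. (if i = 1 then a ^ M else 0) = 0" by (intro indep) simp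
    from bspec[OF this 1] have "a ^ M = 0" by simp
    thus False using a by simp
  qed
  \<comment> \<open>With \<open>c 0\<close> = 0 the relation at \<open>\<beta>\<close> = 0 makes B
    orthogonal to 1, and now w = B is orthogonal to every \<open>\<sigma> i\<close>: a full basis is
    tested.\<close>
  have "apair f B = 0" using rel'[of 0] c0 e by simp
  moreover have "apair f (B * \<sigma> i) = 0" if "i \<in> {1..n}" for i
    using w[OF that] c0 by (simp add: w_def)
  ultimately have "B \<in> Ann {1..k} f"
    using apair_eq_0_if_gens[of B] B(1) by (simp add: Ann_iff[OF f(2)])
  hence "\<forall>i\<in>{1..n}. c i = 0" unfolding B_def by (rule indep)
  hence "c i = 0" if "i \<in> {0..n}" for i using c0 that by (cases "i = 0") auto
  hence "\<tau> = 0" using \<tau>_eq t0 by simp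
  thus False using \<tau>(2) by simp
qed

end

theorem encompassing_extension:
  fixes F :: "(nat, 'a::field_char_0) mpoly"
  assumes F: "F \<in> polys {0..k}" "homogeneous F" "concise {0..k} F" "f = dehomogenize F"
    and smooth: "smoothable (Ap_scalar {1..k} f) (Ap {1..k} f)"
    and dim: "ring.dimension (Ap {1..k} f) (n + 1) (range (Ap_scalar {1..k} f)) (carrier (Ap {1..k} f))"
  shows "\<exists>G g. G \<in> polys {0..n} \<and> homogeneous G \<and> concise {0..n} G \<and>
            F = set_zero {k+1..n} G \<and>
            g = dehomogenize G \<and> encompassing {1..n} g \<and>
            smoothable (Ap_scalar {1..n} g) (Ap {1..n} g) \<and>
            algebra_iso (Ap_scalar {1..n} g) (Ap {1..n} g) (Ap_scalar {1..k} f) (Ap {1..k} f)"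
proof -
  have F0: "F \<noteq> 0" by (rule concise_nonzero[OF F(3)])
  obtain e where e: "F \<in> forms {0..k} e"
    using F(1,2) by (auto simp: homogeneous_def forms_def)
  have f0: "f \<noteq> 0" using dehomogenize_nonzero[OF e F0] F(4) by simp
  have "{0..k} - {0} = {1..k}" by auto
  hence fp: "f \<in> polys {1..k}" using dehomogenize_polys[OF F(1)] F(4) by simp
  have lf: "lookup f b = (if lookup b 0 = 0 \<and> mon_deg b \<le> e then lookup F (b + single 0 (e - mon_deg b)) else 0)" for b
    unfolding F(4) by (rule lookup_dehomogenize[OF e])
  have lF: "lookup F m = lookup f (mon_rest m)" if "mon_deg m = e" for m
    unfolding F(4) using lookup_form_dehomogenize[OF e that] .
  have fdeg: "mon_deg m \<le> e" if "lookup f m \<noteq> 0" for m using that lf by (auto split: if_splits)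
  \<comment> \<open>A relation without x_0 that kills \<open>f\<close> kills \<open>F\<close>:
    coefficients of \<open>F\<close> at b are those of \<open>f\<close> at
    \<open>mon_rest b\<close>, and the factorial of the x_0 exponent is common to all terms.
    Conciseness then applies.\<close>
  have indep0: "\<forall>i\<in>{1..k}. c i = 0" if c: "(\<Sum>i\<in>{1..k}. Const (c i) * Var i) \<in> Ann {1..k} f" for c
  proof -
    have "(\<Sum>i\<in>{1..k}. Const (c i) * Var i) \<in> Ann {0..k} F"
    proof (subst Ann_linear_iff)
      show "\<forall>b. (\<Sum>i\<in>{1..k}. c i * (of_nat (mfact (b + single i 1)) * lookup F (b + single i 1))) = 0"
      proof
        fix b
        show "(\<Sum>i\<in>{1..k}. c i * (of_nat (mfact (b + single i 1)) * lookup F (b + single i 1))) = 0"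
        proof (cases "mon_deg b + 1 = e")
          case True
          have mr: "mon_rest (b + single i 1) = mon_rest b + single i 1" if "i \<in> {1..k}" for i
            by (rule poly_mapping_eqI) (use that in \<open>auto simp: lookup_mon_rest lookup_add lookup_single when_def\<close>)
          have mf: "mfact (b + single i 1) = fact (lookup b 0) * mfact (mon_rest b + single i 1)" if i: "i \<in> {1..k}" for i
          proof -
            let ?m = "mon_rest b + single i 1" and ?l = "single 0 (lookup b 0)"
            have "b + single i 1 = ?m + ?l"
              using arg_cong[OF mon_rest_split[of b], of "\<lambda>x. x + single i 1"] by (simp add: add_ac)
            moreover have "keys ?m \<inter> keys ?l = {}"
              using i by (auto simp: keys_add_nat in_keys_iff lookup_mon_rest lookup_single when_def)
            ultimately show ?thesis using mfact_add_disjoint[of ?m ?l] by simp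
          qed
          have "(\<Sum>i\<in>{1..k}. c i * (of_nat (mfact (mon_rest b + single i 1)) * lookup f (mon_rest b + single i 1))) = 0"
            using c by (subst (asm) Ann_linear_iff) auto
          hence "fact (lookup b 0) * (\<Sum>i\<in>{1..k}. c i * (of_nat (mfact (mon_rest b + single i 1)) *
             lookup f (mon_rest b + single i 1))) = 0" by simp
          also have "fact (lookup b 0) * (\<Sum>i\<in>{1..k}. c i * (of_nat (mfact (mon_rest b + single i 1)) *
             lookup f (mon_rest b + single i 1))) =
             (\<Sum>i\<in>{1..k}. c i * (of_nat (mfact (b + single i 1)) * lookup F (b + single i 1)))"
            unfolding sum_distrib_left using True
            by (intro sum.cong refl) (simp add: lF mon_deg_add mr mf mult_ac)
          finally show ?thesis .
        next
          case False
          hence "lookup F (b + single i 1) = 0" for i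
            using forms_lookup[OF e, of "b + single i 1"] by (auto simp: mon_deg_add)
          thus ?thesis by simp
        qed
      qed
    qed auto
    from concise_linear_zero[OF F(3) _ _ this] show ?thesis by auto
  qed
  obtain \<sigma> where kn: "k \<le> n" and \<sigma>: "\<And>i. i \<in> {1..n} \<Longrightarrow> \<sigma> i \<in> polys {1..k}" "\<And>i. i \<in> {1..n} \<Longrightarrow> \<sigma> i \<in> low_deg 1"
      "\<And>i. i \<in> {1..k} \<Longrightarrow> \<sigma> i = Var i"
    and indep: "\<And>c. (\<Sum>i\<in>{1..n}. Const (c i) * \<sigma> i) \<in> Ann {1..k} f \<Longrightarrow> \<forall>i\<in>{1..n}. c i = 0"
    and span: "\<And>p. p \<in> polys {1..k} \<Longrightarrow> \<exists>c0 c. p - (Const c0 + (\<Sum>i\<in>{1..n}. Const (c i) * \<sigma> i)) \<in> Ann {1..k} f"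
    using Ap_generators[OF f0 fp dim indep0] by blast
  define g where "g = dual_gen {1..n} \<sigma> f"
  have gp: "g \<in> polys {1..n}" by (simp add: g_def dual_gen_polys)
  have lg: "lookup g b = (if keys b \<subseteq> {1..n} then apair f (mon_eval \<sigma> b) / of_nat (mfact b) else 0)" for b
    unfolding g_def by (rule lookup_dual_gen) (use \<sigma> in auto)
  have gdeg: "mon_deg m \<le> e" if "lookup g m \<noteq> 0" for m
  proof (rule ccontr)
    assume "\<not> mon_deg m \<le> e"
    moreover have "keys m \<subseteq> {1..n}" using that lg by (auto split: if_splits)
    ultimately have "apair f (mon_eval \<sigma> m) = 0"
      using \<sigma>(2) fdeg by (intro apair_low_deg[OF low_deg_mon_eval]) (auto simp: not_le intro: le_less_trans)
    thus False using that lg by (auto split: if_splits)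
  qed
  have lgf: "lookup g b = lookup f b" if "keys b \<subseteq> {1..k}" for b
  proof -
    have "mon_eval \<sigma> b = mon_eval Var b" using that \<sigma>(3) by (intro mon_eval_cong) auto
    moreover have "keys b \<subseteq> {1..n}" using that kn by auto
    ultimately show ?thesis by (simp add: lg mon_eval_Var)
  qed
  define G where "G = homogenize e g"
  have lG: "lookup G m = (if mon_deg m = e then lookup g (mon_rest m) else 0)" for m
    unfolding G_def by (rule lookup_homogenize[OF gp]) (use gdeg in auto)
  have "insert 0 {1..n} = {0..n}" by auto
  hence Gforms: "G \<in> forms {0..n} e"
    using homogenize_forms[OF gp, of e] gdeg by (simp add: G_def)
  have dG: "dehomogenize G = g"
    unfolding G_def by (rule dehomogenize_homogenize[OF gp]) (use gdeg in auto)
  have FG: "F = set_zero {k+1..n} G"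
  proof (rule poly_mapping_eqI)
    fix m
    show "lookup F m = lookup (set_zero {k+1..n} G) m"
    proof (cases "mon_deg m = e \<and> keys m \<subseteq> {0..k}")
      case True
      hence "keys (mon_rest m) \<subseteq> {1..k}" by (auto simp: in_keys_iff lookup_mon_rest subset_iff split: if_splits)
      moreover have "keys m \<inter> {k+1..n} = {}" using True by auto
      ultimately show ?thesis using True by (simp add: lookup_set_zero lG lgf lF)
    next
      case False
      hence "lookup F m = 0" using forms_lookup[OF e, of m] by blast
      moreover have "lookup (set_zero {k+1..n} G) m = 0"
      proof (rule ccontr)
        assume "lookup (set_zero {k+1..n} G) m \<noteq> 0"
        hence "keys m \<inter> {k+1..n} = {}" "lookup G m \<noteq> 0" by (auto simp: lookup_set_zero split: if_splits)
        moreover from this(2) have "keys m \<subseteq> {0..n}" "mon_deg m = e" using forms_lookup[OF Gforms] by auto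
        moreover have "{0..n} \<inter> - {k+1..n} \<subseteq> {0..k}" by auto
        ultimately show False using False by blast
      qed
      ultimately show ?thesis by simp
    qed
  qed
  have gne: "g \<noteq> 0"
  proof
    assume "g = 0"
    hence "F = 0" unfolding FG by (intro poly_mapping_eqI) (simp add: lookup_set_zero lG)
    thus False using F0 by simp
  qed
  have conc: "concise {0..n} G"
  \<comment> \<open>For n = 0 nothing is added and \<open>G\<close> is \<open>F\<close>. For n > 0
    the degree is at least 2: with k = 0 the element \<open>\<sigma> 1\<close> would be 0, a
    constant \<open>F\<close> is killed by the derivative by x_0, and a concise linear form has only
    one variable.\<close>
  proof (cases "n = 0")
    case True
    hence "k = 0" using kn by simp
    have "set_zero {k+1..n} G = G" by (rule poly_mapping_eqI) (simp add: lookup_set_zero True)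
    thus ?thesis using F(3) FG True \<open>k = 0\<close> by simp
  next
    case False
    have 1: "1 \<in> {1..n}" using False by simp
    have "k \<noteq> 0"
    proof
      assume "k = 0"
      have "lookup (\<sigma> 1) m = 0" for m
      proof (cases "m = 0")
        case False
        then obtain v where "v \<in> keys m" by (metis equals0I keys_eq_empty)
        moreover have "{1..k} = {}" using \<open>k = 0\<close> by simp
        ultimately show ?thesis using polys_lookup[OF \<sigma>(1)[OF 1], of m] by blast
      qed (use \<sigma>(2)[OF 1] in \<open>simp add: low_deg_1_iff\<close>)
      hence "\<sigma> 1 = 0" by (intro poly_mapping_eqI) simp
      hence "(\<Sum>i\<in>{1..n}. Const (if i = 1 then 1 else 0) * \<sigma> i) = 0" by (intro sum.neutral) auto
      hence "\<forall>i\<in>{1..n}. (if i = 1 then 1 else 0) = (0::'a)" by (intro indep) simp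
      from bspec[OF this 1] show False by simp
    qed
    have "e \<noteq> 0"
    proof
      assume "e = 0"
      hence "lookup F (b + single 0 1) = 0" for b
        using forms_lookup[OF e, of "b + single 0 1"] by (auto simp: mon_deg_add simp del: single_one)
      hence "(\<Sum>i\<in>{0}. Const 1 * Var i) \<in> Ann {0..k} F"
        by (subst Ann_linear_iff) (auto simp del: single_one)
      from concise_linear_zero[OF F(3) _ _ this, of 0] show False by simp
    qed
    moreover have "e \<noteq> 1"
    proof
      assume "e = 1"
      with concise_linear_form[of F "{0..k}" 0 1] e F(3) \<open>k \<noteq> 0\<close> show False by auto
    qed
    ultimately have "e \<ge> 2" by linarith
    thus ?thesis unfolding G_def g_def
      by (intro concise_homogenize_dual_gen[OF f0 fp \<sigma>(1,2) span indep fdeg])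
        (use False gne gdeg in \<open>auto simp: g_def\<close>)
  qed
  have "{1..k} \<subseteq> {1..n}" using kn by auto
  hence iso: "algebra_iso (Ap_scalar {1..n} g) (Ap {1..n} g) (Ap_scalar {1..k} f) (Ap {1..k} f)"
    unfolding g_def by (intro Ap_dual_gen_iso fp \<sigma>) auto
  have "algebra_iso (Ap_scalar {1..k} f) (Ap {1..k} f) (Ap_scalar {1..n} g) (Ap {1..n} g)"
    by (rule algebra_iso_sym[OF iso])
      (use Ap_algebra[of "{1..n}" g] is_algebra_closed cring.axioms(1) in \<open>auto simp: is_algebra_def\<close>)
  hence "smoothable (Ap_scalar {1..n} g) (Ap {1..n} g)"
    by (rule smoothable_iso[OF smooth _ Ap_algebra])
  moreover have "encompassing {1..n} g" unfolding g_def
    by (rule encompassing_dual_gen[OF f0 fp \<sigma>(1,2) span kn \<sigma>(3)])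
  ultimately show ?thesis
    using Gforms conc FG dG iso
    by (intro exI[of _ G] exI[of _ g]) (auto simp: forms_def homogeneous_def)
qed

section \<open>Finite formally smooth algebras in characteristic zero\<close>

text \<open>Gaussian elimination on the last coordinate: a pivot vector clears it from the others,
  the induction gives a relation among those, and the coefficient of the pivot is then fixed by the
  last equation.\<close>

lemma more_vectors_dependent:
  fixes a :: "'t \<Rightarrow> nat \<Rightarrow> 'f::field"
  assumes "finite T" "card T > r"
  shows "\<exists>\<mu>. (\<exists>t\<in>T. \<mu> t \<noteq> 0) \<and> (\<forall>i<r. (\<Sum>t\<in>T. \<mu> t * a t i) = 0)"
  using assms
proof (induction r arbitrary: T a)
  case 0
  hence "T \<noteq> {}" by auto
  thus ?case by (intro exI[of _ "\<lambda>_. 1"]) auto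
next
  case (Suc r)
  show ?case
  proof (cases "\<forall>t\<in>T. a t r = 0")
    case True
    obtain \<mu> where "\<exists>t\<in>T. \<mu> t \<noteq> 0" "\<forall>i<r. (\<Sum>t\<in>T. \<mu> t * a t i) = 0"
      using Suc.IH[of T a] Suc.prems by auto
    with True show ?thesis by (intro exI[of _ \<mu>]) (auto simp: less_Suc_eq)
  next
    case False
    then obtain t0 where t0: "t0 \<in> T" "a t0 r \<noteq> 0" by auto
    define T' where "T' = T - {t0}"
    have T': "finite T'" "card T' > r" "T = insert t0 T'" "t0 \<notin> T'"
      using Suc.prems t0 by (auto simp: T'_def)
    obtain \<mu> where \<mu>: "\<exists>t\<in>T'. \<mu> t \<noteq> 0"
      "\<forall>i<r. (\<Sum>t\<in>T'. \<mu> t * (a t i - a t r / a t0 r * a t0 i)) = 0"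
      using Suc.IH[OF T'(1,2), of "\<lambda>t i. a t i - a t r / a t0 r * a t0 i"] by auto
    define s where "s = (\<Sum>t\<in>T'. \<mu> t * a t r)"
    define \<nu> where "\<nu> t = (if t = t0 then - s / a t0 r else \<mu> t)" for t
    have sum: "(\<Sum>t\<in>T. \<nu> t * a t i) = - s / a t0 r * a t0 i + (\<Sum>t\<in>T'. \<mu> t * a t i)" for i
    proof -
      have "(\<Sum>t\<in>T'. \<nu> t * a t i) = (\<Sum>t\<in>T'. \<mu> t * a t i)"
        using T'(4) by (intro sum.cong refl) (auto simp: \<nu>_def)
      thus ?thesis using T'(1,4) by (simp add: T'(3) \<nu>_def)
    qed
    have "(\<Sum>t\<in>T. \<nu> t * a t i) = 0" if "i < Suc r" for i
    proof (cases "i = r")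
      case True
      thus ?thesis using t0 by (simp add: sum s_def)
    next
      case False
      hence "i < r" using that by simp
      with \<mu>(2) have "(\<Sum>t\<in>T'. \<mu> t * a t i) = (\<Sum>t\<in>T'. \<mu> t * (a t r / a t0 r * a t0 i))"
        by (simp add: right_diff_distrib sum_subtractf)
      also have "\<dots> = s / a t0 r * a t0 i" by (simp add: s_def sum_distrib_right sum_divide_distrib mult.assoc)
      finally show ?thesis by (simp add: sum)
    qed
    moreover have "\<exists>t\<in>T. \<nu> t \<noteq> 0" using \<mu>(1) T'(3,4) by (auto simp: \<nu>_def)
    ultimately show ?thesis by blast
  qed
qed

section \<open>Partial derivatives as derivations\<close>

lemma partial_add: "partial i (p + q) = partial i p + partial i q"
  by (rule poly_mapping_eqI) (simp add: lookup_partial lookup_add distrib_left)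

lemma partial_0 [simp]: "partial i 0 = 0"
  by (rule poly_mapping_eqI) (simp add: lookup_partial)

lemma partial_diff: "partial i (p - q) = partial i p - partial i q"
  by (rule poly_mapping_eqI) (simp add: lookup_partial lookup_minus right_diff_distrib)

lemma partial_single:
  "partial i (single m c) = single (m - single i 1) (of_nat (lookup m i) * c)"
  by (cases "c = 0") (simp_all add: partial_def)

lemma partial_mult: "partial i (p * q) = partial i p * q + p * partial i q"
proof (induction p rule: mpoly_induct)
  case (single a c)
  show ?case
  proof (induction q rule: mpoly_induct)
    case (single b d)
    \<comment> \<open>Truncated subtraction commutes with adding \<open>b\<close> only if x_i
      divides the monomial \<open>a\<close>; otherwise the coefficient \<open>lookup a i\<close> is
      0 and both sides vanish.\<close>
    have 1: "single (a + b - single i 1) (of_nat (lookup a i) * e) =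
        single (a - single i 1 + b) (of_nat (lookup a i) * e)" for e :: 'a
    proof (cases "lookup a i = 0")
      case False
      have "a + b - single i 1 = a - single i 1 + b"
        by (rule poly_mapping_eqI) (use False in \<open>auto simp: lookup_add lookup_minus lookup_single when_def\<close>)
      thus ?thesis by simp
    qed simp
    have 2: "single (a + b - single i 1) (of_nat (lookup b i) * e) =
        single (a + (b - single i 1)) (of_nat (lookup b i) * e)" for e :: 'a
    proof (cases "lookup b i = 0")
      case False
      have "a + b - single i 1 = a + (b - single i 1)"
        by (rule poly_mapping_eqI) (use False in \<open>auto simp: lookup_add lookup_minus lookup_single when_def\<close>)
      thus ?thesis by simp
    qed simp
    have "partial i (single a c * single b d) =
       single (a + b - single i 1) (of_nat (lookup a i) * (c * d)) +
       single (a + b - single i 1) (of_nat (lookup b i) * (c * d))"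
      by (simp add: mult_single partial_single lookup_add distrib_right single_add)
    also have "\<dots> = partial i (single a c) * single b d + single a c * partial i (single b d)"
      unfolding 1 2 by (simp add: partial_single mult_single mult_ac add_ac)
    finally show ?case .
  qed (simp_all add: distrib_left partial_add)
qed (simp_all add: distrib_right partial_add)

lemma partial_Const [simp]: "partial i (Const c) = 0"
  by (simp add: Const_def partial_single)

lemma partial_Const_mult: "partial i (Const c * p) = Const c * partial i p"
  by (simp add: partial_mult)

lemma partial_Var: "partial i (Var v) = (if i = v then 1 else 0)"
  by (simp add: Var_def partial_single lookup_single when_def)

lemma partial_polys:
  assumes "p \<in> polys V"
  shows "partial i p \<in> polys V"
proof (rule polysI)
  fix m assume "lookup (partial i p) m \<noteq> 0"
  hence "lookup p (m + single i 1) \<noteq> 0" by (auto simp: lookup_partial)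
  from polys_lookup[OF assms this] show "keys m \<subseteq> V" by (simp add: keys_add_nat)
qed

text \<open>
  \<open>k[V] / I\<close> is a finite \<open>k\<close>-algebra with coordinate functionals \<open>w i\<close>, and \<open>S\<close> induces a section of
  \<open>k[V] / I\<^sup>2 \<rightarrow> k[V] / I\<close>; of \<open>S I \<subseteq> I\<^sup>2\<close> only the consequence for first derivatives matters.
  The points of the algebra live in an algebraically closed extension \<open>\<iota> : k \<rightarrow> l\<close>.
\<close>

locale finite_smooth_algebra = \<iota>: ring_map \<iota> + S: ring_map S
  for \<iota> :: "'k::field_char_0 \<Rightarrow> 'l::alg_closed_field"
    and S :: "(nat, 'k) mpoly \<Rightarrow> (nat, 'k) mpoly" +
  fixes V :: "nat set" and I :: "(nat, 'k) mpoly set" and r :: nat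
    and w :: "nat \<Rightarrow> (nat, 'k) mpoly \<Rightarrow> 'k" and b :: "nat \<Rightarrow> (nat, 'k) mpoly"
  assumes finV: "finite V"
    and I_polys: "I \<subseteq> polys V" and I_0: "0 \<in> I"
    and I_add: "p \<in> I \<Longrightarrow> q \<in> I \<Longrightarrow> p + q \<in> I"
    and I_mult: "p \<in> I \<Longrightarrow> q \<in> polys V \<Longrightarrow> p * q \<in> I"
    and w_I: "p \<in> I \<Longrightarrow> i < r \<Longrightarrow> w i p = 0"
    and w_add: "p \<in> polys V \<Longrightarrow> q \<in> polys V \<Longrightarrow> i < r \<Longrightarrow> w i (p + q) = w i p + w i q"
    and w_Const: "p \<in> polys V \<Longrightarrow> i < r \<Longrightarrow> w i (Const c * p) = c * w i p"
    and b_polys: "i < r \<Longrightarrow> b i \<in> polys V"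
    and expand: "p \<in> polys V \<Longrightarrow> p - (\<Sum>i<r. Const (w i p) * b i) \<in> I"
    and S_polys: "p \<in> polys V \<Longrightarrow> S p \<in> polys V"
    and S_Const: "S (Const c) = Const c"
    and S_diff: "p \<in> polys V \<Longrightarrow> S p - p \<in> I"
    and S_partial: "p \<in> I \<Longrightarrow> v \<in> V \<Longrightarrow> partial v (S p) \<in> I"
begin

lemma I_Const: "p \<in> I \<Longrightarrow> Const c * p \<in> I"
  using I_mult[of p "Const c"] by (simp add: mult.commute)

lemma I_uminus: "p \<in> I \<Longrightarrow> - p \<in> I"
  using I_Const[of p "- 1"] by (simp add: ring_map.uminus[OF ring_map_Const])

lemma I_diff: "p \<in> I \<Longrightarrow> q \<in> I \<Longrightarrow> p - q \<in> I"
  using I_add[of p "- q"] I_uminus[of q] by simp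

lemma \<iota>_eq_0_iff: "\<iota> x = 0 \<longleftrightarrow> x = 0"
proof
  assume "\<iota> x = 0"
  hence "\<iota> (x * inverse x) = 0" by (simp add: \<iota>.mult)
  thus "x = 0" using \<iota>.one by (cases "x = 0") auto
qed (simp add: \<iota>.zero)

lemma mem_I_iff: "p \<in> polys V \<Longrightarrow> (\<And>i. i < r \<Longrightarrow> w i p = 0) \<Longrightarrow> p \<in> I"
  using expand[of p] by simp

lemma w_sum:
  "finite A \<Longrightarrow> (\<And>j. j \<in> A \<Longrightarrow> p j \<in> polys V) \<Longrightarrow> i < r \<Longrightarrow> w i (\<Sum>j\<in>A. p j) = (\<Sum>j\<in>A. w i (p j))"
proof (induction A rule: finite_induct)
  case empty
  thus ?case using w_I[OF I_0] by simp
qed (auto simp: w_add polys_sum)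

text \<open>The r + 1 powers of \<open>x\<close> have only r coordinates modulo \<open>I\<close>, so
  they are linearly dependent there.\<close>

lemma algebraic:
  assumes "x \<in> polys V"
  obtains d where "\<exists>l\<le>r. d l \<noteq> 0" "(\<Sum>l\<le>r. Const (d l) * x ^ l) \<in> I"
proof -
  obtain d where d: "\<exists>l\<in>{..r}. d l \<noteq> 0" "\<forall>i<r. (\<Sum>l\<in>{..r}. d l * w i (x ^ l)) = 0"
    using more_vectors_dependent[of "{..r}" r "\<lambda>l i. w i (x ^ l)"] by auto
  have "(\<Sum>l\<le>r. Const (d l) * x ^ l) \<in> I"
  proof (rule mem_I_iff)
    show "(\<Sum>l\<le>r. Const (d l) * x ^ l) \<in> polys V" using assms by (intro polys_sum polys_mult polys_power) auto
    fix i assume i: "i < r"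
    have "w i (\<Sum>l\<le>r. Const (d l) * x ^ l) = (\<Sum>l\<le>r. w i (Const (d l) * x ^ l))"
      using assms i by (intro w_sum) (auto intro: polys_mult polys_power)
    also have "\<dots> = (\<Sum>l\<le>r. d l * w i (x ^ l))"
      using assms i by (intro sum.cong refl w_Const polys_power)
    finally show "w i (\<Sum>l\<le>r. Const (d l) * x ^ l) = 0" using d(2) i by simp
  qed
  thus ?thesis using d(1) that by auto
qed

abbreviation ev :: "(nat \<Rightarrow> 'l) \<Rightarrow> (nat, 'k) mpoly \<Rightarrow> 'l" where
  "ev \<equiv> poly_eval \<iota>"

lemma ring_map_ev: "ring_map (ev \<xi>)"
  by (rule \<iota>.ring_map_poly_eval)

lemmas ev_simps = ring_map.add[OF ring_map_ev] ring_map.diff[OF ring_map_ev] ring_map.mult[OF ring_map_ev]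
  ring_map.power[OF ring_map_ev] ring_map.sum[OF ring_map_ev] ring_map.of_nat[OF ring_map_ev]
  ring_map.one[OF ring_map_ev] ring_map.zero[OF ring_map_ev] \<iota>.poly_eval_Var

text \<open>Coordinates outside \<open>V\<close> are fixed to 0, so that points agreeing on
  \<open>V\<close> are equal.\<close>

definition zeros :: "(nat \<Rightarrow> 'l) set" where
  "zeros = {\<xi>. (\<forall>v. v \<notin> V \<longrightarrow> \<xi> v = 0) \<and> (\<forall>p\<in>I. ev \<xi> p = 0)}"

lemma ev_I: "\<xi> \<in> zeros \<Longrightarrow> p \<in> I \<Longrightarrow> ev \<xi> p = 0"
  by (simp add: zeros_def)

subsection \<open>Tangent vectors vanish\<close>

text \<open>Induces a derivation of k[V] / I into itself: \<open>S\<close> is multiplicative and the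
  identity modulo \<open>I\<close>, which gives the Leibniz rule modulo \<open>I\<close>, and
  \<open>S_partial\<close> makes it vanish on \<open>I\<close>. These derivations measure how far
  the section moves the variables.\<close>

definition D :: "nat \<Rightarrow> (nat, 'k) mpoly \<Rightarrow> (nat, 'k) mpoly" where
  "D v p = partial v (S p)"

lemma D_polys: "p \<in> polys V \<Longrightarrow> D v p \<in> polys V"
  by (simp add: D_def partial_polys S_polys)

lemma D_add: "D v (p + q) = D v p + D v q"
  by (simp add: D_def S.add partial_add)

lemma D_Const_mult: "D v (Const c * p) = Const c * D v p"
  by (simp add: D_def S.mult S_Const partial_Const_mult)

lemma D_mult:
  assumes "p \<in> polys V" "q \<in> polys V"
  shows "D v (p * q) - (D v p * q + p * D v q) \<in> I"
proof -
  have "D v (p * q) - (D v p * q + p * D v q) = (S q - q) * D v p + (S p - p) * D v q"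
    by (simp add: D_def S.mult partial_mult algebra_simps)
  also have "\<dots> \<in> I" using assms by (intro I_add I_mult S_diff D_polys)
  finally show ?thesis .
qed

lemma D_power:
  assumes "p \<in> polys V"
  shows "D v (p ^ n) - of_nat n * p ^ (n - 1) * D v p \<in> I"
proof (induction n)
  case 0
  have "D v 1 = 0" using S.one by (simp add: D_def) (metis Const_1 partial_Const)
  thus ?case by (simp add: I_0)
next
  case (Suc n)
  \<comment> \<open>The exponent n - 1 is truncated at n = 0, where the factor
    \<open>of_nat n\<close> is 0.\<close>
  have eq: "of_nat n * p ^ (n - 1) * p = of_nat n * p ^ n" by (cases n) auto
  have "D v (p ^ Suc n) - of_nat (Suc n) * p ^ (Suc n - 1) * D v p =
    (D v (p * p ^ n) - (D v p * p ^ n + p * D v (p ^ n))) + (D v (p ^ n) - of_nat n * p ^ (n - 1) * D v p) * p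
     + (of_nat n * p ^ (n - 1) * p - of_nat n * p ^ n) * D v p"
    by (simp add: algebra_simps)
  also have "\<dots> \<in> I"
    unfolding eq using Suc assms by (auto intro!: I_add I_mult D_mult polys_power I_0)
  finally show ?case .
qed

context
  fixes \<xi> assumes \<xi>: "\<xi> \<in> zeros"
begin

lemma ev_D_power:
  assumes "p \<in> polys V"
  shows "ev \<xi> (D v (p ^ n)) = of_nat n * ev \<xi> p ^ (n - 1) * ev \<xi> (D v p)"
  using ev_I[OF \<xi> D_power[OF assms, of v n]]
  by (simp add: ev_simps)

lemma D_sum: "D v (\<Sum>j\<in>A. p j) = (\<Sum>j\<in>A. D v (p j))"
  by (induction A rule: infinite_finite_induct) (auto simp: D_add, auto simp: D_def S.zero)

text \<open>Replacing \<open>x\<close> by its minimal polynomial over \<open>k\<close>, we may assume that \<open>x\<close> vanishes at \<open>\<xi>\<close>.\<close>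

lemma exists_vanishing_with_derivative:
  assumes x: "x \<in> polys V" "ev \<xi> (D v x) \<noteq> 0"
  obtains y where "y \<in> polys V" "ev \<xi> y = 0" "ev \<xi> (D v y) \<noteq> 0"
proof -
  define P where "P n c \<longleftrightarrow> c n \<noteq> 0 \<and> (\<Sum>j\<le>n. \<iota> (c j) * ev \<xi> x ^ j) = 0" for n and c :: "nat \<Rightarrow> 'k"
  obtain d where d: "\<exists>l\<le>r. d l \<noteq> 0" "(\<Sum>l\<le>r. Const (d l) * x ^ l) \<in> I" using algebraic[OF x(1)] .
  have "\<exists>n c. P n c"
  proof -
    define n where "n = Max {l. l \<le> r \<and> d l \<noteq> 0}"
    have "finite {l. l \<le> r \<and> d l \<noteq> 0}" "{l. l \<le> r \<and> d l \<noteq> 0} \<noteq> {}" using d(1) by auto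
    hence n: "n \<le> r" "d n \<noteq> 0" "\<And>l. l \<le> r \<Longrightarrow> d l \<noteq> 0 \<Longrightarrow> l \<le> n"
      using Max_in[of "{l. l \<le> r \<and> d l \<noteq> 0}"] Max_ge[of "{l. l \<le> r \<and> d l \<noteq> 0}"] unfolding n_def by auto
    have "(\<Sum>j\<le>n. \<iota> (d j) * ev \<xi> x ^ j) = (\<Sum>j\<le>r. \<iota> (d j) * ev \<xi> x ^ j)"
      using n by (intro sum.mono_neutral_left) (auto simp: \<iota>_eq_0_iff)
    also have "\<dots> = ev \<xi> (\<Sum>l\<le>r. Const (d l) * x ^ l)"
      by (simp add: ev_simps)
    also have "\<dots> = 0" by (rule ev_I[OF \<xi> d(2)])
    finally have "P n d" using n by (simp add: P_def)
    thus ?thesis by blast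
  qed
  define n where "n = (LEAST n. \<exists>c. P n c)"
  have "\<exists>c. P n c" unfolding n_def using \<open>\<exists>n c. P n c\<close> by (rule LeastI_ex)
  then obtain c where c: "P n c" by blast
  have min: "\<not> P m c'" if "m < n" for m c' using not_less_Least[of m "\<lambda>n. \<exists>c. P n c"] that unfolding n_def by blast
  have "n \<noteq> 0" using c by (auto simp: P_def \<iota>_eq_0_iff intro!: Nat.gr0I)
  then obtain n' where n': "n = Suc n'" by (cases n) auto
  define y where "y = (\<Sum>j\<le>n. Const (c j) * x ^ j)"
  \<comment> \<open>The derivative of the minimal relation. Its leading coefficient is nonzero in
    characteristic zero, so by minimality of n it does not vanish at the value of \<open>x\<close>;
    this value is the factor between the derivatives of \<open>y\<close> and \<open>x\<close> at
    \<open>\<xi>\<close>.\<close>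
  define c' where "c' j = of_nat (Suc j) * c (Suc j)" for j
  have "c' n' \<noteq> 0" using c by (simp add: c'_def P_def n' del: of_nat_Suc)
  with min[of n' c'] have ne: "(\<Sum>j\<le>n'. \<iota> (c' j) * ev \<xi> x ^ j) \<noteq> 0" by (auto simp: P_def n')
  have "ev \<xi> (D v y) = (\<Sum>j\<le>n. \<iota> (c j) * (of_nat j * ev \<xi> x ^ (j - 1) * ev \<xi> (D v x)))"
    by (simp add: y_def D_sum D_Const_mult ev_simps ev_D_power[OF x(1)])
  also have "\<dots> = (\<Sum>j\<le>n'. \<iota> (c' j) * ev \<xi> x ^ j) * ev \<xi> (D v x)"
    by (simp add: n' sum.atMost_Suc_shift c'_def \<iota>.mult \<iota>.of_nat sum_distrib_right sum_distrib_left mult_ac del: of_nat_Suc sum.atMost_Suc)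
  also have "\<dots> \<noteq> 0" using ne x(2) by simp
  finally have "ev \<xi> (D v y) \<noteq> 0" .
  moreover have "ev \<xi> y = 0"
    using c by (simp add: y_def P_def ev_simps)
  moreover have "y \<in> polys V" unfolding y_def using x(1) by (intro polys_sum polys_mult polys_power) auto
  ultimately show ?thesis using that by blast
qed

text \<open>
  If \<open>D y\<close> were nonzero at \<open>\<xi>\<close> while \<open>y\<close> vanishes there, differentiating \<open>u y\<^sup>\<rho> \<in> I\<close> would lower the
  exponent \<open>\<rho>\<close>, since the characteristic is zero.
\<close>

lemma ev_D:
  assumes v: "v \<in> V" and x: "x \<in> polys V"
  shows "ev \<xi> (D v x) = 0"
proof (rule ccontr)
  assume "ev \<xi> (D v x) \<noteq> 0"
  then obtain y where y: "y \<in> polys V" "ev \<xi> y = 0" "ev \<xi> (D v y) \<noteq> 0"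
    using exists_vanishing_with_derivative[OF x] by blast
  define P where "P \<rho> \<longleftrightarrow> (\<exists>u\<in>polys V. ev \<xi> u \<noteq> 0 \<and> u * y ^ \<rho> \<in> I)" for \<rho>
  obtain d where d: "\<exists>l\<le>r. d l \<noteq> 0" "(\<Sum>l\<le>r. Const (d l) * y ^ l) \<in> I" using algebraic[OF y(1)] .
  have "\<exists>\<rho>. P \<rho>"
  proof -
    \<comment> \<open>Splitting the lowest power of \<open>y\<close> off its relation leaves a
      cofactor whose value at \<open>\<xi>\<close>, where \<open>y\<close> vanishes, is the nonzero
      lowest coefficient.\<close>
    define l0 where "l0 = (LEAST l. d l \<noteq> 0)"
    from d(1) obtain l1 where l1: "l1 \<le> r" "d l1 \<noteq> 0" by blast
    have l0: "d l0 \<noteq> 0" unfolding l0_def using l1(2) by (rule LeastI)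
    have l0_min: "d l = 0" if "l < l0" for l using not_less_Least[of l "\<lambda>l. d l \<noteq> 0"] that unfolding l0_def by blast
    have "l0 \<le> l1" unfolding l0_def using l1(2) by (rule Least_le)
    hence "l0 \<le> r" using l1(1) by simp
    define u where "u = (\<Sum>l\<le>r - l0. Const (d (l0 + l)) * y ^ l)"
    have "u * y ^ l0 = (\<Sum>l\<le>r - l0. Const (d (l0 + l)) * y ^ (l0 + l))"
      by (simp add: u_def sum_distrib_right sum_distrib_left power_add mult_ac)
    also have "\<dots> = (\<Sum>l\<in>{l0..r}. Const (d l) * y ^ l)"
      using \<open>l0 \<le> r\<close> by (intro sum.reindex_bij_witness[of _ "\<lambda>l. l - l0" "\<lambda>l. l0 + l"]) auto
    also have "\<dots> = (\<Sum>l\<le>r. Const (d l) * y ^ l)"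
      by (intro sum.mono_neutral_left) (auto simp: l0_min)
    finally have "u * y ^ l0 \<in> I" using d(2) by simp
    moreover have "ev \<xi> u = \<iota> (d l0)"
    proof -
      have "ev \<xi> u = (\<Sum>l\<le>r - l0. \<iota> (d (l0 + l)) * 0 ^ l)"
        by (simp add: u_def ev_simps y(2))
      also have "\<dots> = (\<Sum>l\<in>{0}. \<iota> (d (l0 + l)) * 0 ^ l)"
        by (intro sum.mono_neutral_right) auto
      finally show ?thesis by simp
    qed
    moreover have "u \<in> polys V" unfolding u_def using y(1) by (intro polys_sum polys_mult polys_power) auto
    ultimately show ?thesis unfolding P_def using l0
      by (intro exI[of _ l0] bexI[of _ u]) (auto simp: \<iota>_eq_0_iff)
  qed
  define \<rho> where "\<rho> = (LEAST \<rho>. P \<rho>)"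
  have "P \<rho>" unfolding \<rho>_def using \<open>\<exists>\<rho>. P \<rho>\<close> by (rule LeastI_ex)
  have min: "\<not> P \<rho>'" if "\<rho>' < \<rho>" for \<rho>' using that not_less_Least[of \<rho>' P] unfolding \<rho>_def by blast
  from \<open>P \<rho>\<close> obtain u where u: "u \<in> polys V" "ev \<xi> u \<noteq> 0" "u * y ^ \<rho> \<in> I" by (auto simp: P_def)
  have "\<rho> \<noteq> 0" using u ev_I[OF \<xi>, of u] by (intro notI) auto
  then obtain \<rho>' where \<rho>': "\<rho> = Suc \<rho>'" by (cases \<rho>) auto
  have yp: "y ^ n \<in> polys V" for n using y(1) by (rule polys_power)
  define Y where "Y = D v (y ^ \<rho>)"
  define Z where "Z = of_nat \<rho> * y ^ \<rho>' * D v y"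
  have 1: "D v (u * y ^ \<rho>) \<in> I" unfolding D_def by (rule S_partial[OF u(3) v])
  have 2: "D v (u * y ^ \<rho>) - (D v u * y ^ \<rho> + u * Y) \<in> I"
    unfolding Y_def by (rule D_mult[OF u(1) yp])
  have 3: "Y - Z \<in> I" using D_power[OF y(1), of v \<rho>] by (simp add: Y_def Z_def \<rho>' del: power_Suc of_nat_Suc)
  \<comment> \<open>The extra factor \<open>u\<close> turns the unwanted term
    \<open>D v u * y ^ \<rho>\<close> into a multiple of \<open>u * y ^ \<rho>\<close>, which is in
    \<open>I\<close>. What is left is the derivative term, with the exponent of \<open>y\<close>
    lowered by one.\<close>
  have "(D v (u * y ^ \<rho>) - (D v (u * y ^ \<rho>) - (D v u * y ^ \<rho> + u * Y))) * u
     - (Y - Z) * (u * u) - (u * y ^ \<rho>) * D v u \<in> I"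
    using u(1) by (intro I_diff[OF I_diff] I_mult[OF u(3)] I_mult[OF 3] I_mult[OF I_diff[OF 1 2]] polys_mult D_polys)
  also have "(D v (u * y ^ \<rho>) - (D v (u * y ^ \<rho>) - (D v u * y ^ \<rho> + u * Y))) * u
     - (Y - Z) * (u * u) - (u * y ^ \<rho>) * D v u = Z * (u * u)"
    by (simp add: algebra_simps)
  also have "Z * (u * u) = of_nat \<rho> * (u * u * D v y * y ^ \<rho>')" by (simp add: Z_def mult_ac)
  finally have "Const (1 / of_nat \<rho>) * (of_nat \<rho> * (u * u * D v y * y ^ \<rho>')) \<in> I" by (rule I_Const)
  moreover have "Const (1 / of_nat \<rho>) * (of_nat \<rho> :: (nat, 'k) mpoly) = 1"
    using \<open>\<rho> \<noteq> 0\<close> by (simp add: ring_map.of_nat[OF ring_map_Const, symmetric] Const_mult[symmetric])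
  ultimately have "u * u * D v y * y ^ \<rho>' \<in> I" by (simp add: mult.assoc[symmetric])
  moreover have "ev \<xi> (u * u * D v y) \<noteq> 0" using u(2) y(3) by (simp add: ev_simps)
  moreover have "u * u * D v y \<in> polys V" using u(1) y(1) by (intro polys_mult D_polys)
  ultimately have "P \<rho>'" unfolding P_def by blast
  thus False using min[of \<rho>'] \<rho>' by simp
qed

text \<open>The element \<open>S (Var u) - Var u\<close> of \<open>I\<close> is tested: by
  \<open>ev_D\<close> the derivatives of \<open>S (Var u)\<close> vanish at \<open>\<xi>\<close>,
  and only - \<open>\<eta> u\<close> remains.\<close>

lemma tangent_zero:
  assumes "\<And>p. p \<in> I \<Longrightarrow> (\<Sum>v\<in>V. \<eta> v * ev \<xi> (partial v p)) = 0" "u \<in> V"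
  shows "\<eta> u = 0"
proof -
  have Vu: "Var u \<in> polys V" using assms(2) by (rule polys_Var)
  have "(\<Sum>v\<in>V. \<eta> v * ev \<xi> (partial v (S (Var u) - Var u))) = 0"
    by (rule assms(1)[OF S_diff[OF Vu]])
  also have "(\<Sum>v\<in>V. \<eta> v * ev \<xi> (partial v (S (Var u) - Var u))) = (\<Sum>v\<in>V. if v = u then - \<eta> u else 0)"
  proof (intro sum.cong refl)
    fix v assume "v \<in> V"
    from ev_D[OF this Vu] have "ev \<xi> (partial v (S (Var u))) = 0" by (simp add: D_def)
    thus "\<eta> v * ev \<xi> (partial v (S (Var u) - Var u)) = (if v = u then - \<eta> u else 0)"
      by (simp add: partial_diff partial_Var ev_simps)
  qed
  finally show ?thesis using assms(2) finV by simp
qed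

end

end

context finite_smooth_algebra
begin

subsection \<open>Functionals are combinations of evaluations at points\<close>

text \<open>The dual of k[V] / I with values extended to \<open>l\<close>. Values outside
  \<open>polys V\<close> are arbitrary, so the identities below are asserted on
  \<open>polys V\<close> only.\<close>

definition functionals :: "((nat, 'k) mpoly \<Rightarrow> 'l) set" where
  "functionals = {\<psi>. (\<forall>p\<in>polys V. \<forall>q\<in>polys V. \<psi> (p + q) = \<psi> p + \<psi> q) \<and>
     (\<forall>p\<in>polys V. \<forall>c. \<psi> (Const c * p) = \<iota> c * \<psi> p) \<and> (\<forall>p\<in>I. \<psi> p = 0)}"

lemma functionals_add: "\<psi> \<in> functionals \<Longrightarrow> p \<in> polys V \<Longrightarrow> q \<in> polys V \<Longrightarrow> \<psi> (p + q) = \<psi> p + \<psi> q"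
  and functionals_Const: "\<psi> \<in> functionals \<Longrightarrow> p \<in> polys V \<Longrightarrow> \<psi> (Const c * p) = \<iota> c * \<psi> p"
  and functionals_I: "\<psi> \<in> functionals \<Longrightarrow> p \<in> I \<Longrightarrow> \<psi> p = 0"
  by (simp_all add: functionals_def)

lemma functionalsI:
  assumes "\<And>p q. p \<in> polys V \<Longrightarrow> q \<in> polys V \<Longrightarrow> \<psi> (p + q) = \<psi> p + \<psi> q"
    and "\<And>p c. p \<in> polys V \<Longrightarrow> \<psi> (Const c * p) = \<iota> c * \<psi> p" and "\<And>p. p \<in> I \<Longrightarrow> \<psi> p = 0"
  shows "\<psi> \<in> functionals"
  using assms by (simp add: functionals_def)

definition comb :: "(nat \<Rightarrow> 'l) set \<Rightarrow> ((nat, 'k) mpoly \<Rightarrow> 'l) \<Rightarrow> bool" where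
  "comb T \<psi> \<longleftrightarrow> (\<exists>l. \<forall>p\<in>polys V. \<psi> p = (\<Sum>\<xi>\<in>T. l \<xi> * ev \<xi> p))"

definition ev_span :: "((nat, 'k) mpoly \<Rightarrow> 'l) set" where
  "ev_span = {\<psi>. \<exists>T. finite T \<and> T \<subseteq> zeros \<and> comb T \<psi>}"

lemma comb_mono: "comb T \<psi> \<Longrightarrow> T \<subseteq> T' \<Longrightarrow> finite T' \<Longrightarrow> comb T' \<psi>"
proof -
  assume "comb T \<psi>" "T \<subseteq> T'" "finite T'"
  then obtain l where l: "\<forall>p\<in>polys V. \<psi> p = (\<Sum>\<xi>\<in>T. l \<xi> * ev \<xi> p)" by (auto simp: comb_def)
  have "(\<Sum>\<xi>\<in>T. l \<xi> * ev \<xi> p) = (\<Sum>\<xi>\<in>T'. (if \<xi> \<in> T then l \<xi> else 0) * ev \<xi> p)" for p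
    using \<open>T \<subseteq> T'\<close> \<open>finite T'\<close> by (intro sum.mono_neutral_cong_left) auto
  thus ?thesis unfolding comb_def using l by (intro exI[of _ "\<lambda>\<xi>. if \<xi> \<in> T then l \<xi> else 0"]) auto
qed

lemma comb_lincomb:
  assumes "comb T \<psi>" "comb T \<psi>'" "\<And>p. p \<in> polys V \<Longrightarrow> \<psi>'' p = a * \<psi> p + a' * \<psi>' p"
  shows "comb T \<psi>''"
proof -
  from assms obtain l l' where "\<forall>p\<in>polys V. \<psi> p = (\<Sum>\<xi>\<in>T. l \<xi> * ev \<xi> p)" "\<forall>p\<in>polys V. \<psi>' p = (\<Sum>\<xi>\<in>T. l' \<xi> * ev \<xi> p)"
    by (auto simp: comb_def)
  thus ?thesis unfolding comb_def using assms(3)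
    by (intro exI[of _ "\<lambda>\<xi>. a * l \<xi> + a' * l' \<xi>"])
      (simp add: sum_distrib_left sum.distrib distrib_right mult.assoc)
qed

lemma comb_mult:
  assumes "comb T \<psi>" "x \<in> polys V" "\<And>p. p \<in> polys V \<Longrightarrow> \<psi>' p = \<psi> (x * p)"
  shows "comb T \<psi>'"
proof -
  from assms obtain l where "\<forall>p\<in>polys V. \<psi> p = (\<Sum>\<xi>\<in>T. l \<xi> * ev \<xi> p)" by (auto simp: comb_def)
  thus ?thesis unfolding comb_def using assms(2,3)
    by (intro exI[of _ "\<lambda>\<xi>. l \<xi> * ev \<xi> x"]) (simp add: polys_mult ev_simps mult.assoc)
qed

lemma ev_span_lincomb:
  assumes "\<psi> \<in> ev_span" "\<psi>' \<in> ev_span" "\<And>p. p \<in> polys V \<Longrightarrow> \<psi>'' p = a * \<psi> p + a' * \<psi>' p"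
  shows "\<psi>'' \<in> ev_span"
proof -
  from assms obtain T T' where T: "finite T" "T \<subseteq> zeros" "comb T \<psi>" "finite T'" "T' \<subseteq> zeros" "comb T' \<psi>'"
    by (auto simp: ev_span_def)
  have "comb (T \<union> T') \<psi>''"
    using T by (intro comb_lincomb[OF comb_mono[of T \<psi>] comb_mono[of T' \<psi>'] assms(3)]) auto
  thus ?thesis using T by (auto simp: ev_span_def intro!: exI[of _ "T \<union> T'"])
qed

lemma ev_span_scale:
  assumes "\<psi> \<in> ev_span" "\<And>p. p \<in> polys V \<Longrightarrow> \<psi>' p = a * \<psi> p"
  shows "\<psi>' \<in> ev_span"
  by (rule ev_span_lincomb[OF assms(1) assms(1), of \<psi>' a 0]) (simp add: assms(2))

lemma ev_span_mult:
  assumes "\<psi> \<in> ev_span" "x \<in> polys V" "\<And>p. p \<in> polys V \<Longrightarrow> \<psi>' p = \<psi> (x * p)"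
  shows "\<psi>' \<in> ev_span"
proof -
  obtain T where T: "finite T" "T \<subseteq> zeros" "comb T \<psi>" using assms(1) by (auto simp: ev_span_def)
  have "comb T \<psi>'" by (rule comb_mult[OF T(3) assms(2)]) (rule assms(3))
  thus ?thesis using T by (auto simp: ev_span_def)
qed

lemma ev_span_zero: "(\<And>p. p \<in> polys V \<Longrightarrow> \<psi> p = 0) \<Longrightarrow> \<psi> \<in> ev_span"
  unfolding ev_span_def comb_def by (intro CollectI exI[of _ "{}"]) auto

definition pact :: "'l poly \<Rightarrow> (nat, 'k) mpoly \<Rightarrow> ((nat, 'k) mpoly \<Rightarrow> 'l) \<Rightarrow> (nat, 'k) mpoly \<Rightarrow> 'l" where
  "pact q x \<psi> p = (\<Sum>l\<le>Polynomial.degree q. Polynomial.coeff q l * \<psi> (x ^ l * p))"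

lemma pact_bound:
  assumes "Polynomial.degree q \<le> N"
  shows "pact q x \<psi> p = (\<Sum>l\<le>N. Polynomial.coeff q l * \<psi> (x ^ l * p))"
  unfolding pact_def using assms
  by (intro sum.mono_neutral_left) (auto simp: Polynomial.coeff_eq_0)

lemma pact_linear_factor:
  "pact ([:- \<zeta>, 1:] * q) x \<psi> p = pact q x \<psi> (x * p) - \<zeta> * pact q x \<psi> p"
proof -
  let ?N = "Polynomial.degree q"
  have eq: "[:- \<zeta>, 1:] * q = pCons 0 q - Polynomial.smult \<zeta> q" by simp
  have "Polynomial.degree ([:- \<zeta>, 1:] * q) \<le> Suc ?N"
    using Polynomial.degree_mult_le[of "[:- \<zeta>, 1:]" q] by simp
  hence "pact ([:- \<zeta>, 1:] * q) x \<psi> p = (\<Sum>l\<le>Suc ?N. Polynomial.coeff (pCons 0 q - Polynomial.smult \<zeta> q) l * \<psi> (x ^ l * p))"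
    unfolding eq by (rule pact_bound)
  also have "\<dots> = (\<Sum>l\<le>Suc ?N. Polynomial.coeff (pCons 0 q) l * \<psi> (x ^ l * p)) - \<zeta> * (\<Sum>l\<le>Suc ?N. Polynomial.coeff q l * \<psi> (x ^ l * p))"
    by (simp only: Polynomial.coeff_diff Polynomial.coeff_smult left_diff_distrib sum_subtractf sum_distrib_left mult.assoc)
  also have "(\<Sum>l\<le>Suc ?N. Polynomial.coeff q l * \<psi> (x ^ l * p)) = pact q x \<psi> p"
    by (rule pact_bound[symmetric]) simp
  also have "(\<Sum>l\<le>Suc ?N. Polynomial.coeff (pCons 0 q) l * \<psi> (x ^ l * p)) = pact q x \<psi> (x * p)"
    unfolding sum.atMost_Suc_shift pact_def by (simp add: mult_ac)
  finally show ?thesis .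
qed

lemma pact_functional:
  assumes "\<psi> \<in> functionals" "x \<in> polys V"
  shows "pact q x \<psi> \<in> functionals"
proof -
  have xl: "x ^ l \<in> polys V" for l using assms(2) by (rule polys_power)
  have 1: "\<psi> (x ^ l * p + x ^ l * q) = \<psi> (x ^ l * p) + \<psi> (x ^ l * q)" if "p \<in> polys V" "q \<in> polys V" for l p q
    using that polys_mult[OF xl] by (intro functionals_add[OF assms(1)])
  have 2: "\<psi> (Const c * (x ^ l * p)) = \<iota> c * \<psi> (x ^ l * p)" if "p \<in> polys V" for l p c
    using that polys_mult[OF xl] by (intro functionals_Const[OF assms(1)])
  have 3: "\<psi> (x ^ l * p) = 0" if "p \<in> I" for l p
    using assms(1) I_mult[OF that xl[of l]] by (simp add: functionals_def mult.commute)
  show ?thesis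
    by (rule functionalsI) (simp_all only: pact_def 1 2 3 ring_distribs sum.distrib sum_distrib_left
        mult.left_commute mult_zero_right sum.neutral_const)
qed

lemma pact_ev_span:
  assumes "\<psi> \<in> ev_span" "x \<in> polys V"
  shows "pact q x \<psi> \<in> ev_span"
proof -
  have "(\<lambda>p. \<Sum>l\<le>n. Polynomial.coeff q l * \<psi> (x ^ l * p)) \<in> ev_span" for n
  proof (induction n)
    case 0
    show ?case by (rule ev_span_scale[OF assms(1), of _ "Polynomial.coeff q 0"]) simp
  next
    case (Suc n)
    have "(\<lambda>p. \<psi> (x ^ Suc n * p)) \<in> ev_span"
      by (rule ev_span_mult[OF assms(1) polys_power[OF assms(2), of "Suc n"]]) simp
    from ev_span_lincomb[OF Suc this, of _ 1 "Polynomial.coeff q (Suc n)"] show ?case by simp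
  qed
  thus ?thesis by (simp add: pact_def[abs_def])
qed

text \<open>Take a nonzero \<open>q\<close> of least degree with q(x) \<psi> in the span and split
  off a root \<zeta>. By minimality the cofactor takes \<psi> to a functional outside the span,
  which x - \<zeta> sends into it: an eigenvector modulo the span.\<close>

lemma eigen_step:
  assumes \<psi>: "\<psi> \<in> functionals" "\<psi> \<notin> ev_span" and v: "v \<in> V"
  obtains q \<zeta> where "pact q (Var v) \<psi> \<notin> ev_span"
    "(\<lambda>p. pact q (Var v) \<psi> (Var v * p) - \<zeta> * pact q (Var v) \<psi> p) \<in> ev_span"
proof -
  let ?x = "Var v :: (nat, 'k) mpoly"
  have x: "?x \<in> polys V" using v by (rule polys_Var)
  define P where "P n \<longleftrightarrow> (\<exists>q. q \<noteq> 0 \<and> Polynomial.degree q = n \<and> pact q ?x \<psi> \<in> ev_span)" for n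
  obtain d where d: "\<exists>l\<le>r. d l \<noteq> 0" "(\<Sum>l\<le>r. Const (d l) * ?x ^ l) \<in> I" using algebraic[OF x] .
  have "\<exists>n. P n"
  proof -
    define q where "q = (\<Sum>l\<le>r. Polynomial.monom (\<iota> (d l)) l)"
    have cq: "Polynomial.coeff q l = (if l \<le> r then \<iota> (d l) else 0)" for l
      by (simp add: q_def Polynomial.coeff_sum)
    have "q \<noteq> 0" using d(1) cq \<iota>_eq_0_iff by (metis Polynomial.coeff_0)
    moreover have "Polynomial.degree q \<le> r" by (rule Polynomial.degree_le) (simp add: cq)
    moreover have "pact q ?x \<psi> p = 0" if p: "p \<in> polys V" for p
    proof -
      have "pact q ?x \<psi> p = (\<Sum>l\<le>r. \<iota> (d l) * \<psi> (?x ^ l * p))"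
        using pact_bound[OF \<open>Polynomial.degree q \<le> r\<close>] by (simp add: cq)
      also have "\<dots> = \<psi> (\<Sum>l\<le>n. Const (d l) * (?x ^ l * p))" if "n = r" for n
        unfolding that[symmetric]
      proof (induction n)
        case 0
        show ?case using \<psi>(1) p by (simp add: functionals_def)
      next
        case (Suc n)
        have "(\<Sum>l\<le>n. Const (d l) * (?x ^ l * p)) \<in> polys V" "?x ^ Suc n * p \<in> polys V"
          "Const (d (Suc n)) * (?x ^ Suc n * p) \<in> polys V"
          using x p by (auto intro!: polys_sum polys_mult polys_power simp del: power_Suc)
        thus ?case using Suc \<psi>(1) by (simp add: functionals_def del: power_Suc)
      qed
      also have "(\<Sum>l\<le>r. Const (d l) * (?x ^ l * p)) = (\<Sum>l\<le>r. Const (d l) * ?x ^ l) * p"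
        by (simp add: sum_distrib_right mult.assoc)
      also have "\<psi> \<dots> = 0" using \<psi>(1) I_mult[OF d(2) p] by (simp add: functionals_def)
      finally show ?thesis by simp
    qed
    ultimately show ?thesis using ev_span_zero[of "pact q ?x \<psi>"] by (auto simp: P_def)
  qed
  define n where "n = (LEAST n. P n)"
  have "P n" unfolding n_def using \<open>\<exists>n. P n\<close> by (rule LeastI_ex)
  then obtain q where q: "q \<noteq> 0" "Polynomial.degree q = n" "pact q ?x \<psi> \<in> ev_span" by (auto simp: P_def)
  have min: "\<not> P m" if "m < n" for m using that not_less_Least[of m P] unfolding n_def by blast
  have "n \<noteq> 0"
  proof
    assume "n = 0"
    then obtain c where c: "q = [:c:]" using q(2) Polynomial.degree_eq_zeroE by blast
    hence "c \<noteq> 0" using q(1) by simp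
    have "\<psi> \<in> ev_span"
      by (rule ev_span_scale[OF q(3), of _ "1 / c"]) (simp add: pact_def c \<open>c \<noteq> 0\<close>)
    thus False using \<psi>(2) by blast
  qed
  then obtain \<zeta> where "poly q \<zeta> = 0" using alg_closed_imp_poly_has_root[of q] q(2) by auto
  then obtain q1 where q1: "q = [:- \<zeta>, 1:] * q1" using Polynomial.poly_eq_0_iff_dvd by (metis dvdE)
  have "q1 \<noteq> 0" using q(1) q1 by auto
  hence "Polynomial.degree q = 1 + Polynomial.degree q1"
    unfolding q1 by (subst Polynomial.degree_mult_eq) auto
  hence "\<not> P (Polynomial.degree q1)" using q(2) by (intro min) simp
  hence "pact q1 ?x \<psi> \<notin> ev_span" using \<open>q1 \<noteq> 0\<close> by (auto simp: P_def)
  moreover have "(\<lambda>p. pact q1 ?x \<psi> (?x * p) - \<zeta> * pact q1 ?x \<psi> p) \<in> ev_span"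
    using q(3) unfolding q1 pact_linear_factor[abs_def] .
  ultimately show ?thesis by (rule that)
qed

text \<open>One variable is treated at a time. The operators commute and preserve
  \<open>ev_span\<close>, so a polynomial in the new variable keeps the eigenvalue relations already
  reached.\<close>

lemma joint_eigenvector:
  assumes "\<psi>0 \<in> functionals" "\<psi>0 \<notin> ev_span"
  obtains \<psi> \<xi> where "\<psi> \<in> functionals" "\<psi> \<notin> ev_span" "\<And>v. v \<notin> V \<Longrightarrow> \<xi> v = 0"
    "\<And>v. v \<in> V \<Longrightarrow> (\<lambda>p. \<psi> (Var v * p) - \<xi> v * \<psi> p) \<in> ev_span"
proof -
  have "\<exists>\<psi>\<in>functionals - ev_span. \<exists>\<xi>. \<forall>v\<in>A. (\<lambda>p. \<psi> (Var v * p) - \<xi> v * \<psi> p) \<in> ev_span"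
    if "finite A" "A \<subseteq> V" for A
    using that
  proof (induction A rule: finite_induct)
    case empty
    thus ?case using assms by auto
  next
    case (insert u A)
    then obtain \<psi> \<xi> where \<psi>: "\<psi> \<in> functionals" "\<psi> \<notin> ev_span"
      "\<forall>v\<in>A. (\<lambda>p. \<psi> (Var v * p) - \<xi> v * \<psi> p) \<in> ev_span" by auto
    have u: "u \<in> V" "Var u \<in> polys V" using insert by (auto intro: polys_Var)
    obtain q \<zeta> where q: "pact q (Var u) \<psi> \<notin> ev_span"
      "(\<lambda>p. pact q (Var u) \<psi> (Var u * p) - \<zeta> * pact q (Var u) \<psi> p) \<in> ev_span"
      using eigen_step[OF \<psi>(1,2) u(1)] .
    define \<psi>' where "\<psi>' = pact q (Var u) \<psi>"
    define \<xi>' where "\<xi>' = \<xi>(u := \<zeta>)"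
    have "(\<lambda>p. \<psi>' (Var v * p) - \<xi>' v * \<psi>' p) \<in> ev_span" if v: "v \<in> insert u A" for v
    proof (cases "v = u")
      case True
      thus ?thesis using q(2) by (simp add: \<psi>'_def \<xi>'_def)
    next
      case False
      hence "(\<lambda>p. \<psi> (Var v * p) - \<xi> v * \<psi> p) \<in> ev_span" using \<psi>(3) v by auto
      from pact_ev_span[OF this u(2), of q]
      have "(\<lambda>p. pact q (Var u) (\<lambda>p. \<psi> (Var v * p) - \<xi> v * \<psi> p) p) \<in> ev_span" .
      moreover have "pact q (Var u) (\<lambda>p. \<psi> (Var v * p) - \<xi> v * \<psi> p) p = \<psi>' (Var v * p) - \<xi>' v * \<psi>' p" for p
        using False by (simp add: \<psi>'_def \<xi>'_def pact_def right_diff_distrib sum_subtractf sum_distrib_left mult_ac)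
      ultimately show ?thesis by simp
    qed
    moreover have "\<psi>' \<in> functionals" unfolding \<psi>'_def by (rule pact_functional[OF \<psi>(1) u(2)])
    ultimately show ?case using q(1) unfolding \<psi>'_def[symmetric] by blast
  qed
  from this[OF finV] obtain \<psi> \<xi> where *: "\<psi> \<in> functionals" "\<psi> \<notin> ev_span"
    "\<forall>v\<in>V. (\<lambda>p. \<psi> (Var v * p) - \<xi> v * \<psi> p) \<in> ev_span" by auto
  show ?thesis
    by (rule that[of \<psi> "\<lambda>v. if v \<in> V then \<xi> v else 0"]) (use * in auto)
qed

text \<open>Multiplying by linear factors removes all points but \<open>\<xi>\<close> from the support.\<close>

lemma localize_support:
  assumes "finite R" "R \<subseteq> zeros" "\<xi> \<notin> R" "E \<subseteq> zeros \<inter> {\<xi>}" "\<And>v. v \<notin> V \<Longrightarrow> \<xi> v = 0"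
    and "\<psi> \<in> functionals" "\<psi> \<notin> ev_span" "\<And>v. v \<in> V \<Longrightarrow> comb (R \<union> E) (\<lambda>p. \<psi> (Var v * p) - \<xi> v * \<psi> p)"
  shows "\<exists>\<psi>'\<in>functionals - ev_span. \<forall>v\<in>V. comb E (\<lambda>p. \<psi>' (Var v * p) - \<xi> v * \<psi>' p)"
  using assms(1-3,6-8)
proof (induction R arbitrary: \<psi> rule: finite_induct)
  case empty
  thus ?case by auto
next
  case (insert \<eta> R)
  have finE: "finite E" using assms(4) finite_subset by blast
  have \<eta>: "\<eta> \<in> zeros" "\<eta> \<noteq> \<xi>" "\<eta> \<notin> R \<union> E" using insert assms(4) by auto
  have "\<exists>u\<in>V. \<eta> u \<noteq> \<xi> u"
  proof (rule ccontr)
    assume "\<not> (\<exists>u\<in>V. \<eta> u \<noteq> \<xi> u)"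
    hence "\<eta> = \<xi>" using \<eta>(1) assms(5) by (intro ext) (auto simp: zeros_def)
    thus False using \<eta>(2) by blast
  qed
  then obtain u where u: "u \<in> V" "\<eta> u \<noteq> \<xi> u" by blast
  have Vu: "(Var u :: (nat, 'k) mpoly) \<in> polys V" using u(1) by (rule polys_Var)
  \<comment> \<open>Multiplying by x_u - \<open>\<eta> u\<close> removes \<open>\<eta>\<close> from
    the support. The result stays outside the span, since (\<open>\<eta> u\<close> -
    \<open>\<xi> u\<close>) \<psi> is (x_u - \<open>\<xi> u\<close>) \<psi>, which is in the span,
    minus \<open>\<psi>'\<close>.\<close>
  define \<psi>' where "\<psi>' p = \<psi> (Var u * p) - \<eta> u * \<psi> p" for p
  have "\<psi>' \<in> functionals"
  proof (rule functionalsI)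
    note V = polys_mult[OF Vu]
    show "\<psi>' (p + q) = \<psi>' p + \<psi>' q" if "p \<in> polys V" "q \<in> polys V" for p q
      using that V by (simp add: \<psi>'_def distrib_left functionals_add[OF insert.prems(3)])
    show "\<psi>' (Const c * p) = \<iota> c * \<psi>' p" if "p \<in> polys V" for p c
      using that V functionals_Const[OF insert.prems(3), of "Var u * p" c]
      by (simp add: \<psi>'_def mult.left_commute[of "Var u"] functionals_Const[OF insert.prems(3)] right_diff_distrib)
    show "\<psi>' p = 0" if "p \<in> I" for p
      using I_mult[OF that Vu] that functionals_I[OF insert.prems(3)] by (simp add: \<psi>'_def mult.commute)
  qed
  moreover have "\<psi>' \<notin> ev_span"
  proof
    assume 1: "\<psi>' \<in> ev_span"
    have "finite (insert \<eta> R \<union> E)" "insert \<eta> R \<union> E \<subseteq> zeros" using insert finE assms(4) by auto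
    hence 2: "(\<lambda>p. \<psi> (Var u * p) - \<xi> u * \<psi> p) \<in> ev_span"
      using insert.prems(5)[OF u(1)] unfolding ev_span_def by blast
    have "\<psi> \<in> ev_span"
    proof (rule ev_span_lincomb[OF 2 1])
      fix p
      have "(\<psi> (Var u * p) - \<xi> u * \<psi> p) - \<psi>' p = (\<eta> u - \<xi> u) * \<psi> p" by (simp add: \<psi>'_def algebra_simps)
      moreover have "x = 1 / (\<eta> u - \<xi> u) * y" if "y = (\<eta> u - \<xi> u) * x" for x y
        using u(2) that by simp
      ultimately have h: "\<psi> p = 1 / (\<eta> u - \<xi> u) * ((\<psi> (Var u * p) - \<xi> u * \<psi> p) - \<psi>' p)" by blast
      have alg: "x = K * (A - B) \<Longrightarrow> x = K * A + - K * B" for x K A B :: 'l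
        by (simp add: right_diff_distrib)
      show "\<psi> p = 1 / (\<eta> u - \<xi> u) * (\<psi> (Var u * p) - \<xi> u * \<psi> p) + - (1 / (\<eta> u - \<xi> u)) * \<psi>' p"
        by (rule alg[OF h])
    qed
    thus False using insert.prems(4) by blast
  qed
  moreover have "comb (R \<union> E) (\<lambda>p. \<psi>' (Var v * p) - \<xi> v * \<psi>' p)" if v: "v \<in> V" for v
  proof -
    obtain l where l: "\<forall>p\<in>polys V. \<psi> (Var v * p) - \<xi> v * \<psi> p = (\<Sum>\<theta>\<in>insert \<eta> (R \<union> E). l \<theta> * ev \<theta> p)"
      using insert.prems(5)[OF v] by (auto simp: comb_def)
    have "\<psi>' (Var v * p) - \<xi> v * \<psi>' p = (\<Sum>\<theta>\<in>R \<union> E. l \<theta> * (\<theta> u - \<eta> u) * ev \<theta> p)" if p: "p \<in> polys V" for p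
    proof -
      have "\<psi>' (Var v * p) - \<xi> v * \<psi>' p =
        (\<psi> (Var v * (Var u * p)) - \<xi> v * \<psi> (Var u * p)) - \<eta> u * (\<psi> (Var v * p) - \<xi> v * \<psi> p)"
        by (simp add: \<psi>'_def algebra_simps)
      also have "\<dots> = (\<Sum>\<theta>\<in>insert \<eta> (R \<union> E). l \<theta> * ev \<theta> (Var u * p)) - \<eta> u * (\<Sum>\<theta>\<in>insert \<eta> (R \<union> E). l \<theta> * ev \<theta> p)"
        using l p polys_mult[OF Vu p] by simp
      also have "\<dots> = (\<Sum>\<theta>\<in>insert \<eta> (R \<union> E). l \<theta> * (\<theta> u - \<eta> u) * ev \<theta> p)"
        unfolding sum_distrib_left sum_subtractf[symmetric]
        by (intro sum.cong refl) (simp add: ev_simps algebra_simps)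
      also have "\<dots> = (\<Sum>\<theta>\<in>R \<union> E. l \<theta> * (\<theta> u - \<eta> u) * ev \<theta> p)"
        using \<eta>(3) insert.hyps(1) finE by simp
      finally show ?thesis .
    qed
    thus ?thesis unfolding comb_def by (intro exI[of _ "\<lambda>\<theta>. l \<theta> * (\<theta> u - \<eta> u)"]) auto
  qed
  ultimately show ?case using insert.prems by (intro insert.IH[of \<psi>']) auto
qed

text \<open>A functional outside the span can be replaced by one that every x_v -
  \<open>\<xi> v\<close> maps to a multiple of evaluation at one point \<open>\<xi>\<close>. Such a
  functional is a value plus a tangent vector at \<open>\<xi>\<close>, and tangent vectors
  vanish.\<close>

theorem functionals_ev_span: "functionals \<subseteq> ev_span"
proof (rule ccontr)
  assume "\<not> functionals \<subseteq> ev_span"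
  then obtain \<psi>0 where "\<psi>0 \<in> functionals" "\<psi>0 \<notin> ev_span" by blast
  then obtain \<psi>1 \<xi> where \<psi>1: "\<psi>1 \<in> functionals" "\<psi>1 \<notin> ev_span" "\<And>v. v \<notin> V \<Longrightarrow> \<xi> v = 0"
    "\<And>v. v \<in> V \<Longrightarrow> (\<lambda>p. \<psi>1 (Var v * p) - \<xi> v * \<psi>1 p) \<in> ev_span"
    by (rule joint_eigenvector) blast
  have "\<exists>T. finite T \<and> T \<subseteq> zeros \<and> comb T (\<lambda>p. \<psi>1 (Var v * p) - \<xi> v * \<psi>1 p)" if "v \<in> V" for v
    using \<psi>1(4)[OF that] by (simp add: ev_span_def)
  then obtain Tv where Tv: "\<And>v. v \<in> V \<Longrightarrow> finite (Tv v) \<and> Tv v \<subseteq> zeros \<and> comb (Tv v) (\<lambda>p. \<psi>1 (Var v * p) - \<xi> v * \<psi>1 p)"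
    by metis
  define T where "T = (\<Union>v\<in>V. Tv v)"
  have T: "finite T" "T \<subseteq> zeros" using Tv finV by (auto simp: T_def)
  define E where "E = T \<inter> {\<xi>}"
  have "\<exists>\<psi>\<in>functionals - ev_span. \<forall>v\<in>V. comb E (\<lambda>p. \<psi> (Var v * p) - \<xi> v * \<psi> p)"
  proof (rule localize_support[of "T - {\<xi>}" \<xi>])
    fix v assume v: "v \<in> V"
    have "comb T (\<lambda>p. \<psi>1 (Var v * p) - \<xi> v * \<psi>1 p)"
      by (rule comb_mono[of "Tv v"]) (use Tv v T in \<open>auto simp: T_def\<close>)
    moreover have "T - {\<xi>} \<union> E = T" by (auto simp: E_def)
    ultimately show "comb (T - {\<xi>} \<union> E) (\<lambda>p. \<psi>1 (Var v * p) - \<xi> v * \<psi>1 p)" by simp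
  qed (use T \<psi>1 in \<open>auto simp: E_def\<close>)
  then obtain \<psi> where \<psi>: "\<psi> \<in> functionals" "\<psi> \<notin> ev_span"
    "\<And>v. v \<in> V \<Longrightarrow> comb E (\<lambda>p. \<psi> (Var v * p) - \<xi> v * \<psi> p)" by blast
  have E: "E = {} \<or> E = {\<xi>}" "E \<subseteq> zeros" using T by (auto simp: E_def)
  \<comment> \<open>At most \<open>\<xi>\<close> is left in the support \<open>E\<close>, and
    \<open>E\<close> consists of zeros of \<open>I\<close>; so a nonzero constant certifies that
    \<open>\<xi>\<close> is a point of the algebra.\<close>
  have "\<exists>c. (\<forall>p\<in>polys V. \<psi> (Var v * p) - \<xi> v * \<psi> p = c * ev \<xi> p) \<and> (c \<noteq> 0 \<longrightarrow> \<xi> \<in> zeros)" if v: "v \<in> V" for v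
  proof -
    obtain l where l: "\<forall>p\<in>polys V. \<psi> (Var v * p) - \<xi> v * \<psi> p = (\<Sum>\<theta>\<in>E. l \<theta> * ev \<theta> p)"
      using \<psi>(3)[OF v] by (auto simp: comb_def)
    from E(1) show ?thesis
    proof
      assume "E = {}"
      thus ?thesis using l by (intro exI[of _ 0]) auto
    next
      assume "E = {\<xi>}"
      thus ?thesis using l E(2) by (intro exI[of _ "l \<xi>"]) auto
    qed
  qed
  then obtain c where c: "\<And>v p. v \<in> V \<Longrightarrow> p \<in> polys V \<Longrightarrow> \<psi> (Var v * p) = \<xi> v * \<psi> p + c v * ev \<xi> p"
    "\<And>v. v \<in> V \<Longrightarrow> c v \<noteq> 0 \<Longrightarrow> \<xi> \<in> zeros"
    by (metis diff_eq_eq add.commute)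
  \<comment> \<open>The recurrence under multiplication by a variable is that of a first-order jet
    at \<open>\<xi>\<close> with tangent components \<open>c v\<close>.\<close>
  have mon: "\<psi> (single m 1) = \<psi> 1 * ev \<xi> (single m 1) + (\<Sum>v\<in>V. c v * ev \<xi> (partial v (single m 1)))"
    if "keys m \<subseteq> V" for m
    using that
  proof (induction m rule: mon_induct)
    case zero
    show ?case using partial_Const[of _ "1::'k"] by (simp add: \<iota>.poly_eval_1 \<iota>.poly_eval_0)
  next
    case (add m u)
    hence u: "u \<in> V" and m: "keys m \<subseteq> V" by (auto simp: keys_add_nat)
    let ?x = "single m 1 :: (nat, 'k) mpoly"
    have eq: "single (m + single u 1) 1 = Var u * ?x" by (simp add: Var_def mult_single add.commute)
    have "ev \<xi> (partial v (Var u * ?x)) = (if v = u then ev \<xi> ?x else 0) + \<xi> u * ev \<xi> (partial v ?x)" for v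
      by (simp add: partial_mult partial_Var ev_simps)
    hence "(\<Sum>v\<in>V. c v * ev \<xi> (partial v (Var u * ?x))) =
      (\<Sum>v\<in>V. (if v = u then c u * ev \<xi> ?x else 0) + \<xi> u * (c v * ev \<xi> (partial v ?x)))"
      by (intro sum.cong refl) (simp add: distrib_left mult.left_commute)
    also have "\<dots> = c u * ev \<xi> ?x + \<xi> u * (\<Sum>v\<in>V. c v * ev \<xi> (partial v ?x))"
      using u finV by (simp add: sum.distrib sum_distrib_left)
    finally have "(\<Sum>v\<in>V. c v * ev \<xi> (partial v (Var u * ?x))) = \<dots>" .
    moreover have "\<psi> (Var u * ?x) = \<xi> u * \<psi> ?x + c u * ev \<xi> ?x"
      by (rule c(1)[OF u polys_single[OF m]])
    ultimately show ?case
      unfolding eq using add.IH[OF m] by (simp add: ev_simps algebra_simps)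
  qed
  have \<psi>_eq: "\<psi> p = \<psi> 1 * ev \<xi> p + (\<Sum>v\<in>V. c v * ev \<xi> (partial v p))" if p: "p \<in> polys V" for p
  proof -
    have *: "\<psi> (\<Sum>m\<in>A. Const (a m) * single m 1) = \<psi> 1 * ev \<xi> (\<Sum>m\<in>A. Const (a m) * single m 1) +
        (\<Sum>v\<in>V. c v * ev \<xi> (partial v (\<Sum>m\<in>A. Const (a m) * single m 1)))"
      if "finite A" "\<And>m. m \<in> A \<Longrightarrow> keys m \<subseteq> V" for A and a :: "(nat \<Rightarrow>\<^sub>0 nat) \<Rightarrow> 'k"
      using that
    proof (induction A rule: finite_induct)
      case empty
      have "\<psi> 0 = 0" using \<psi>(1) I_0 by (simp add: functionals_def)
      thus ?case by (simp add: \<iota>.poly_eval_0)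
    next
      case (insert m A)
      let ?s = "\<Sum>m\<in>A. Const (a m) * single m 1"
      have p: "?s \<in> polys V" "(single m 1 :: (nat, 'k) mpoly) \<in> polys V" "Const (a m) * single m 1 \<in> polys V"
        using insert by (auto intro!: polys_sum polys_mult polys_single)
      have "\<psi> (Const (a m) * single m 1 + ?s) = \<iota> (a m) * \<psi> (single m 1) + \<psi> ?s"
        using p by (simp only: functionals_add[OF \<psi>(1)] functionals_Const[OF \<psi>(1)])
      moreover have "keys m \<subseteq> V" using insert by simp
      ultimately show ?case using insert mon[of m]
        by (simp add: ev_simps partial_add partial_Const_mult
            distrib_left sum.distrib sum_distrib_left mult_ac)
    qed
    have "p = (\<Sum>m\<in>keys p. Const (lookup p m) * single m 1)"
      using poly_sum_monomials[of p] by (simp add: Const_def mult_single)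
    moreover have "keys m \<subseteq> V" if "m \<in> keys p" for m using p that by (auto simp: polys_def)
    ultimately show ?thesis using *[of "keys p" "lookup p"] by simp
  qed
  show False
  proof (cases "\<exists>v\<in>V. c v \<noteq> 0")
    case True
    then obtain v where v: "v \<in> V" "c v \<noteq> 0" by blast
    hence \<xi>: "\<xi> \<in> zeros" using c(2) by blast
    have "c v = 0"
    proof (rule tangent_zero[OF \<xi> _ v(1)])
      fix p assume p: "p \<in> I"
      hence "\<psi> p = 0" "ev \<xi> p = 0" using \<psi>(1) ev_I[OF \<xi>] by (auto simp: functionals_def)
      thus "(\<Sum>v\<in>V. c v * ev \<xi> (partial v p)) = 0" using \<psi>_eq[of p] p I_polys by auto
    qed
    thus False using v by simp
  next
    case False
    \<comment> \<open>Without a tangent part \<psi> is a nonzero multiple of the evaluation at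
      \<open>\<xi>\<close>; as \<psi> vanishes on \<open>I\<close>, this places \<open>\<xi>\<close>
      among the zeros.\<close>
    hence eq: "\<psi> p = \<psi> 1 * ev \<xi> p" if "p \<in> polys V" for p using \<psi>_eq[OF that] by simp
    have nz: "\<psi> 1 \<noteq> 0"
    proof
      assume "\<psi> 1 = 0"
      hence "\<psi> p = 0" if "p \<in> polys V" for p using eq[OF that] by simp
      thus False using ev_span_zero \<psi>(2) by blast
    qed
    have "ev \<xi> p = 0" if "p \<in> I" for p
    proof -
      have "p \<in> polys V" using that I_polys by blast
      from eq[OF this] functionals_I[OF \<psi>(1) that] nz show ?thesis by simp
    qed
    hence "\<xi> \<in> zeros" using \<psi>1(3) by (simp add: zeros_def)
    moreover have "comb {\<xi>} \<psi>" unfolding comb_def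
    proof (intro exI ballI)
      fix p :: "(nat, 'k) mpoly" assume "p \<in> polys V"
      from eq[OF this] show "\<psi> p = (\<Sum>\<theta>\<in>{\<xi>}. \<psi> 1 * ev \<theta> p)" by simp
    qed
    ultimately have "\<psi> \<in> ev_span" by (auto simp: ev_span_def intro!: exI[of _ "{\<xi>}"])
    thus False using \<psi>(2) by blast
  qed
qed

lemma ev_coords:
  assumes "\<xi> \<in> zeros" "p \<in> polys V"
  shows "ev \<xi> p = (\<Sum>i<r. \<iota> (w i p) * ev \<xi> (b i))"
  using ev_I[OF assms(1) expand[OF assms(2)]]
  by (simp add: ev_simps)

text \<open>An evaluation at a zero is determined by its r values on the \<open>b i\<close>. More
  than r evaluations are therefore dependent, and a representation with the fewest points could drop
  one of them.\<close>

theorem functional_eq_sum_points: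
  assumes "\<psi> \<in> functionals"
  obtains l \<xi> where "\<And>p. p \<in> polys V \<Longrightarrow> \<psi> p = (\<Sum>j<r. l j * ev (\<xi> j) p)"
proof -
  define P where "P N \<longleftrightarrow> (\<exists>T. finite T \<and> T \<subseteq> zeros \<and> comb T \<psi> \<and> card T = N)" for N
  have ex: "\<exists>N. P N" using functionals_ev_span assms by (auto simp: ev_span_def P_def)
  define N where "N = (LEAST N. P N)"
  have "P N" unfolding N_def using ex by (rule LeastI_ex)
  then obtain T where T: "finite T" "T \<subseteq> zeros" "comb T \<psi>" "card T = N" by (auto simp: P_def)
  have min: "\<not> P M" if "M < N" for M using that not_less_Least[of M P] unfolding N_def by blast
  obtain l where l: "\<And>p. p \<in> polys V \<Longrightarrow> \<psi> p = (\<Sum>\<xi>\<in>T. l \<xi> * ev \<xi> p)" using T(3) by (auto simp: comb_def)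
  have "N \<le> r"
  proof (rule ccontr)
    assume "\<not> N \<le> r"
    then obtain \<mu> where \<mu>: "\<exists>t\<in>T. \<mu> t \<noteq> 0" "\<forall>i<r. (\<Sum>t\<in>T. \<mu> t * ev t (b i)) = 0"
      using more_vectors_dependent[OF T(1), of r "\<lambda>t i. ev t (b i)"] T(4) by auto
    then obtain t0 where t0: "t0 \<in> T" "\<mu> t0 \<noteq> 0" by blast
    have dep: "(\<Sum>t\<in>T. \<mu> t * ev t p) = 0" if p: "p \<in> polys V" for p :: "(nat, 'k) mpoly"
    proof -
      have "(\<Sum>t\<in>T. \<mu> t * ev t p) = (\<Sum>t\<in>T. \<Sum>i<r. \<iota> (w i p) * (\<mu> t * ev t (b i)))"
      proof (intro sum.cong refl)
        fix t assume "t \<in> T"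
        hence "t \<in> zeros" using T(2) by blast
        thus "\<mu> t * ev t p = (\<Sum>i<r. \<iota> (w i p) * (\<mu> t * ev t (b i)))"
          by (subst ev_coords[OF _ p]) (simp_all add: sum_distrib_left mult_ac)
      qed
      also have "\<dots> = (\<Sum>i<r. \<iota> (w i p) * (\<Sum>t\<in>T. \<mu> t * ev t (b i)))"
        by (subst sum.swap) (simp add: sum_distrib_left)
      finally show ?thesis using \<mu>(2) by simp
    qed
    have "comb (T - {t0}) \<psi>" unfolding comb_def
    proof (intro exI ballI)
      fix p :: "(nat, 'k) mpoly" assume p: "p \<in> polys V"
      have "\<psi> p = (\<Sum>t\<in>T. l t * ev t p) - l t0 / \<mu> t0 * (\<Sum>t\<in>T. \<mu> t * ev t p)" using l[OF p] dep[OF p] by simp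
      also have "\<dots> = (\<Sum>t\<in>T. (l t - l t0 / \<mu> t0 * \<mu> t) * ev t p)"
        by (simp add: sum_distrib_left left_diff_distrib sum_subtractf mult.assoc)
      also have "\<dots> = (\<Sum>t\<in>T - {t0}. (l t - l t0 / \<mu> t0 * \<mu> t) * ev t p)"
        using t0 T(1) by (simp add: sum.remove[of T t0])
      finally show "\<psi> p = (\<Sum>t\<in>T - {t0}. (l t - l t0 / \<mu> t0 * \<mu> t) * ev t p)" .
    qed
    moreover have "card (T - {t0}) < N" using T t0 by (metis card_Diff1_less)
    ultimately have "P (card (T - {t0}))" using T by (auto simp: P_def)
    thus False using min \<open>card (T - {t0}) < N\<close> by blast
  qed
  obtain g where g: "bij_betw g {..<N} T" using ex_bij_betw_nat_finite[OF T(1)] T(4) by (auto simp: atLeast0LessThan)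
  show ?thesis
  \<comment> \<open>Padding to exactly r terms: the indices from N on get coefficient 0.\<close>
  proof (rule that[of "\<lambda>j. if j < N then l (g j) else 0" g])
    fix p :: "(nat, 'k) mpoly" assume "p \<in> polys V"
    hence "\<psi> p = (\<Sum>\<xi>\<in>T. l \<xi> * ev \<xi> p)" by (rule l)
    also have "\<dots> = (\<Sum>j<N. l (g j) * ev (g j) p)" by (rule sum.reindex_bij_betw[OF g, symmetric])
    also have "\<dots> = (\<Sum>j<r. (if j < N then l (g j) else 0) * ev (g j) p)"
      using \<open>N \<le> r\<close> by (intro sum.mono_neutral_cong_left) auto
    finally show "\<psi> p = (\<Sum>j<r. (if j < N then l (g j) else 0) * ev (g j) p)" .
  qed
qed

end

section \<open>Free algebras over power series and their generic fibre\<close>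

locale free_power_series_algebra = cring B for B :: "'b ring" (structure) +
  fixes \<phi> :: "'a::field_char_0 fps \<Rightarrow> 'b" and r :: nat and b :: "nat \<Rightarrow> 'b"
  assumes algebra: "is_algebra \<phi> B"
    and b_closed: "b \<in> {..<r} \<rightarrow> carrier B"
    and unique: "x \<in> carrier B \<Longrightarrow> \<exists>!c. c \<in> {..<r} \<rightarrow>\<^sub>E UNIV \<and> x = (\<Oplus>i\<in>{..<r}. \<phi> (c i) \<otimes> b i)"
begin

lemma \<phi>_closed [simp]: "\<phi> a \<in> carrier B"
  using algebra by (rule is_algebra_closed)

lemma \<phi>_hom: "\<phi> \<in> ring_hom ring_of_type_algebra B"
  using algebra by (simp add: is_algebra_def)

lemma \<phi>_add: "\<phi> (x + y) = \<phi> x \<oplus> \<phi> y" and \<phi>_mult: "\<phi> (x * y) = \<phi> x \<otimes> \<phi> y" and \<phi>_1: "\<phi> 1 = \<one>"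
  using ring_hom_add[OF \<phi>_hom, of x y] ring_hom_mult[OF \<phi>_hom, of x y] ring_hom_one[OF \<phi>_hom] by auto

lemma \<phi>_power: "\<phi> (x ^ n) = \<phi> x [^] n"
  by (induction n) (simp_all add: \<phi>_1 \<phi>_mult nat_pow_Suc m_comm)

definition lin :: "(nat \<Rightarrow> 'a fps) \<Rightarrow> 'b" where
  "lin c = (\<Oplus>i\<in>{..<r}. \<phi> (c i) \<otimes> b i)"

lemma b_carrier: "i < r \<Longrightarrow> b i \<in> carrier B"
  using b_closed by auto

lemma lin_closed [simp]: "lin c \<in> carrier B"
  unfolding lin_def using b_closed by (intro finsum_closed) auto

lemma lin_cong: "(\<And>i. i < r \<Longrightarrow> c i = d i) \<Longrightarrow> lin c = lin d"
  unfolding lin_def using b_closed by (intro finsum_cong') auto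

lemma lin_add: "lin c \<oplus> lin d = lin (\<lambda>i. c i + d i)"
proof -
  have "lin (\<lambda>i. c i + d i) = (\<Oplus>i\<in>{..<r}. \<phi> (c i) \<otimes> b i \<oplus> \<phi> (d i) \<otimes> b i)"
    unfolding lin_def using b_closed by (intro finsum_cong') (auto simp: \<phi>_add l_distr b_carrier)
  also have "\<dots> = lin c \<oplus> lin d"
    unfolding lin_def using b_closed by (intro finsum_addf) auto
  finally show ?thesis by simp
qed

lemma lin_smult: "\<phi> a \<otimes> lin c = lin (\<lambda>i. a * c i)"
proof -
  have "\<phi> a \<otimes> lin c = (\<Oplus>i\<in>{..<r}. \<phi> a \<otimes> (\<phi> (c i) \<otimes> b i))"
    unfolding lin_def using b_closed by (intro finsum_rdistr) auto
  also have "\<dots> = lin (\<lambda>i. a * c i)"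
    unfolding lin_def using b_closed by (intro finsum_cong') (auto simp: \<phi>_mult m_assoc b_carrier)
  finally show ?thesis .
qed

section \<open>Coordinates with respect to the free basis\<close>

definition coord :: "'b \<Rightarrow> nat \<Rightarrow> 'a fps" where
  "coord x = (THE c. c \<in> {..<r} \<rightarrow>\<^sub>E UNIV \<and> x = lin c)"

lemma coord_lin: "i < r \<Longrightarrow> coord (lin c) i = c i"
proof -
  assume i: "i < r"
  let ?c = "restrict c {..<r}"
  have eq: "lin c = lin ?c" by (rule lin_cong) (simp add: restrict_def)
  have "coord (lin c) = ?c" unfolding coord_def
    by (rule the1_equality[OF unique[OF lin_closed, folded lin_def]]) (intro conjI eq, auto)
  thus ?thesis using i by simp
qed

lemma lin_coord: "x \<in> carrier B \<Longrightarrow> lin (coord x) = x"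
  using theI'[OF unique[folded lin_def], of x] by (simp add: coord_def)

lemma coord_eqI: "x \<in> carrier B \<Longrightarrow> y \<in> carrier B \<Longrightarrow> (\<And>i. i < r \<Longrightarrow> coord x i = coord y i) \<Longrightarrow> x = y"
  using lin_cong[of "coord x" "coord y"] by (simp add: lin_coord)

lemma coord_add: "x \<in> carrier B \<Longrightarrow> y \<in> carrier B \<Longrightarrow> i < r \<Longrightarrow> coord (x \<oplus> y) i = coord x i + coord y i"
  using lin_add[of "coord x" "coord y"] coord_lin[of i "\<lambda>i. coord x i + coord y i"] by (simp add: lin_coord)

lemma coord_smult: "x \<in> carrier B \<Longrightarrow> i < r \<Longrightarrow> coord (\<phi> a \<otimes> x) i = a * coord x i"
  using lin_smult[of a "coord x"] coord_lin[of i "\<lambda>i. a * coord x i"] by (simp add: lin_coord)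

lemma coord_b: "j < r \<Longrightarrow> i < r \<Longrightarrow> coord (b j) i = (if i = j then 1 else 0)"
proof -
  assume j: "j < r" and i: "i < r"
  have "lin (\<lambda>i. if i = j then 1 else 0) = (\<Oplus>i\<in>{..<r}. if j = i then b i else \<zero>)"
    unfolding lin_def
  proof (rule finsum_cong')
    have z: "\<phi> 0 = \<zero>" using \<phi>_add[of 0 0] by (simp add: add.r_cancel_one')
    show "\<phi> (if i = j then 1 else 0) \<otimes> b i = (if j = i then b i else \<zero>)" if "i \<in> {..<r}" for i
      using that b_carrier by (auto simp: \<phi>_1 z)
  qed (use b_carrier in auto)
  also have "\<dots> = b j" using j b_closed by (intro finsum_singleton) auto
  finally show ?thesis using coord_lin[OF i, of "\<lambda>i. if i = j then 1 else 0"] by simp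
qed

lemma coord_zero: "i < r \<Longrightarrow> coord \<zero> i = 0"
  using coord_add[of \<zero> \<zero> i] by (metis add_cancel_right_left l_zero zero_closed)

subsection \<open>The localization at the uniformizer\<close>

abbreviation s where "s \<equiv> \<phi> fps_X"

text \<open>An opaque name for the uniformizer, as the simplifier turns division by \<open>fls_X\<close> into shifts.\<close>

definition T :: "'a fls" where
  "T = fls_X"

lemma T_nz [simp]: "T \<noteq> 0"
  by (simp add: T_def)

text \<open>The coordinate over K((t)) of the fraction of \<open>x\<close> by the k-th power of the
  uniformizer.\<close>

definition val :: "'b \<Rightarrow> nat \<Rightarrow> nat \<Rightarrow> 'a fls" where
  "val x k i = fps_to_fls (coord x i) / T ^ k"

lemma coord_s_pow: "x \<in> carrier B \<Longrightarrow> i < r \<Longrightarrow> coord (s [^] (k::nat) \<otimes> x) i = fps_X ^ k * coord x i"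
  by (simp flip: \<phi>_power add: coord_smult)

lemma fps_to_fls_X_power: "fps_to_fls (fps_X ^ k * c) = T ^ k * fps_to_fls c" for c :: "'a fps"
  by (induction k) (simp_all add: T_def fls_times_fps_to_fls mult.assoc)

text \<open>Freeness makes the uniformizer a nonzerodivisor; this removes the auxiliary power from
  the definition of \<open>loc_rel\<close>.\<close>

lemma s_pow_cancel:
  assumes "x \<in> carrier B" "y \<in> carrier B" "s [^] (m::nat) \<otimes> x = s [^] m \<otimes> y"
  shows "x = y"
proof (rule coord_eqI[OF assms(1,2)])
  fix i assume i: "i < r"
  hence "fps_X ^ m * coord x i = fps_X ^ m * coord y i" using coord_s_pow assms by metis
  thus "coord x i = coord y i" by simp
qed

lemma loc_rel_iff:
  "((x, k), (y, l)) \<in> loc_rel B s \<longleftrightarrow> x \<in> carrier B \<and> y \<in> carrier B \<and> s [^] l \<otimes> x = s [^] k \<otimes> y"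
proof -
  have "s [^] l \<otimes> x = s [^] k \<otimes> y" if "x \<in> carrier B" "y \<in> carrier B"
    "s [^] (m::nat) \<otimes> (s [^] l \<otimes> x) = s [^] m \<otimes> (s [^] k \<otimes> y)" for m
    using s_pow_cancel[OF _ _ that(3)] that(1,2) by simp
  moreover have "\<exists>m::nat. s [^] m \<otimes> (s [^] l \<otimes> x) = s [^] m \<otimes> (s [^] k \<otimes> y)" if "s [^] l \<otimes> x = s [^] k \<otimes> y"
    using that by auto
  ultimately show ?thesis unfolding loc_rel_def by blast
qed

text \<open>Identifies the localization with vectors over K((t)): equality of fractions becomes
  equality of coordinates, and independence of representatives can be checked there.\<close>

lemma loc_rel_iff_val:
  "((x, k), (y, l)) \<in> loc_rel B s \<longleftrightarrow> x \<in> carrier B \<and> y \<in> carrier B \<and> (\<forall>i<r. val x k i = val y l i)"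
proof -
  have "s [^] l \<otimes> x = s [^] k \<otimes> y \<longleftrightarrow> (\<forall>i<r. val x k i = val y l i)" if xy: "x \<in> carrier B" "y \<in> carrier B"
  proof -
    have "val x k i = val y l i \<longleftrightarrow> coord (s [^] l \<otimes> x) i = coord (s [^] k \<otimes> y) i" if i: "i < r" for i
    proof -
      have "val x k i = val y l i \<longleftrightarrow> T ^ l * fps_to_fls (coord x i) = T ^ k * fps_to_fls (coord y i)"
        by (simp add: val_def field_simps)
      also have "\<dots> \<longleftrightarrow> fps_to_fls (fps_X ^ l * coord x i) = fps_to_fls (fps_X ^ k * coord y i)"
        by (simp only: fps_to_fls_X_power)
      finally show ?thesis using xy i by (simp add: coord_s_pow)
    qed
    thus ?thesis using xy by (auto intro!: coord_eqI)
  qed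
  thus ?thesis unfolding loc_rel_iff by blast
qed

abbreviation frac where "frac x k \<equiv> loc_frac B s x k"

lemma mem_frac: "(y, l) \<in> frac x k \<longleftrightarrow> x \<in> carrier B \<and> y \<in> carrier B \<and> (\<forall>i<r. val x k i = val y l i)"
  by (simp add: loc_frac_def loc_rel_iff_val)

lemma frac_eq_iff:
  assumes "x \<in> carrier B" "y \<in> carrier B"
  shows "frac x k = frac y l \<longleftrightarrow> (\<forall>i<r. val x k i = val y l i)"
proof
  assume "frac x k = frac y l"
  moreover have "(y, l) \<in> frac y l" using assms by (simp add: mem_frac)
  ultimately have "(y, l) \<in> frac x k" by simp
  thus "\<forall>i<r. val x k i = val y l i" by (simp add: mem_frac)
next
  assume "\<forall>i<r. val x k i = val y l i"
  thus "frac x k = frac y l" using assms by (auto simp: mem_frac)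
qed

lemma frac_in_carrier: "x \<in> carrier B \<Longrightarrow> frac x k \<in> carrier (localization B s)"
  by (auto simp: localization_def loc_frac_def intro!: quotientI)

lemma carrier_localizationE:
  assumes "U \<in> carrier (localization B s)"
  obtains x k where "x \<in> carrier B" "U = frac x k"
  using assms by (auto simp: localization_def loc_frac_def elim!: quotientE)

text \<open>The operations of \<open>localization\<close> are unions over representatives; a union
  of equal classes over a nonempty index set is that class.\<close>

lemma UN_frac_const:
  assumes "\<And>y l y' l'. (y, l) \<in> frac x k \<Longrightarrow> (y', l') \<in> frac x' k' \<Longrightarrow> G (y, l) (y', l') = Z"
    and "x \<in> carrier B" "x' \<in> carrier B"
  shows "(\<Union>u\<in>frac x k. \<Union>u'\<in>frac x' k'. G u u') = Z"
proof -
  have "(x, k) \<in> frac x k" "(x', k') \<in> frac x' k'" using assms by (auto simp: mem_frac)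
  moreover have "G u u' = Z" if "u \<in> frac x k" "u' \<in> frac x' k'" for u u'
    using assms(1)[of "fst u" "snd u" "fst u'" "snd u'"] that by simp
  ultimately show ?thesis by blast
qed

lemma val_add:
  assumes "x \<in> carrier B" "y \<in> carrier B" "i < r"
  shows "val (s [^] l \<otimes> x \<oplus> s [^] k \<otimes> y) (k + l) i = val x k i + val y l i"
  using assms by (simp add: val_def coord_add coord_s_pow fps_to_fls_X_power power_add field_simps)

lemma frac_mult:
  assumes "x \<in> carrier B" "y \<in> carrier B"
  shows "frac x k \<otimes>\<^bsub>localization B s\<^esub> frac y l = frac (x \<otimes> y) (k + l)"
proof -
  have "frac (x' \<otimes> y') (k' + l') = frac (x \<otimes> y) (k + l)" if "(x', k') \<in> frac x k" "(y', l') \<in> frac y l" for x' k' y' l'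
  proof -
    from that have c: "x' \<in> carrier B" "y' \<in> carrier B" by (auto simp: mem_frac)
    have "((x, k), (x', k')) \<in> loc_rel B s" "((y, l), (y', l')) \<in> loc_rel B s"
      using that by (auto simp: mem_frac loc_rel_iff_val)
    hence 1: "s [^] k' \<otimes> x = s [^] k \<otimes> x'" and 2: "s [^] l' \<otimes> y = s [^] l \<otimes> y'" by (auto simp: loc_rel_iff)
    have "s [^] (k' + l') \<otimes> (x \<otimes> y) = (s [^] k' \<otimes> x) \<otimes> (s [^] l' \<otimes> y)"
      using assms by (simp add: nat_pow_mult[symmetric] m_ac)
    also have "\<dots> = s [^] (k + l) \<otimes> (x' \<otimes> y')"
      unfolding 1 2 using c by (simp add: nat_pow_mult[symmetric] m_ac)
    finally have "((x \<otimes> y, k + l), (x' \<otimes> y', k' + l')) \<in> loc_rel B s"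
      using assms c by (simp add: loc_rel_iff)
    thus ?thesis using assms c by (subst frac_eq_iff) (auto simp: loc_rel_iff_val)
  qed
  hence "(\<Union>u\<in>frac x k. \<Union>u'\<in>frac y l. frac (fst u \<otimes> fst u') (snd u + snd u')) = frac (x \<otimes> y) (k + l)"
    using assms by (intro UN_frac_const) simp_all
  thus ?thesis by (simp add: localization_def)
qed

lemma frac_add:
  assumes "x \<in> carrier B" "y \<in> carrier B"
  shows "frac x k \<oplus>\<^bsub>localization B s\<^esub> frac y l = frac (s [^] l \<otimes> x \<oplus> s [^] k \<otimes> y) (k + l)"
proof -
  have "frac (s [^] l' \<otimes> x' \<oplus> s [^] k' \<otimes> y') (k' + l') = frac (s [^] l \<otimes> x \<oplus> s [^] k \<otimes> y) (k + l)"
    if "(x', k') \<in> frac x k" "(y', l') \<in> frac y l" for x' k' y' l'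
  proof -
    from that have c: "x' \<in> carrier B" "y' \<in> carrier B" by (auto simp: mem_frac)
    show ?thesis using assms c that by (subst frac_eq_iff) (auto simp: val_add mem_frac)
  qed
  hence "(\<Union>u\<in>frac x k. \<Union>u'\<in>frac y l. frac (s [^] snd u' \<otimes> fst u \<oplus> s [^] snd u \<otimes> fst u') (snd u + snd u'))
      = frac (s [^] l \<otimes> x \<oplus> s [^] k \<otimes> y) (k + l)"
    using assms by (intro UN_frac_const) simp_all
  thus ?thesis by (simp add: localization_def)
qed

text \<open>The chosen representative does not affect the value, as \<open>val\<close> is constant
  on each class.\<close>

definition lcoord :: "nat \<Rightarrow> ('b \<times> nat) set \<Rightarrow> 'a fls" where
  "lcoord i U = (let (x, k) = SOME u. u \<in> U in val x k i)"

lemma lcoord_frac: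
  assumes "x \<in> carrier B" "i < r"
  shows "lcoord i (frac x k) = val x k i"
proof -
  obtain y l where yl: "(SOME u. u \<in> frac x k) = (y, l)" by force
  have "(x, k) \<in> frac x k" using assms by (simp add: mem_frac)
  hence "(SOME u. u \<in> frac x k) \<in> frac x k" by (rule someI)
  hence "(y, l) \<in> frac x k" by (simp only: yl)
  thus ?thesis using assms by (simp add: lcoord_def yl mem_frac)
qed

lemma lcoord_add:
  assumes "U \<in> carrier (localization B s)" "W \<in> carrier (localization B s)" "i < r"
  shows "lcoord i (U \<oplus>\<^bsub>localization B s\<^esub> W) = lcoord i U + lcoord i W"
  using assms by (elim carrier_localizationE) (simp add: frac_add lcoord_frac val_add)

lemma lcoord_zero: "i < r \<Longrightarrow> lcoord i \<zero>\<^bsub>localization B s\<^esub> = 0"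
  by (simp add: localization_def lcoord_frac val_def coord_zero)

lemma lcoord_eqI:
  assumes "U \<in> carrier (localization B s)" "W \<in> carrier (localization B s)" "\<And>i. i < r \<Longrightarrow> lcoord i U = lcoord i W"
  shows "U = W"
  using assms by (elim carrier_localizationE) (simp add: frac_eq_iff lcoord_frac)

text \<open>Together with \<open>lcoord_add\<close> this makes the coordinates K((t))-linear. With k
  the pole order of \<open>g\<close>, the product of t^k and \<open>g\<close> is a power series that
  acts on coordinates of B, and the denominators account for the rest.\<close>

lemma laurent_map_mult:
  assumes "U \<in> carrier (localization B s)" "i < r"
  shows "lcoord i (laurent_map \<phi> B g \<otimes>\<^bsub>localization B s\<^esub> U) = g * lcoord i U"
proof -
  define k where "k = nat (- fls_subdegree g)"
  define c where "c = fls_regpart (fls_shift (- int k) g)"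
  have "- int k \<le> fls_subdegree g" by (simp add: k_def)
  hence "fps_to_fls c = fls_shift (- int k) g"
    unfolding c_def by (intro fls_regpart_to_fls_trivial fls_shift_nonneg_subdegree)
  hence c: "fps_to_fls c = g * T ^ k" by (simp add: T_def fls_X_power_times_conv_shift)
  have L: "laurent_map \<phi> B g = frac (\<phi> c) k" by (simp add: laurent_map_def k_def c_def Let_def)
  obtain x l where x: "x \<in> carrier B" "U = frac x l" using carrier_localizationE[OF assms(1)] .
  have "lcoord i (laurent_map \<phi> B g \<otimes>\<^bsub>localization B s\<^esub> U) = val (\<phi> c \<otimes> x) (k + l) i"
    using x assms(2) by (simp add: L frac_mult lcoord_frac)
  also have "\<dots> = fps_to_fls (c * coord x i) / T ^ (k + l)"
    using x assms(2) by (simp add: val_def coord_smult)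
  also have "\<dots> = g * val x l i"
    by (simp add: fls_times_fps_to_fls c val_def power_add)
  finally show ?thesis using x assms(2) by (simp add: lcoord_frac)
qed

end

subsection \<open>Presentations of formally smooth algebras\<close>

lemma polys_induct [consumes 1, case_names Const Var add mult]:
  fixes p :: "('v, 'a::comm_ring_1) mpoly"
  assumes "p \<in> polys V" and "\<And>c. P (Const c)" and "\<And>v. v \<in> V \<Longrightarrow> P (Var v)"
    and "\<And>p q. p \<in> polys V \<Longrightarrow> q \<in> polys V \<Longrightarrow> P p \<Longrightarrow> P q \<Longrightarrow> P (p + q)"
    and "\<And>p q. p \<in> polys V \<Longrightarrow> q \<in> polys V \<Longrightarrow> P p \<Longrightarrow> P q \<Longrightarrow> P (p * q)"
  shows "P p"
proof -
  have mon: "P (single m 1)" if "keys m \<subseteq> V" for m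
    using that
  proof (induction m rule: mon_induct)
    case zero
    show ?case using assms(2)[of 1] by simp
  next
    case (add m v)
    hence v: "v \<in> V" and m: "keys m \<subseteq> V" by (auto simp: keys_add_nat)
    have "single (m + single v 1) 1 = single m 1 * (Var v :: ('v, 'a) mpoly)" by (simp add: Var_def mult_single)
    thus ?case using assms(5)[OF polys_single[OF m] polys_Var[OF v] add.IH[OF m] assms(3)[OF v]] by simp
  qed
  have "P (\<Sum>m\<in>A. single m (lookup p m)) \<and> (\<Sum>m\<in>A. single m (lookup p m)) \<in> polys V"
    if "finite A" "A \<subseteq> keys p" for A
    using that
  proof (induction A rule: finite_induct)
    case empty
    show ?case using assms(2)[of 0] by simp
  next
    case (insert m A)
    have m: "keys m \<subseteq> V" using insert assms(1) by (auto simp: polys_def)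
    have "single m (lookup p m) = Const (lookup p m) * single m 1" by (simp add: Const_def mult_single)
    moreover have "P (Const (lookup p m) * single m 1)"
      using assms(5)[OF polys_Const polys_single[OF m] assms(2) mon[OF m]] .
    ultimately show ?case using insert m by (auto intro!: assms(4) polys_add polys_mult polys_single)
  qed
  from this[of "keys p"] show ?thesis using poly_sum_monomials[of p] by simp
qed

text \<open>
  Formal smoothness of \<open>k[V] / I\<close>, applied to \<open>k[V] / Q \<rightarrow> k[V] / I\<close> where \<open>Q \<supseteq> I\<^sup>2\<close> consists of the elements
  of \<open>I\<close> all of whose first derivatives lie in \<open>I\<close>.
\<close>

lemma formally_smooth_section:
  fixes \<psi> :: "'r::comm_ring_1 \<Rightarrow> 'b" and \<eta> :: "(nat, 'r) mpoly \<Rightarrow> 'b"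
  assumes smooth: "formally_smooth \<psi> L" and L: "is_algebra \<psi> L"
    and \<eta>: "\<eta> \<in> ring_hom (mpoly_ring V) L" "\<eta> ` polys V = carrier L" "\<And>c. \<eta> (Const c) = \<psi> c"
    and I: "I = {p \<in> polys V. \<eta> p = \<zero>\<^bsub>L\<^esub>}"
  obtains s where "\<And>v. v \<in> V \<Longrightarrow> s v \<in> polys V"
    "\<And>p. p \<in> polys V \<Longrightarrow> poly_eval Const s p - p \<in> I"
    "\<And>p v. p \<in> I \<Longrightarrow> v \<in> V \<Longrightarrow> partial v (poly_eval Const s p) \<in> I"
proof -
  let ?P = "mpoly_ring V :: (nat, 'r) mpoly ring"
  interpret L: cring L using L by (simp add: is_algebra_def)
  interpret P: cring ?P by (rule cring_mpoly_ring)
  interpret \<eta>: ring_hom_ring ?P L \<eta>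
    by (intro ring_hom_ringI2 \<eta>(1) P.ring_axioms L.ring_axioms)
  have \<eta>_simps: "\<eta> (p + q) = \<eta> p \<oplus>\<^bsub>L\<^esub> \<eta> q" "\<eta> (p * q) = \<eta> p \<otimes>\<^bsub>L\<^esub> \<eta> q" if "p \<in> polys V" "q \<in> polys V" for p q
    using \<eta>.hom_add[of p q] \<eta>.hom_mult[of p q] that by auto
  have \<eta>_closed: "\<eta> p \<in> carrier L" if "p \<in> polys V" for p using \<eta>.hom_closed[of p] that by simp
  have I_add: "p + q \<in> I" if "p \<in> I" "q \<in> I" for p q
    using that \<eta>_simps by (auto simp: I polys_add)
  have I_mult: "p * q \<in> I" if "p \<in> I" "q \<in> polys V" for p q
    using that \<eta>_simps \<eta>_closed by (auto simp: I polys_mult)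
  have I0: "0 \<in> I" using \<eta>.hom_zero by (simp add: I)
  have IV: "I \<subseteq> polys V" by (auto simp: I)
  have idI: "ideal I ?P" using I_add I_mult I0 IV by (intro ideal_mpolyI) auto
  define Q where "Q = {p \<in> I. \<forall>v\<in>V. partial v p \<in> I}"
  have QI: "Q \<subseteq> I" by (auto simp: Q_def)
  have idQ: "ideal Q ?P"
  proof (rule ideal_mpolyI)
    fix p q :: "(nat, 'r) mpoly" assume p: "p \<in> Q" and q: "q \<in> polys V"
    have "partial v (p * q) \<in> I" if "v \<in> V" for v
    proof -
      have "p \<in> I" "partial v p \<in> I" using p that by (auto simp: Q_def)
      thus ?thesis unfolding partial_mult using I_add[OF I_mult[OF _ q] I_mult[OF _ partial_polys[OF q]], of "partial v p" p v]
        by simp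
    qed
    thus "p * q \<in> Q" using p q I_mult by (auto simp: Q_def)
  qed (use I_add I0 IV in \<open>auto simp: Q_def partial_add\<close>)
  \<comment> \<open>By the Leibniz rule products of elements of \<open>I\<close> have their
    derivatives in \<open>I\<close>; hence the image of \<open>I\<close> in the test algebra has
    square zero.\<close>
  have IQ: "p * q \<in> Q" if "p \<in> I" "q \<in> I" for p q
  proof -
    have pq: "p \<in> polys V" "q \<in> polys V" using that IV by auto
    have "partial v (p * q) \<in> I" for v
      unfolding partial_mult
      using I_add[OF I_mult[OF that(2) partial_polys[OF pq(1)], of v]
          I_mult[OF that(1) partial_polys[OF pq(2)], of v]] by (simp add: mult.commute)
    thus ?thesis using I_mult that pq by (auto simp: Q_def)
  qed
  let ?C = "?P Quot Q"
  let ?q = "\<lambda>p. Q +>\<^bsub>?P\<^esub> p"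
  define J where "J = ?q ` I"
  have algC: "is_algebra (quot_map ?P Q Const) ?C" by (rule is_algebra_quot[OF is_algebra_mpoly idQ])
  interpret C: cring ?C using algC by (simp add: is_algebra_def)
  interpret q: ring_hom_ring ?P ?C ?q by (rule ideal.rcos_ring_hom_ring[OF idQ])
  have idJ: "ideal J ?C" unfolding J_def by (rule P.ring_ideal_imp_quot_ideal[OF idQ idI])
  have J2: "\<forall>x\<in>J. \<forall>y\<in>J. x \<otimes>\<^bsub>?C\<^esub> y = \<zero>\<^bsub>?C\<^esub>"
  proof (intro ballI)
    fix x y assume "x \<in> J" "y \<in> J"
    then obtain p p' where p: "p \<in> I" "p' \<in> I" "x = ?q p" "y = ?q p'" by (auto simp: J_def)
    hence "x \<otimes>\<^bsub>?C\<^esub> y = ?q (p * p')" using q.hom_mult[of p p'] IV by auto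
    also have "\<dots> = \<zero>\<^bsub>?C\<^esub>" using quot_zero[OF idQ, of "p * p'"] IQ[OF p(1,2)] p IV by (auto intro: polys_mult)
    finally show "x \<otimes>\<^bsub>?C\<^esub> y = \<zero>\<^bsub>?C\<^esub>" .
  qed
  define \<kappa> where "\<kappa> p = J +>\<^bsub>?C\<^esub> ?q p" for p
  have \<kappa>: "\<kappa> \<in> ring_hom ?P (?C Quot J)"
    using ring_hom_trans[OF q.homh ideal.rcos_ring_hom[OF idJ]] by (simp add: \<kappa>_def[abs_def] comp_def)
  have qJ: "?q p \<in> J \<longleftrightarrow> p \<in> I" if "p \<in> polys V" for p
  proof
    assume "?q p \<in> J"
    then obtain p' where p': "p' \<in> I" "?q p = ?q p'" by (auto simp: J_def)
    hence "p - p' \<in> Q" using quot_cong[OF idQ, of p p'] that IV by auto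
    hence "(p - p') + p' \<in> I" using QI p'(1) I_add by blast
    thus "p \<in> I" by simp
  qed (simp add: J_def)
  have \<kappa>_eq: "\<kappa> p = \<kappa> p' \<longleftrightarrow> p - p' \<in> I" if "p \<in> polys V" "p' \<in> polys V" for p p'
  proof -
    have "\<kappa> p = \<kappa> p' \<longleftrightarrow> ?q p \<ominus>\<^bsub>?C\<^esub> ?q p' \<in> J"
      unfolding \<kappa>_def using that by (intro quot_cong[OF idJ]) auto
    also have "?q p \<ominus>\<^bsub>?C\<^esub> ?q p' = ?q (p - p')"
      using that q.hom_add[of p "- p'"] q.hom_a_inv[of p'] polys_uminus[of p' V] by (simp add: a_minus_def)
    finally show ?thesis using qJ[of "p - p'"] that by (simp add: polys_diff)
  qed
  have \<eta>_surj: "\<exists>p. p \<in> polys V \<and> \<eta> p = U" if "U \<in> carrier L" for U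
  proof -
    from that have "U \<in> \<eta> ` polys V" by (simp only: \<eta>(2))
    thus ?thesis by (elim imageE) metis
  qed
  define \<pi> where "\<pi> U = (SOME p. p \<in> polys V \<and> \<eta> p = U)" for U
  have \<pi>: "\<pi> U \<in> polys V \<and> \<eta> (\<pi> U) = U" if "U \<in> carrier L" for U
  proof -
    from \<eta>_surj[OF that] obtain p where "p \<in> polys V \<and> \<eta> p = U" ..
    thus ?thesis unfolding \<pi>_def by (rule someI)
  qed
  \<comment> \<open>The canonical isomorphism of P / I with (P / Q) / (I / Q), the map to be lifted.
    By \<open>\<kappa>_eq\<close> the choice of preimages does not matter.\<close>
  define u where "u U = \<kappa> (\<pi> U)" for U
  have u_\<eta>: "u (\<eta> p) = \<kappa> p" if p: "p \<in> polys V" for p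
  proof -
    have *: "\<pi> (\<eta> p) \<in> polys V" "\<eta> (\<pi> (\<eta> p)) = \<eta> p" using \<pi>[OF \<eta>_closed[OF p]] by auto
    have "\<eta> (\<pi> (\<eta> p) - p) = \<eta> (\<pi> (\<eta> p)) \<ominus>\<^bsub>L\<^esub> \<eta> p"
      using * p \<eta>.hom_add[of "\<pi> (\<eta> p)" "- p"] \<eta>.hom_a_inv[of p] polys_uminus[of p V] by (simp add: a_minus_def)
    also have "\<dots> = \<zero>\<^bsub>L\<^esub>" using * \<eta>_closed[OF p] by (simp add: L.r_neg a_minus_def)
    finally have "\<pi> (\<eta> p) - p \<in> I" using * p by (simp add: I polys_diff)
    thus ?thesis unfolding u_def using \<kappa>_eq * p by blast
  qed
  have "u \<in> ring_hom L (?C Quot J)"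
  proof (rule ring_hom_memI)
    have rep: "\<exists>p\<in>polys V. U = \<eta> p" if "U \<in> carrier L" for U
      using \<eta>_surj[OF that] by metis
    show "u U \<in> carrier (?C Quot J)" if U: "U \<in> carrier L" for U
      using rep[OF U] ring_hom_closed[OF \<kappa>] by (auto simp: u_\<eta>)
    show "u (U \<otimes>\<^bsub>L\<^esub> W) = u U \<otimes>\<^bsub>?C Quot J\<^esub> u W" if U: "U \<in> carrier L" "W \<in> carrier L" for U W
    proof -
      obtain p p' where p: "p \<in> polys V" "p' \<in> polys V" "U = \<eta> p" "W = \<eta> p'" using rep[OF U(1)] rep[OF U(2)] by metis
      have "u (U \<otimes>\<^bsub>L\<^esub> W) = u (\<eta> (p * p'))" using p by (simp add: \<eta>_simps)
      thus ?thesis using p ring_hom_mult[OF \<kappa>, of p p'] by (simp add: u_\<eta> polys_mult)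
    qed
    show "u (U \<oplus>\<^bsub>L\<^esub> W) = u U \<oplus>\<^bsub>?C Quot J\<^esub> u W" if U: "U \<in> carrier L" "W \<in> carrier L" for U W
    proof -
      obtain p p' where p: "p \<in> polys V" "p' \<in> polys V" "U = \<eta> p" "W = \<eta> p'" using rep[OF U(1)] rep[OF U(2)] by metis
      have "u (U \<oplus>\<^bsub>L\<^esub> W) = u (\<eta> (p + p'))" using p by (simp add: \<eta>_simps)
      thus ?thesis using p ring_hom_add[OF \<kappa>, of p p'] by (simp add: u_\<eta> polys_add)
    qed
    have "u \<one>\<^bsub>L\<^esub> = u (\<eta> 1)" using \<eta>.hom_one by simp
    thus "u \<one>\<^bsub>L\<^esub> = \<one>\<^bsub>?C Quot J\<^esub>" using ring_hom_one[OF \<kappa>] by (simp add: u_\<eta>)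
  qed
  moreover have "u (\<psi> c) = quot_map ?C J (quot_map ?P Q Const) c" for c
    using u_\<eta>[of "Const c"] by (simp add: \<eta>(3) \<kappa>_def quot_map_def)
  ultimately have "u \<in> algebra_hom \<psi> L (quot_map ?C J (quot_map ?P Q Const)) (?C Quot J)"
    by (simp add: algebra_hom_def)
  with smooth[unfolded formally_smooth_def, rule_format, OF conjI[OF algC conjI[OF idJ J2]]]
  obtain h where h: "h \<in> algebra_hom \<psi> L (quot_map ?P Q Const) ?C" "\<forall>U\<in>carrier L. J +>\<^bsub>?C\<^esub> h U = u U"
    by meson
  have hh: "h \<in> ring_hom L ?C" "\<And>c. h (\<psi> c) = ?q (Const c)" using h(1) by (auto simp: algebra_hom_def quot_map_def)
  \<comment> \<open>The lift only gives classes modulo \<open>Q\<close>. Representatives are chosen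
    for the variables and extended by substitution to an honest endomorphism of the polynomial
    ring.\<close>
  have "\<exists>p. p \<in> polys V \<and> ?q p = h (\<eta> (Var v))" if "v \<in> V" for v
    using ring_hom_closed[OF hh(1) \<eta>_closed[OF polys_Var[OF that]]] by (auto simp: quot_carrier)
  then obtain s where s: "\<And>v. v \<in> V \<Longrightarrow> s v \<in> polys V \<and> ?q (s v) = h (\<eta> (Var v))" by metis
  note S = ring_map.ring_map_poly_eval[OF ring_map_Const, of s]
  have S_polys: "poly_eval Const s p \<in> polys V" if "p \<in> polys V" for p
    using polys_poly_eval[OF that] s by blast
  have key: "?q (poly_eval Const s p) = h (\<eta> p)" if "p \<in> polys V" for p
    using that
  proof (induction p rule: polys_induct)
    case (Const c)
    show ?case by (simp add: \<eta>(3) hh(2) ring_map.poly_eval_Const[OF ring_map_Const])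
  next
    case (Var v)
    thus ?case using s by (simp add: ring_map.poly_eval_Var[OF ring_map_Const])
  next
    case (add p p')
    thus ?case using q.hom_add[of "poly_eval Const s p" "poly_eval Const s p'"] S_polys
      by (simp add: ring_map.add[OF S] \<eta>_simps ring_hom_add[OF hh(1)] \<eta>_closed)
  next
    case (mult p p')
    thus ?case using q.hom_mult[of "poly_eval Const s p" "poly_eval Const s p'"] S_polys
      by (simp add: ring_map.mult[OF S] \<eta>_simps ring_hom_mult[OF hh(1)] \<eta>_closed)
  qed
  show ?thesis
  proof (rule that[of s])
    show "s v \<in> polys V" if "v \<in> V" for v using s that by blast
    show "poly_eval Const s p - p \<in> I" if p: "p \<in> polys V" for p
    proof -
      have "\<kappa> (poly_eval Const s p) = J +>\<^bsub>?C\<^esub> h (\<eta> p)" by (simp add: \<kappa>_def key[OF p])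
      also have "\<dots> = \<kappa> p" using h(2) \<eta>_closed[OF p] u_\<eta>[OF p] by simp
      finally show ?thesis using \<kappa>_eq[OF S_polys[OF p] p] by blast
    qed
    \<comment> \<open>The lift sends 0 to 0, so the substitution maps \<open>I\<close> into
      \<open>Q\<close>, whose elements have their first derivatives in \<open>I\<close>.\<close>
    show "partial v (poly_eval Const s p) \<in> I" if p: "p \<in> I" and v: "v \<in> V" for p v
    proof -
      have pV: "p \<in> polys V" "\<eta> p = \<zero>\<^bsub>L\<^esub>" using p by (auto simp: I)
      have "?q (poly_eval Const s p) = \<zero>\<^bsub>?C\<^esub>"
        unfolding key[OF pV(1)] pV(2) using ring_hom_zero[OF hh(1) L.ring_axioms C.ring_axioms] .
      hence "poly_eval Const s p \<in> Q" using quot_zero[OF idQ, of "poly_eval Const s p"] S_polys[OF pV(1)] by simp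
      thus ?thesis using v by (simp add: Q_def)
    qed
  qed
qed

lemma ring_map_to_ac: "ring_map to_ac"
  by unfold_locales auto

context free_power_series_algebra
begin

text \<open>A finite presentation of the generic fibre over K((t)), the section from formal
  smoothness and the coordinates \<open>lcoord\<close> form a \<open>finite_smooth_algebra\<close>.
  The vector \<open>a\<close> stands for an arbitrary functional in these coordinates.\<close>

lemma generic_fibre_points:
  assumes "smooth (laurent_map \<phi> B) (localization B s)"
  obtains V :: "nat set" and \<eta> where "\<eta> \<in> ring_hom (mpoly_ring V) (localization B s)"
    "\<eta> ` polys V = carrier (localization B s)"
    "\<And>a. \<exists>l \<xi>. \<forall>p\<in>polys V. to_ac (\<Sum>i<r. lcoord i (\<eta> p) * a i) = (\<Sum>j<r. l j * poly_eval to_ac (\<xi> j) p)"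
proof -
  let ?L = "localization B s" and ?\<psi> = "laurent_map \<phi> B"
  have L: "is_algebra ?\<psi> ?L" and fs: "formally_smooth ?\<psi> ?L" and fp: "finitely_presented ?\<psi> ?L"
    using assms by (auto simp: smooth_def)
  interpret L: cring ?L using L by (simp add: is_algebra_def)
  from fp obtain m :: nat and Z where Z: "Z \<subseteq> carrier (mpoly_ring {..<m})"
    and iso: "algebra_iso (quot_map (mpoly_ring {..<m}) (genideal (mpoly_ring {..<m}) Z) Const)
      (mpoly_ring {..<m} Quot genideal (mpoly_ring {..<m}) Z) ?\<psi> ?L"
    unfolding finitely_presented_def Let_def by auto
  let ?P = "mpoly_ring {..<m} :: (nat, 'a fls) mpoly ring"
  define V where "V = {..<m}"
  interpret P: cring "mpoly_ring V :: (nat, 'a fls) mpoly ring" by (rule cring_mpoly_ring)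
  define I0 where "I0 = genideal ?P Z"
  have idI0: "ideal I0 (mpoly_ring V)" unfolding I0_def V_def using Z by (intro ring.genideal_ideal ring_mpoly_ring)
  from iso obtain h where h: "h \<in> ring_iso (mpoly_ring V Quot I0) ?L"
    "\<And>c. h (quot_map (mpoly_ring V) I0 Const c) = ?\<psi> c" unfolding algebra_iso_def I0_def V_def by blast
  define \<eta> where "\<eta> p = h (I0 +>\<^bsub>mpoly_ring V\<^esub> p)" for p
  have \<eta>_hom: "\<eta> \<in> ring_hom (mpoly_ring V) ?L"
    using ring_hom_trans[OF ideal.rcos_ring_hom[OF idI0], of h ?L] h(1)
    by (simp add: \<eta>_def[abs_def] comp_def ring_iso_def)
  have "h ` carrier (mpoly_ring V Quot I0) = carrier ?L"
    using h(1) by (simp add: ring_iso_def bij_betw_def)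
  hence \<eta>_surj: "\<eta> ` polys V = carrier ?L" by (simp add: quot_carrier \<eta>_def image_image)
  have \<eta>_Const: "\<eta> (Const c) = ?\<psi> c" for c using h(2)[of c] by (simp add: \<eta>_def quot_map_def)
  interpret \<eta>: ring_hom_ring "mpoly_ring V" ?L \<eta> by (intro ring_hom_ringI2 \<eta>_hom P.ring_axioms L.ring_axioms)
  have \<eta>_simps: "\<eta> (p + q) = \<eta> p \<oplus>\<^bsub>?L\<^esub> \<eta> q" "\<eta> (p * q) = \<eta> p \<otimes>\<^bsub>?L\<^esub> \<eta> q" if "p \<in> polys V" "q \<in> polys V" for p q
    using \<eta>.hom_add[of p q] \<eta>.hom_mult[of p q] that by auto
  have \<eta>_closed: "\<eta> p \<in> carrier ?L" if "p \<in> polys V" for p using \<eta>.hom_closed[of p] that by simp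
  define I where "I = {p \<in> polys V. \<eta> p = \<zero>\<^bsub>?L\<^esub>}"
  obtain s' where s': "\<And>v. v \<in> V \<Longrightarrow> s' v \<in> polys V"
    "\<And>p. p \<in> polys V \<Longrightarrow> poly_eval Const s' p - p \<in> I"
    "\<And>p v. p \<in> I \<Longrightarrow> v \<in> V \<Longrightarrow> partial v (poly_eval Const s' p) \<in> I"
    using formally_smooth_section[OF fs L \<eta>_hom \<eta>_surj \<eta>_Const I_def] by metis
  define w where "w i p = lcoord i (\<eta> p)" for i p
  have w_add: "w i (p + q) = w i p + w i q" if "p \<in> polys V" "q \<in> polys V" "i < r" for p q i
    using that by (simp add: w_def \<eta>_simps lcoord_add \<eta>_closed)
  have w_Const: "w i (Const c * p) = c * w i p" if "p \<in> polys V" "i < r" for p c i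
    using that by (simp add: w_def \<eta>_simps \<eta>_Const laurent_map_mult \<eta>_closed)
  have w_0: "w i 0 = 0" if "i < r" for i using w_add[of 0 0 i] that by simp
  have w_sum: "w i (\<Sum>j\<in>A. p j) = (\<Sum>j\<in>A. w i (p j))" if "finite A" "\<And>j. j \<in> A \<Longrightarrow> p j \<in> polys V" "i < r"
    for A :: "nat set" and p i
    using that by (induction A rule: finite_induct) (auto simp: w_0 w_add polys_sum)
  have "\<exists>p. p \<in> polys V \<and> \<eta> p = frac (b i) 0" if "i < r" for i
  proof -
    have "frac (b i) 0 \<in> \<eta> ` polys V" unfolding \<eta>_surj using frac_in_carrier b_carrier that by auto
    thus ?thesis by (elim imageE) metis
  qed
  then obtain b' where b': "\<And>i. i < r \<Longrightarrow> b' i \<in> polys V \<and> \<eta> (b' i) = frac (b i) 0" by metis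
  have w_b': "w j (b' i) = (if i = j then 1 else 0)" if "i < r" "j < r" for i j
    using that b' b_carrier by (simp add: w_def lcoord_frac val_def coord_b)
  have mem_I: "p \<in> I" if "p \<in> polys V" "\<And>i. i < r \<Longrightarrow> w i p = 0" for p
  proof -
    have "\<eta> p = \<zero>\<^bsub>?L\<^esub>"
      by (rule lcoord_eqI) (use that \<eta>_closed in \<open>auto simp: w_def lcoord_zero\<close>)
    thus ?thesis using that by (simp add: I_def)
  qed
  note S = ring_map.ring_map_poly_eval[OF ring_map_Const, of s']
  interpret fsa: finite_smooth_algebra to_ac "poly_eval Const s'" V I r w b'
  proof (intro finite_smooth_algebra.intro ring_map_to_ac S finite_smooth_algebra_axioms.intro)
    show "finite V" by (simp add: V_def)
    show "I \<subseteq> polys V" by (auto simp: I_def)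
    show "0 \<in> I" using \<eta>.hom_zero by (simp add: I_def)
    show "p + q \<in> I" if "p \<in> I" "q \<in> I" for p q
      using that by (auto simp: I_def polys_add \<eta>_simps)
    show "p * q \<in> I" if "p \<in> I" "q \<in> polys V" for p q
      using that by (auto simp: I_def polys_mult \<eta>_simps \<eta>_closed)
    show "w i p = 0" if "p \<in> I" "i < r" for i p
      using that by (auto simp: I_def w_def lcoord_zero)
    show "p - (\<Sum>i<r. Const (w i p) * b' i) \<in> I" if p: "p \<in> polys V" for p
    proof (rule mem_I)
      have c: "(\<Sum>i<r. Const (- w i p) * b' i) \<in> polys V" using b' by (intro polys_sum polys_mult) auto
      have eq: "p - (\<Sum>i<r. Const (w i p) * b' i) = p + (\<Sum>i<r. Const (- w i p) * b' i)"
        by (simp add: ring_map.uminus[OF ring_map_Const] sum_negf)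
      show "p - (\<Sum>i<r. Const (w i p) * b' i) \<in> polys V" unfolding eq using p c by (rule polys_add)
      fix j assume j: "j < r"
      have "w j (\<Sum>i<r. Const (- w i p) * b' i) = (\<Sum>i<r. - w i p * w j (b' i))"
        using b' j by (subst w_sum) (auto simp: w_Const intro!: polys_mult)
      also have "\<dots> = (\<Sum>i<r. if i = j then - w j p else 0)"
        using j by (intro sum.cong) (auto simp: w_b')
      finally show "w j (p - (\<Sum>i<r. Const (w i p) * b' i)) = 0"
        unfolding eq using j p c by (simp add: w_add)
    qed
    show "poly_eval Const s' p \<in> polys V" if "p \<in> polys V" for p using polys_poly_eval[OF that] s'(1) by blast
    show "poly_eval Const s' (Const c) = Const c" for c by (rule ring_map.poly_eval_Const[OF ring_map_Const])
  qed (use s' w_add w_Const b' in auto)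
  show ?thesis
  proof (rule that[OF \<eta>_hom \<eta>_surj])
    fix a :: "nat \<Rightarrow> 'a fls"
    define \<psi> where "\<psi> p = to_ac (\<Sum>i<r. w i p * a i)" for p
    have "\<psi> \<in> fsa.functionals"
    proof (rule fsa.functionalsI)
      show "\<psi> (p + q) = \<psi> p + \<psi> q" if "p \<in> polys V" "q \<in> polys V" for p q
        using that by (simp add: \<psi>_def w_add distrib_right sum.distrib)
      show "\<psi> (Const c * p) = to_ac c * \<psi> p" if "p \<in> polys V" for p c
        using that by (simp add: \<psi>_def w_Const mult.assoc flip: sum_distrib_left)
      show "\<psi> p = 0" if "p \<in> I" for p
        using that by (simp add: \<psi>_def fsa.w_I)
    qed
    then obtain l \<xi> where "\<And>p. p \<in> polys V \<Longrightarrow> \<psi> p = (\<Sum>j<r. l j * poly_eval to_ac (\<xi> j) p)"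
      by (rule fsa.functional_eq_sum_points) blast
    thus "\<exists>l \<xi>. \<forall>p\<in>polys V. to_ac (\<Sum>i<r. lcoord i (\<eta> p) * a i) = (\<Sum>j<r. l j * poly_eval to_ac (\<xi> j) p)"
      unfolding \<psi>_def w_def by blast
  qed
qed

end

text \<open>A linear functional on the smoothing that reduces to \<open>apair f\<close> is applied
  to lifts of monomials. Its values are power series with the right constant term, while on the
  generic fibre the functional is a sum of point evaluations.\<close>

theorem smoothable_imp_points:
  fixes f :: "(nat, 'a::field_char_0) mpoly"
  assumes f: "f \<noteq> 0" and smooth: "smoothable (Ap_scalar V f) (Ap V f)"
    and dim: "ring.dimension (Ap V f) N (range (Ap_scalar V f)) (carrier (Ap V f))"
  obtains \<Phi> :: "(nat \<Rightarrow>\<^sub>0 nat) \<Rightarrow> 'a fps" and l :: "nat \<Rightarrow> 'a fls alg_closure" and \<xi> where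
    "\<And>\<beta>. keys \<beta> \<subseteq> V \<Longrightarrow> fps_nth (\<Phi> \<beta>) 0 = apair f (single \<beta> 1)"
    "\<And>\<beta>. keys \<beta> \<subseteq> V \<Longrightarrow> to_ac (fps_to_fls (\<Phi> \<beta>)) = (\<Sum>j<N. l j * mon_eval (\<xi> j) \<beta>)"
proof -
  let ?A = "Ap V f"
  let ?q = "\<lambda>p. Ann V f +>\<^bsub>mpoly_ring V\<^esub> p"
  interpret q: ring_hom_ring "mpoly_ring V" ?A ?q by (rule Ap_hom)
  from smooth obtain B :: "(nat \<Rightarrow> 'a fps) ring" and \<phi> where B: "is_algebra \<phi> B" "free_of_finite_rank \<phi> B"
      "algebra_iso (quot_map B (cgenideal B (\<phi> fps_X)) (\<lambda>c. \<phi> (fps_const c)))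
        (B Quot cgenideal B (\<phi> fps_X)) (Ap_scalar V f) ?A" "smooth (laurent_map \<phi> B) (localization B (\<phi> fps_X))"
    unfolding smoothable_def Let_def by blast
  from B(2) obtain r :: nat and b where rb: "b \<in> {..<r} \<rightarrow> carrier B"
    "\<forall>x\<in>carrier B. \<exists>!c. c \<in> {..<r} \<rightarrow>\<^sub>E UNIV \<and> x = (\<Oplus>\<^bsub>B\<^esub>i\<in>{..<r}. \<phi> (c i) \<otimes>\<^bsub>B\<^esub> b i)"
    unfolding free_of_finite_rank_def by blast
  interpret F: free_power_series_algebra B \<phi> r b
    by (intro free_power_series_algebra.intro free_power_series_algebra_axioms.intro)
      (use B(1) rb in \<open>auto simp: is_algebra_def\<close>)
  define I where "I = cgenideal B F.s"
  have idI: "ideal I B" unfolding I_def by (rule F.cgenideal_ideal) simp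
  obtain g where g: "g \<in> ring_iso (B Quot I) ?A" "\<And>c. g (quot_map B I (\<lambda>c. \<phi> (fps_const c)) c) = Ap_scalar V f c"
    using B(3) unfolding algebra_iso_def I_def by blast
  define \<theta> where "\<theta> x = g (I +>\<^bsub>B\<^esub> x)" for x
  have \<theta>_hom: "\<theta> \<in> ring_hom B ?A"
    using ring_hom_trans[OF ideal.rcos_ring_hom[OF idI], of g ?A] g(1)
    by (simp add: \<theta>_def[abs_def] comp_def ring_iso_def)
  interpret \<theta>: ring_hom_ring B ?A \<theta> by (intro ring_hom_ringI2 \<theta>_hom F.ring_axioms q.S.ring_axioms)
  have g_bij: "bij_betw g (carrier (B Quot I)) (carrier ?A)" using g(1) by (simp add: ring_iso_def)
  have \<theta>_surj: "\<exists>x\<in>carrier B. \<theta> x = y" if "y \<in> carrier ?A" for y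
  proof -
    have "y \<in> g ` carrier (B Quot I)" using g_bij that by (simp add: bij_betw_def)
    thus ?thesis by (auto simp: quot_carrier \<theta>_def)
  qed
  have \<theta>_zero: "\<theta> x = \<zero>\<^bsub>?A\<^esub> \<longleftrightarrow> x \<in> I" if x: "x \<in> carrier B" for x
  proof -
    interpret Q: ring "B Quot I" by (rule ideal.quotient_is_ring[OF idI])
    interpret g: ring_hom_ring "B Quot I" ?A g
      using g(1) by (intro ring_hom_ringI2 Q.ring_axioms q.S.ring_axioms) (simp add: ring_iso_def)
    have c: "I +>\<^bsub>B\<^esub> x \<in> carrier (B Quot I)" using x by (simp add: quot_carrier)
    have "\<theta> x = g \<zero>\<^bsub>B Quot I\<^esub> \<longleftrightarrow> I +>\<^bsub>B\<^esub> x = \<zero>\<^bsub>B Quot I\<^esub>"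
      unfolding \<theta>_def using bij_betw_imp_inj_on[OF g_bij] c Q.zero_closed by (rule inj_on_eq_iff)
    thus ?thesis using quot_zero[OF idI x] by simp
  qed
  have \<theta>_const: "\<theta> (\<phi> (fps_const c)) = Ap_scalar V f c" for c
    using g(2)[of c] by (simp add: \<theta>_def quot_map_def)
  have \<theta>_\<phi>: "\<theta> (\<phi> a) = ?q (Const (fps_nth a 0))" for a
  proof -
    have a: "a = fps_const (fps_nth a 0) + fps_X * fps_shift 1 a"
      by (rule fps_ext) (simp add: fps_X_mult_nth fps_nth_fps_const Suc_diff_Suc)
    have "F.s \<otimes>\<^bsub>B\<^esub> \<phi> (fps_shift 1 a) \<in> I"
      unfolding I_def cgenideal_def using F.m_comm[of F.s "\<phi> (fps_shift 1 a)"] by auto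
    hence "\<theta> (F.s \<otimes>\<^bsub>B\<^esub> \<phi> (fps_shift 1 a)) = \<zero>\<^bsub>?A\<^esub>" by (subst \<theta>_zero) auto
    hence "\<theta> (\<phi> a) = Ap_scalar V f (fps_nth a 0)"
      by (subst a) (simp add: F.\<phi>_add F.\<phi>_mult \<theta>_const is_algebra_closed[OF Ap_algebra] del: \<theta>.hom_mult)
    thus ?thesis by (simp add: Ap_scalar_def quot_map_def)
  qed
  have Ap_rep: "\<exists>p. p \<in> polys V \<and> ?q p = y" if "y \<in> carrier ?A" for y
    using that by (auto simp: Ap_def quot_carrier)
  have "\<exists>p. p \<in> polys V \<and> ?q p = \<theta> (b i)" if "i < r" for i
    using Ap_rep[of "\<theta> (b i)"] F.b_carrier[OF that] by simp
  then obtain pr where pr: "\<And>i. i < r \<Longrightarrow> pr i \<in> polys V \<and> ?q (pr i) = \<theta> (b i)" by metis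
  have \<theta>_lin: "\<theta> (F.lin c) = ?q (\<Sum>i<r. Const (fps_nth (c i) 0) * pr i)" for c
  proof -
    have "\<theta> (F.lin c) = (\<Oplus>\<^bsub>?A\<^esub>i\<in>{..<r}. \<theta> (\<phi> (c i) \<otimes>\<^bsub>B\<^esub> b i))"
      unfolding F.lin_def using F.b_carrier by (subst \<theta>.hom_finsum) (auto simp: comp_def)
    also have "\<dots> = (\<Oplus>\<^bsub>?A\<^esub>i\<in>{..<r}. ?q (Const (fps_nth (c i) 0) * pr i))"
    proof (rule q.S.finsum_cong')
      fix i assume i: "i \<in> {..<r}"
      hence "\<theta> (\<phi> (c i) \<otimes>\<^bsub>B\<^esub> b i) = ?q (Const (fps_nth (c i) 0)) \<otimes>\<^bsub>?A\<^esub> ?q (pr i)"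
        using F.b_carrier pr by (simp add: \<theta>_\<phi>)
      also have "\<dots> = ?q (Const (fps_nth (c i) 0) * pr i)"
        using q.hom_mult[of "Const (fps_nth (c i) 0)" "pr i"] pr i by simp
      finally show "\<theta> (\<phi> (c i) \<otimes>\<^bsub>B\<^esub> b i) = ?q (Const (fps_nth (c i) 0) * pr i)" .
    qed (use pr in \<open>auto intro!: q.hom_closed polys_mult\<close>)
    also have "\<dots> = ?q (\<Sum>i<r. Const (fps_nth (c i) 0) * pr i)"
    proof -
      have "(\<Oplus>\<^bsub>?A\<^esub>i\<in>A. ?q (Const (fps_nth (c i) 0) * pr i)) = ?q (\<Sum>i\<in>A. Const (fps_nth (c i) 0) * pr i)"
        if "finite A" "A \<subseteq> {..<r}" for A
        using that
      proof (induction A rule: finite_induct)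
        case empty
        show ?case using q.hom_zero by simp
      next
        case (insert i A)
        have cl: "Const (fps_nth (c j) 0) * pr j \<in> polys V" if "j \<in> insert i A" for j
          using that insert.prems pr by (intro polys_mult) auto
        hence "(\<Oplus>\<^bsub>?A\<^esub>i\<in>insert i A. ?q (Const (fps_nth (c i) 0) * pr i)) =
          ?q (Const (fps_nth (c i) 0) * pr i) \<oplus>\<^bsub>?A\<^esub> ?q (\<Sum>i\<in>A. Const (fps_nth (c i) 0) * pr i)"
          using insert by (subst q.S.finsum_insert) (auto intro!: q.hom_closed)
        also have "\<dots> = ?q (Const (fps_nth (c i) 0) * pr i + (\<Sum>i\<in>A. Const (fps_nth (c i) 0) * pr i))"
          using q.hom_add[of "Const (fps_nth (c i) 0) * pr i" "\<Sum>i\<in>A. Const (fps_nth (c i) 0) * pr i"] cl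
          by (simp add: polys_sum)
        finally show ?case using insert by simp
      qed
      thus ?thesis by simp
    qed
    finally show ?thesis .
  qed
  have sum_polys: "(\<Sum>i<r. Const (c i) * pr i) \<in> polys V" for c using pr by (intro polys_sum polys_mult) auto
  \<comment> \<open>A relation among the reductions of the basis lifts to a combination with
    constant coefficients that is divisible by t; its coordinates are constants divisible by t,
    hence 0. So the rank r is at most N.\<close>
  have "indep_mod (Ann V f) r pr"
    unfolding indep_mod_def
  proof (intro allI impI)
    fix c i assume c: "(\<Sum>i<r. Const (c i) * pr i) \<in> Ann V f" and i: "i < r"
    have "\<theta> (F.lin (\<lambda>i. fps_const (c i))) = ?q (\<Sum>i<r. Const (c i) * pr i)" by (simp add: \<theta>_lin)
    also have "\<dots> = \<zero>\<^bsub>?A\<^esub>" using quot_zero[OF ideal_Ann, of _ V f] c sum_polys by (simp add: Ap_def)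
    finally have "F.lin (\<lambda>i. fps_const (c i)) \<in> I" using \<theta>_zero by simp
    then obtain x where x: "x \<in> carrier B" "F.lin (\<lambda>i. fps_const (c i)) = x \<otimes>\<^bsub>B\<^esub> F.s"
      by (auto simp: I_def cgenideal_def)
    have "fps_const (c i) = F.coord (F.s \<otimes>\<^bsub>B\<^esub> x) i"
      using F.coord_lin[OF i, of "\<lambda>i. fps_const (c i)"] x by (simp add: F.m_comm)
    also have "\<dots> = fps_X * F.coord x i" using x(1) i by (rule F.coord_smult)
    finally have "fps_nth (fps_const (c i)) 0 = fps_nth (fps_X * F.coord x i) 0" by simp
    thus "c i = 0" by simp
  qed
  hence rN: "r \<le> N" using Ap_basis_extension[OF f dim, of r pr] pr by blast
  obtain \<eta> and V' :: "nat set" where \<eta>: "\<eta> \<in> ring_hom (mpoly_ring V') (localization B F.s)"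
    "\<eta> ` polys V' = carrier (localization B F.s)"
    "\<And>a. \<exists>l \<xi>. \<forall>p\<in>polys V'. to_ac (\<Sum>i<r. F.lcoord i (\<eta> p) * a i) = (\<Sum>j<r. l j * poly_eval to_ac (\<xi> j) p)"
    by (rule F.generic_fibre_points[OF B(4)]) (rule that, assumption, assumption, blast)
  obtain l \<xi> where l: "\<And>p. p \<in> polys V' \<Longrightarrow> to_ac (\<Sum>i<r. F.lcoord i (\<eta> p) * fls_const (apair f (pr i))) =
      (\<Sum>j<r. l j * poly_eval to_ac (\<xi> j) p)"
    using \<eta>(3)[of "\<lambda>i. fls_const (apair f (pr i))"] by blast
  have "\<exists>x. x \<in> carrier B \<and> \<theta> x = ?q (Var v)" if "v \<in> V" for v
  proof -
    have "(Var v :: (nat, 'a) mpoly) \<in> polys V" by (rule polys_Var[OF that])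
    hence "?q (Var v) \<in> carrier ?A" by simp
    from \<theta>_surj[OF this] show ?thesis by metis
  qed
  then obtain \<alpha> where \<alpha>: "\<And>v. v \<in> V \<Longrightarrow> \<alpha> v \<in> carrier B \<and> \<theta> (\<alpha> v) = ?q (Var v)" by metis
  have "\<exists>p. p \<in> polys V' \<and> \<eta> p = F.frac (\<alpha> v) 0" if "v \<in> V" for v
  proof -
    have "F.frac (\<alpha> v) 0 \<in> \<eta> ` polys V'" unfolding \<eta>(2) using F.frac_in_carrier \<alpha>[OF that] by blast
    thus ?thesis by (elim imageE) metis
  qed
  then obtain qq where qq: "\<And>v. v \<in> V \<Longrightarrow> qq v \<in> polys V' \<and> \<eta> (qq v) = F.frac (\<alpha> v) 0" by metis
  \<comment> \<open>Monomials are lifted multiplicatively from the lifts \<open>\<alpha> v\<close>: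
    the same element of B reduces to the monomial at t = 0 and evaluates as a monomial at the
    generic points.\<close>
  have "\<exists>x. x \<in> carrier B \<and> \<theta> x = ?q (single \<beta> 1) \<and> F.frac x 0 = \<eta> (mon_eval qq \<beta>)" if "keys \<beta> \<subseteq> V" for \<beta>
    using that
  proof (induction \<beta> rule: mon_induct)
    case zero
    have "\<theta> \<one>\<^bsub>B\<^esub> = ?q 1" using q.hom_one by simp
    moreover have "\<eta> 1 = F.frac \<one>\<^bsub>B\<^esub> 0" using ring_hom_one[OF \<eta>(1)] by (simp add: localization_def)
    ultimately show ?case by (intro exI[of _ "\<one>\<^bsub>B\<^esub>"]) simp
  next
    case (add \<beta> v)
    hence v: "v \<in> V" and \<beta>: "keys \<beta> \<subseteq> V" by (auto simp: keys_add_nat)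
    obtain x where x: "x \<in> carrier B" "\<theta> x = ?q (single \<beta> 1)" "F.frac x 0 = \<eta> (mon_eval qq \<beta>)"
      using add.IH[OF \<beta>] by blast
    have "\<theta> (x \<otimes>\<^bsub>B\<^esub> \<alpha> v) = ?q (single \<beta> 1 * Var v)"
    proof -
      have "(single \<beta> 1 :: (nat, 'a) mpoly) \<in> polys V" "(Var v :: (nat, 'a) mpoly) \<in> polys V"
        using polys_single[OF \<beta>] polys_Var[OF v] by auto
      thus ?thesis using x \<alpha>[OF v] q.hom_mult[of "single \<beta> 1" "Var v"] by simp
    qed
    also have "single \<beta> 1 * Var v = (single (\<beta> + single v 1) 1 :: (nat, 'a) mpoly)" by (simp add: Var_def mult_single)
    finally have 1: "\<theta> (x \<otimes>\<^bsub>B\<^esub> \<alpha> v) = ?q (single (\<beta> + single v 1) 1)" .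
    have "mon_eval qq \<beta> \<in> polys V'" using \<beta> qq by (intro polys_mon_eval) auto
    hence "\<eta> (mon_eval qq (\<beta> + single v 1)) = F.frac x 0 \<otimes>\<^bsub>localization B F.s\<^esub> F.frac (\<alpha> v) 0"
      using ring_hom_mult[OF \<eta>(1), of "mon_eval qq \<beta>" "qq v"] qq[OF v] x by (simp add: mon_eval_add)
    also have "\<dots> = F.frac (x \<otimes>\<^bsub>B\<^esub> \<alpha> v) 0" using x(1) \<alpha>[OF v] by (simp add: F.frac_mult)
    finally show ?case using 1 x \<alpha>[OF v] by (intro exI[of _ "x \<otimes>\<^bsub>B\<^esub> \<alpha> v"]) simp
  qed
  then obtain M where M: "\<And>\<beta>. keys \<beta> \<subseteq> V \<Longrightarrow> M \<beta> \<in> carrier B \<and> \<theta> (M \<beta>) = ?q (single \<beta> 1) \<and> F.frac (M \<beta>) 0 = \<eta> (mon_eval qq \<beta>)"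
    by metis
  \<comment> \<open>The K[[t]]-linear functional taking the constant value
    \<open>apair f (pr i)\<close> at \<open>b i\<close> lifts \<open>apair f\<close>; here it is
    applied to the lifted monomial.\<close>
  define \<Phi> where "\<Phi> \<beta> = (\<Sum>i<r. F.coord (M \<beta>) i * fps_const (apair f (pr i)))" for \<beta>
  show ?thesis
  proof (rule that[of \<Phi> "\<lambda>j. if j < r then l j else 0" "\<lambda>j v. poly_eval to_ac (\<xi> j) (qq v)"])
    fix \<beta> :: "nat \<Rightarrow>\<^sub>0 nat" assume \<beta>: "keys \<beta> \<subseteq> V"
    have x: "M \<beta> \<in> carrier B" using M[OF \<beta>] by blast
    let ?p = "\<Sum>i<r. Const (fps_nth (F.coord (M \<beta>) i) 0) * pr i"
    have "?q (single \<beta> 1) = ?q ?p" using M[OF \<beta>] \<theta>_lin[of "F.coord (M \<beta>)"] F.lin_coord[OF x] by simp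
    hence "single \<beta> 1 - ?p \<in> Ann V f"
      using quot_cong[OF ideal_Ann, of "single \<beta> 1" V ?p f] polys_single[OF \<beta>, of "1::'a"] sum_polys by simp
    from AnnD[OF this, of 1] have "apair f (single \<beta> 1) = apair f ?p"
      by (simp only: mult_1_right apair_diff right_minus_eq)
    also have "\<dots> = fps_nth (\<Phi> \<beta>) 0" by (simp add: \<Phi>_def apair_sum fps_sum_nth)
    finally show "fps_nth (\<Phi> \<beta>) 0 = apair f (single \<beta> 1)" by simp
    have "fps_to_fls (\<Phi> \<beta>) = (\<Sum>i<r. fps_to_fls (F.coord (M \<beta>) i) * fls_const (apair f (pr i)))"
    proof -
      have "fps_to_fls (\<Sum>i\<in>A. c i) = (\<Sum>i\<in>A. fps_to_fls (c i))" for A :: "nat set" and c :: "nat \<Rightarrow> 'a fps"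
        by (induction A rule: infinite_finite_induct) auto
      thus ?thesis by (simp add: \<Phi>_def fls_times_fps_to_fls)
    qed
    also have "\<dots> = (\<Sum>i<r. F.lcoord i (\<eta> (mon_eval qq \<beta>)) * fls_const (apair f (pr i)))"
    proof (intro sum.cong refl)
      fix i assume "i \<in> {..<r}"
      hence "F.lcoord i (\<eta> (mon_eval qq \<beta>)) = fps_to_fls (F.coord (M \<beta>) i)"
        using F.lcoord_frac[OF x, of i 0] M[OF \<beta>] by (simp add: F.val_def)
      thus "fps_to_fls (F.coord (M \<beta>) i) * fls_const (apair f (pr i)) =
          F.lcoord i (\<eta> (mon_eval qq \<beta>)) * fls_const (apair f (pr i))" by simp
    qed
    finally have "to_ac (fps_to_fls (\<Phi> \<beta>)) = (\<Sum>j<r. l j * poly_eval to_ac (\<xi> j) (mon_eval qq \<beta>))"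
      using l[of "mon_eval qq \<beta>"] polys_mon_eval[of \<beta> qq V'] \<beta> qq by auto
    also have "\<dots> = (\<Sum>j<r. l j * mon_eval (\<lambda>v. poly_eval to_ac (\<xi> j) (qq v)) \<beta>)"
      by (simp add: ring_map.mon_eval[OF ring_map.ring_map_poly_eval[OF ring_map_to_ac]])
    also have "\<dots> = (\<Sum>j<N. (if j < r then l j else 0) * mon_eval (\<lambda>v. poly_eval to_ac (\<xi> j) (qq v)) \<beta>)"
      using rN by (intro sum.mono_neutral_cong_left) auto
    finally show "to_ac (fps_to_fls (\<Phi> \<beta>)) =
      (\<Sum>j<N. (if j < r then l j else 0) * mon_eval (\<lambda>v. poly_eval to_ac (\<xi> j) (qq v)) \<beta>)" .
  qed
qed

section \<open>Powers of linear forms and truncated exponentials\<close>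

lemma lookup_Var_mult:
  fixes q :: "('v, 'a::comm_ring_1) mpoly"
  shows "lookup (Var v * q) m = (if v \<in> keys m then lookup q (m - single v 1) else 0)"
proof (cases "v \<in> keys m")
  case True
  then obtain m' where m': "m = m' + single v 1" by (rule mon_split)
  thus ?thesis using True lookup_single_mult[of "single v 1" 1 q m'] by (simp add: Var_def add.commute)
next
  case False
  have "lookup (Var v * q) m = 0"
  proof (rule ccontr)
    assume "lookup (Var v * q) m \<noteq> 0"
    then obtain a b where "m = a + b" "lookup (Var v :: ('v, 'a) mpoly) a \<noteq> 0" by (rule lookup_mult_nonzeroE)
    thus False using False by (auto simp: lookup_Var keys_add_nat split: if_splits)
  qed
  thus ?thesis using False by simp
qed

text \<open>The multinomial theorem with cleared denominators. Splitting off one factor weights each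
  variable by its exponent, and the exponents add up to the new degree.\<close>

lemma lookup_linear_form_power:
  fixes p :: "'v \<Rightarrow> 'a::field_char_0"
  assumes "finite V"
  shows "of_nat (mfact m) * lookup ((\<Sum>v\<in>V. Const (p v) * Var v) ^ s) m =
    (if keys m \<subseteq> V \<and> mon_deg m = s then fact s * mon_eval p m else 0)"
proof (induction s arbitrary: m)
  case 0
  show ?case by (auto simp: lookup_one when_def mon_deg_eq_0_iff)
next
  case (Suc s)
  let ?l = "\<Sum>v\<in>V. Const (p v) * Var v"
  have "of_nat (mfact m) * lookup (?l ^ Suc s) m =
      (\<Sum>v\<in>V. of_nat (mfact m) * (p v * (if v \<in> keys m then lookup (?l ^ s) (m - single v 1) else 0)))"
    by (simp add: sum_distrib_right lookup_sum mult.assoc lookup_Var_mult sum_distrib_left if_distrib cong: if_cong)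
  also have "\<dots> = (\<Sum>v\<in>V. if keys m \<subseteq> V \<and> mon_deg m = Suc s then of_nat (lookup m v) * (fact s * mon_eval p m) else 0)"
  proof (intro sum.cong refl)
    fix v assume v: "v \<in> V"
    show "of_nat (mfact m) * (p v * (if v \<in> keys m then lookup (?l ^ s) (m - single v 1) else 0)) =
      (if keys m \<subseteq> V \<and> mon_deg m = Suc s then of_nat (lookup m v) * (fact s * mon_eval p m) else 0)"
    proof (cases "v \<in> keys m")
      case True
      then obtain m' where m': "m = m' + single v 1" by (rule mon_split)
      have k: "keys m \<subseteq> V \<longleftrightarrow> keys m' \<subseteq> V" using v by (auto simp: m' keys_add_nat)
      have d: "mon_deg m = Suc s \<longleftrightarrow> mon_deg m' = s" by (simp add: m' mon_deg_add)
      have "of_nat (mfact m) * (p v * lookup (?l ^ s) m') =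
         of_nat (lookup m v) * p v * (of_nat (mfact m') * lookup (?l ^ s) m')"
        using mfact_add_single[of m' v] by (simp add: m' lookup_add mult_ac)
      also have "\<dots> = (if keys m \<subseteq> V \<and> mon_deg m = Suc s then of_nat (lookup m v) * (fact s * mon_eval p m) else 0)"
        unfolding Suc.IH k d by (simp add: m' mon_eval_add mult_ac)
      finally show ?thesis using True by (simp add: m')
    next
      case False
      thus ?thesis by (simp add: in_keys_iff)
    qed
  qed
  also have "\<dots> = (if keys m \<subseteq> V \<and> mon_deg m = Suc s then fact (Suc s) * mon_eval p m else 0)"
  proof (cases "keys m \<subseteq> V \<and> mon_deg m = Suc s")
    case True
    have "(\<Sum>v\<in>V. of_nat (lookup m v) * (fact s * mon_eval p m)) = of_nat (\<Sum>v\<in>V. lookup m v) * (fact s * mon_eval p m)"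
      by (simp add: sum_distrib_right)
    also have "(\<Sum>v\<in>V. lookup m v) = Suc s" using mon_deg_superset[OF assms, of m] True by simp
    finally show ?thesis using True by (simp add: mult.assoc)
  next
    case False
    thus ?thesis by (simp only: if_False sum.neutral_const)
  qed
  finally show ?case .
qed

definition lin_form :: "'v set \<Rightarrow> ('v \<Rightarrow> 'a) \<Rightarrow> ('v, 'a::comm_ring_1) mpoly" where
  "lin_form V p = (\<Sum>v\<in>V. Const (p v) * Var v)"

lemma lin_form_low: "lin_form V p \<in> low_deg 1"
proof -
  have "0 \<noteq> single v (1::nat)" for v :: 'a by (rule single_1_neq_0)
  thus ?thesis by (simp add: low_deg_1_iff lin_form_def lookup_sum lookup_Var)
qed

lemma lin_form_add: "lin_form V p + lin_form V q = lin_form V (\<lambda>v. p v + q v)"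
  by (simp add: lin_form_def Const_add distrib_right sum.distrib)

lemma lookup_lin_form_power:
  fixes p :: "'v \<Rightarrow> 'a::field_char_0"
  assumes "finite V"
  shows "lookup (lin_form V p ^ s) m =
    (if keys m \<subseteq> V \<and> mon_deg m = s then fact s * mon_eval p m / of_nat (mfact m) else 0)"
  using lookup_linear_form_power[OF assms, of m p s] by (simp add: lin_form_def field_simps split: if_splits)

section \<open>Truncated power series and exponentials\<close>

lemma low_deg_add: "p \<in> low_deg d \<Longrightarrow> q \<in> low_deg d \<Longrightarrow> p + q \<in> low_deg d"
  by (auto simp: low_deg_def lookup_add) (metis add.right_neutral)

lemma low_deg_zero: "0 \<in> low_deg d"
  by (simp add: low_deg_def)

lemma low_deg_sum: "(\<And>i. i \<in> A \<Longrightarrow> p i \<in> low_deg d) \<Longrightarrow> (\<Sum>i\<in>A. p i) \<in> low_deg d"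
  by (induction A rule: infinite_finite_induct) (auto intro: low_deg_add low_deg_zero)

lemma low_deg_Const_mult: "p \<in> low_deg d \<Longrightarrow> Const c * p \<in> low_deg d" for p :: "('v, 'a::comm_ring_1) mpoly"
  using low_deg_mult[OF low_deg_0, of p d "Const c"] by simp

text \<open>Congruence modulo terms of degree above \<open>D\<close>, standing in for identities
  between formal power series.\<close>

definition trunc_cong :: "nat \<Rightarrow> ('v, 'a::comm_ring_1) mpoly \<Rightarrow> ('v, 'a) mpoly \<Rightarrow> bool" where
  "trunc_cong D u v \<longleftrightarrow> u - v \<in> low_deg (Suc D)"

lemma trunc_cong_lookup: "trunc_cong D u v \<Longrightarrow> mon_deg m \<le> D \<Longrightarrow> lookup u m = lookup v m"
  by (fastforce simp: trunc_cong_def low_deg_def lookup_minus)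

lemma trunc_congI: "(\<And>m. mon_deg m \<le> D \<Longrightarrow> lookup u m = lookup v m) \<Longrightarrow> trunc_cong D u v"
  by (auto simp: trunc_cong_def low_deg_def lookup_minus not_less_eq_eq[symmetric])

lemma trunc_cong_refl: "trunc_cong D u u"
  by (simp add: trunc_cong_def low_deg_zero)

lemma trunc_cong_trans: "trunc_cong D u v \<Longrightarrow> trunc_cong D v w \<Longrightarrow> trunc_cong D u w"
  unfolding trunc_cong_def using low_deg_add[of "u - v" "Suc D" "v - w"] by simp

lemma trunc_cong_mult:
  assumes "trunc_cong D u u'" "trunc_cong D v v'"
  shows "trunc_cong D (u * v) (u' * v')"
proof -
  have "u * v - u' * v' = (u - u') * v + u' * (v - v')" by (simp add: algebra_simps)
  moreover have "(u - u') * v \<in> low_deg (Suc D)" "u' * (v - v') \<in> low_deg (Suc D)"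
    using assms low_deg_mult[OF _ low_deg_0, of "u - u'" "Suc D" v] low_deg_mult[OF low_deg_0, of "v - v'" "Suc D" u']
    by (auto simp: trunc_cong_def)
  ultimately show ?thesis by (simp add: trunc_cong_def low_deg_add)
qed

lemma trunc_cong_sum:
  "(\<And>i. i \<in> A \<Longrightarrow> trunc_cong D (u i) (v i)) \<Longrightarrow> trunc_cong D (\<Sum>i\<in>A. u i) (\<Sum>i\<in>A. v i)"
  by (simp add: trunc_cong_def low_deg_sum flip: sum_subtractf)

lemma trunc_cong_power: "trunc_cong D u v \<Longrightarrow> trunc_cong D (u ^ n) (v ^ n)"
  by (induction n) (auto intro: trunc_cong_mult trunc_cong_refl)

definition texp :: "nat \<Rightarrow> ('v, 'a::field_char_0) mpoly \<Rightarrow> ('v, 'a) mpoly" where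
  "texp D x = (\<Sum>s\<le>D. Const (1 / fact s) * x ^ s)"

text \<open>The products with i + j at most D regroup by the binomial theorem to the truncated
  exponential of the sum; the remaining ones have order above D.\<close>

lemma texp_mult:
  assumes "x \<in> low_deg 1" "y \<in> low_deg 1"
  shows "trunc_cong D (texp D x * texp D y) (texp D (x + y))"
proof -
  define t where "t = (\<lambda>i j. Const (1 / (fact i * fact j)) * (x ^ i * y ^ j))"
  have t: "t i j \<in> low_deg (i + j)" for i j
    using low_deg_power[OF assms(1), of i] low_deg_power[OF assms(2), of j]
    unfolding t_def by (intro low_deg_Const_mult) (simp add: low_deg_mult)
  have "texp D x * texp D y = (\<Sum>(i, j)\<in>{..D} \<times> {..D}. t i j)"
    unfolding texp_def sum_product sum.cartesian_product
    by (intro sum.cong refl) (auto simp: t_def Const_mult[symmetric] mult_ac simp flip: mult.assoc)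
  moreover have "texp D (x + y) = (\<Sum>(i, j)\<in>{(i, j). i + j \<le> D}. t i j)"
  proof -
    have "Const (1 / fact s) * (x + y) ^ s = (\<Sum>i\<le>s. t i (s - i))" for s
    proof -
      have "Const (1 / fact s) * (x + y) ^ s = (\<Sum>i\<le>s. Const (1 / fact s) * (of_nat (s choose i) * x ^ i * y ^ (s - i)))"
        by (simp add: binomial_ring sum_distrib_left)
      also have "\<dots> = (\<Sum>i\<le>s. t i (s - i))"
      proof (intro sum.cong refl)
        fix i assume "i \<in> {..s}"
        hence eq: "1 / fact s * of_nat (s choose i) = (1 / (fact i * fact (s - i)) :: 'b)"
          by (simp add: binomial_fact field_simps)
        have "Const (1 / fact s) * (of_nat (s choose i) * x ^ i * y ^ (s - i)) =
          Const (1 / fact s) * Const (of_nat (s choose i)) * (x ^ i * y ^ (s - i))"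
          by (simp add: ring_map.of_nat[OF ring_map_Const] mult.assoc)
        thus "Const (1 / fact s) * (of_nat (s choose i) * x ^ i * y ^ (s - i)) = t i (s - i)"
          by (simp only: Const_mult[symmetric] eq t_def)
      qed
      finally show ?thesis .
    qed
    thus ?thesis by (simp add: texp_def sum.triangle_reindex_eq)
  qed
  moreover have "(\<Sum>(i, j)\<in>{..D} \<times> {..D}. t i j) - (\<Sum>(i, j)\<in>{(i, j). i + j \<le> D}. t i j) =
     (\<Sum>(i, j)\<in>{..D} \<times> {..D} - {(i, j). i + j \<le> D}. t i j)"
    by (intro sum_diff[symmetric]) auto
  moreover have "\<dots> \<in> low_deg (Suc D)"
    by (rule low_deg_sum) (auto intro: low_deg_mono[OF t])
  ultimately show ?thesis by (simp add: trunc_cong_def)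
qed

lemma lookup_texp_lin_form:
  assumes "finite V" "mon_deg m \<le> D"
  shows "lookup (texp D (lin_form V p)) m = (if keys m \<subseteq> V then mon_eval p m / of_nat (mfact m) else 0)"
proof -
  have "lookup (texp D (lin_form V p)) m =
    (\<Sum>s\<le>D. if s = mon_deg m then (if keys m \<subseteq> V then mon_eval p m / of_nat (mfact m) else 0) else 0)"
    unfolding texp_def lookup_sum lookup_Const_mult lookup_lin_form_power[OF assms(1)]
    by (intro sum.cong refl) auto
  thus ?thesis using assms(2) by simp
qed

text \<open>Multiplicity vectors: entry j counts how often the j-th of N exponentials occurs in a
  product of d factors.\<close>

definition weights :: "nat \<Rightarrow> nat \<Rightarrow> nat list set" where
  "weights N d = {J. length J = N \<and> sum_list J = d}"

lemma finite_weights: "finite (weights N d)"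
proof -
  have "weights N d \<subseteq> {J. set J \<subseteq> {..d} \<and> length J = N}"
    by (auto simp: weights_def intro: elem_le_sum_list member_le_sum_list)
  thus ?thesis by (rule finite_subset) (rule finite_lists_length_eq, simp)
qed

text \<open>Stars and bars, the origin of the binomial bound.\<close>

lemma card_weights: "card (weights (n + 1) d) = (n + d) choose d"
  using card_length_sum_list[of "n + 1" d] by (simp add: weights_def add.commute)

text \<open>The coefficient vector of the linear form in the exponent when the j-th exponential
  occurs \<open>J ! j\<close> times.\<close>

definition wsum :: "nat \<Rightarrow> (nat \<Rightarrow> 'v \<Rightarrow> 'a::comm_ring_1) \<Rightarrow> nat list \<Rightarrow> 'v \<Rightarrow> 'a" where
  "wsum N \<xi> J v = (\<Sum>j<N. of_nat (J ! j) * \<xi> j v)"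

text \<open>A product of exponentials is again an exponential and depends only on the
  multiplicities, so expanding the power leaves one term for each weight vector.\<close>

lemma sum_texp_power:
  fixes \<xi> :: "nat \<Rightarrow> 'v \<Rightarrow> 'a::field_char_0"
  shows "\<exists>c. trunc_cong D ((\<Sum>j<N. Const (l j) * texp D (lin_form V (\<xi> j))) ^ d)
    (\<Sum>J\<in>weights N d. Const (c J) * texp D (lin_form V (wsum N \<xi> J)))"
proof (induction d)
  case 0
  have w: "weights N 0 = {replicate N 0}"
    by (auto simp: weights_def intro: replicate_eqI)
  have "texp D (lin_form V (wsum N \<xi> (replicate N 0))) = 1"
  proof -
    have "lin_form V (wsum N \<xi> (replicate N 0)) = 0" by (simp add: lin_form_def wsum_def)
    thus ?thesis by (simp add: texp_def power_0_left if_distrib[of "\<lambda>x. _ * x"] cong: if_cong)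
  qed
  thus ?case by (intro exI[of _ "\<lambda>_. 1"]) (simp add: w trunc_cong_refl)
next
  case (Suc d)
  let ?f = "\<Sum>j<N. Const (l j) * texp D (lin_form V (\<xi> j))"
  let ?e = "\<lambda>J. texp D (lin_form V (wsum N \<xi> J))"
  from Suc obtain c where c: "trunc_cong D (?f ^ d) (\<Sum>J\<in>weights N d. Const (c J) * ?e J)" by blast
  define up where "up = (\<lambda>(j, J). J[j := Suc (J ! j)])"
  define S where "S = {..<N} \<times> weights N d"
  \<comment> \<open>A weight vector can arise from several pairs of a new factor and an old weight;
    their coefficients are added up.\<close>
  define c' where "c' J' = (\<Sum>x\<in>{x \<in> S. up x = J'}. l (fst x) * c (snd x))" for J'
  have up: "up ` S \<subseteq> weights N (Suc d)"
    by (auto simp: up_def S_def weights_def sum_list_update)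
  have wsum_up: "wsum N \<xi> (up (j, J)) v = \<xi> j v + wsum N \<xi> J v" if "j < N" "length J = N" for j J v
  proof -
    have "wsum N \<xi> (up (j, J)) v = (\<Sum>i<N. of_nat (J ! i) * \<xi> i v + (if i = j then \<xi> j v else 0))"
      unfolding wsum_def using that by (intro sum.cong refl) (auto simp: up_def nth_list_update distrib_right)
    thus ?thesis using that by (simp add: sum.distrib wsum_def add.commute)
  qed
  have "trunc_cong D (?f ^ Suc d) (?f * (\<Sum>J\<in>weights N d. Const (c J) * ?e J))"
    unfolding power_Suc by (intro trunc_cong_mult trunc_cong_refl c)
  also have "?f * (\<Sum>J\<in>weights N d. Const (c J) * ?e J) =
      (\<Sum>x\<in>S. Const (l (fst x) * c (snd x)) * (texp D (lin_form V (\<xi> (fst x))) * ?e (snd x)))"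
    unfolding sum_product sum.cartesian_product S_def
    by (intro sum.cong refl) (auto simp: Const_mult mult_ac)
  finally have 1: "trunc_cong D (?f ^ Suc d)
      (\<Sum>x\<in>S. Const (l (fst x) * c (snd x)) * (texp D (lin_form V (\<xi> (fst x))) * ?e (snd x)))" .
  have 2: "trunc_cong D (\<Sum>x\<in>S. Const (l (fst x) * c (snd x)) * (texp D (lin_form V (\<xi> (fst x))) * ?e (snd x)))
      (\<Sum>x\<in>S. Const (l (fst x) * c (snd x)) * ?e (up x))"
  proof (intro trunc_cong_sum trunc_cong_mult trunc_cong_refl)
    fix x assume "x \<in> S"
    then obtain j J where x: "x = (j, J)" "j < N" "length J = N" by (auto simp: S_def weights_def)
    have "lin_form V (wsum N \<xi> (up x)) = lin_form V (\<xi> j) + lin_form V (wsum N \<xi> J)"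
      unfolding lin_form_add using wsum_up[OF x(2,3)] by (simp add: x(1) fun_eq_iff lin_form_def)
    thus "trunc_cong D (texp D (lin_form V (\<xi> (fst x))) * ?e (snd x)) (?e (up x))"
      using texp_mult[OF lin_form_low lin_form_low, of D V "\<xi> j" V "wsum N \<xi> J"] by (simp add: x(1))
  qed
  have "(\<Sum>x\<in>S. Const (l (fst x) * c (snd x)) * ?e (up x)) =
      (\<Sum>J'\<in>weights N (Suc d). \<Sum>x\<in>{x \<in> S. up x = J'}. Const (l (fst x) * c (snd x)) * ?e (up x))"
    using up by (intro sum.group[symmetric]) (auto simp: S_def finite_weights)
  also have "\<dots> = (\<Sum>J'\<in>weights N (Suc d). Const (c' J') * ?e J')"
    by (intro sum.cong refl) (simp add: c'_def ring_map.sum[OF ring_map_Const] sum_distrib_right)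
  finally show ?case using trunc_cong_trans[OF 1 2] by metis
qed

section \<open>Coefficient extension and Zariski density\<close>

definition map_coeffs :: "('a::comm_ring_1 \<Rightarrow> 'b::comm_ring_1) \<Rightarrow> ('v, 'a) mpoly \<Rightarrow> ('v, 'b) mpoly" where
  "map_coeffs h p = poly_eval (\<lambda>c. Const (h c)) Var p"

context ring_map
begin

lemma ring_map_map_coeffs: "ring_map (map_coeffs h)"
  unfolding map_coeffs_def[abs_def]
  by (rule ring_map.ring_map_poly_eval[OF ring_map_comp[OF ring_map_Const ring_map_axioms]])

lemma lookup_map_coeffs: "lookup (map_coeffs h p) m = h (lookup p m)"
proof -
  have "lookup (map_coeffs h p) m = (\<Sum>a\<in>keys p. if a = m then h (lookup p a) else 0)"
    unfolding map_coeffs_def poly_eval_def' lookup_sum mon_eval_Var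
    by (intro sum.cong refl) (simp add: lookup_single when_def)
  thus ?thesis by (simp add: in_keys_iff zero)
qed

lemma map_coeffs_Const: "map_coeffs h (Const c) = Const (h c)"
  unfolding map_coeffs_def by (rule ring_map.poly_eval_Const[OF ring_map_comp[OF ring_map_Const ring_map_axioms]])

lemma map_coeffs_Var: "map_coeffs h (Var v) = Var v"
  unfolding map_coeffs_def by (rule ring_map.poly_eval_Var[OF ring_map_comp[OF ring_map_Const ring_map_axioms]])

end

text \<open>Coordinates are moved from the image of the small field to the big one, one at a time.
  In each of them the polynomial is univariate and vanishes on the infinite set
  \<open>range h\<close>, hence everywhere.\<close>

lemma poly_eval_zero_transfer:
  fixes h :: "'a::field_char_0 \<Rightarrow> 'l::idom" and T :: "('v, 'a) mpoly"
  assumes h: "ring_map h" and vanish: "\<And>\<zeta>. poly_eval id \<zeta> T = 0"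
  shows "poly_eval h \<zeta> T = 0"
proof -
  interpret h: ring_map h by fact
  have inj: "inj h"
  proof (rule injI)
    fix x y assume "h x = h y"
    hence "h ((x - y) * inverse (x - y)) = 0" by (simp add: h.mult h.diff)
    thus "x = y" using h.one by (cases "x = y") auto
  qed
  have inf: "infinite (range h)"
    using inj infinite_UNIV_char_0 finite_imageD by blast
  have *: "poly_eval h \<zeta> T = 0" if "finite A" "\<And>v. v \<notin> A \<Longrightarrow> \<zeta> v \<in> range h" for A \<zeta>
    using that
  proof (induction A arbitrary: \<zeta> rule: finite_induct)
    case empty
    hence "\<exists>x. \<zeta> v = h x" for v by auto
    then obtain \<zeta>0 where "\<And>v. \<zeta> v = h (\<zeta>0 v)" by metis
    hence "\<zeta> = (\<lambda>v. h (\<zeta>0 v))" by auto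
    hence "poly_eval h \<zeta> T = h (poly_eval id \<zeta>0 T)" using h.hom_poly_eval[of id \<zeta>0 T] by simp
    thus ?case by (simp add: vanish h.zero)
  next
    case (insert v A)
    define q where "q = poly_eval (\<lambda>c. [:h c:]) (\<lambda>w. if w = v then [:0, 1:] else [:\<zeta> w:]) T"
    have q: "poly q x = poly_eval h (\<zeta>(v := x)) T" for x
    proof -
      have "ring_map (\<lambda>q. poly q x)" by unfold_locales auto
      from ring_map.hom_poly_eval[OF this, of "\<lambda>c. [:h c:]" "\<lambda>w. if w = v then [:0, 1:] else [:\<zeta> w:]" T]
      moreover have "(\<lambda>w. poly (if w = v then [:0, 1:] else [:\<zeta> w:]) x) = \<zeta>(v := x)" by auto
      ultimately show ?thesis by (simp add: q_def)
    qed
    have "poly q x = 0" if "x \<in> range h" for x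
      unfolding q using that insert.prems by (intro insert.IH) auto
    hence "range h \<subseteq> {x. poly q x = 0}" by blast
    hence "q = 0" using inf Polynomial.poly_roots_finite[of q] finite_subset by blast
    hence "poly_eval h (\<zeta>(v := \<zeta> v)) T = 0" using q[of "\<zeta> v"] by simp
    thus ?case by simp
  qed
  define vs where "vs = (\<Union>m\<in>keys T. keys m)"
  have "poly_eval h \<zeta> T = poly_eval h (\<lambda>v. if v \<in> vs then \<zeta> v else h 0) T"
    by (rule poly_eval_cong) (auto simp: vs_def)
  also have "\<dots> = 0" by (rule *[of vs]) (auto simp: vs_def)
  finally show ?thesis .
qed

text \<open>The power sum with indeterminate coefficients turns \<open>P\<close> into a polynomial
  in these coefficients that vanishes at all values in the small field, hence at all values in the
  big one.\<close>

lemma powersum_vanish_transfer: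
  fixes h :: "'a::field_char_0 \<Rightarrow> 'l::idom" and P :: "(nat \<Rightarrow>\<^sub>0 nat, 'a) mpoly"
  assumes h: "ring_map h" and V: "finite V"
    and vanish: "\<And>H. H \<in> powersum_le V D r \<Longrightarrow> poly_eval id (lookup H) P = 0"
  shows "poly_eval h (lookup (\<Sum>i<r. Const (c i) * lin_form V (u i) ^ D)) P = 0"
proof -
  \<comment> \<open>The indeterminate (i, None) is the factor in front of the i-th power, and (i,
    Some v) is the coefficient of x_v in the i-th linear form.\<close>
  define Hgen :: "(nat, (nat \<times> nat option, 'a) mpoly) mpoly" where
    "Hgen = (\<Sum>i<r. Const (Var (i, None)) * lin_form V (\<lambda>v. Var (i, Some v)) ^ D)"
  define T where "T = poly_eval Const (lookup Hgen) P"
  have eval: "poly_eval g \<zeta> T =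
      poly_eval g (lookup (\<Sum>i<r. Const (\<zeta> (i, None)) * lin_form V (\<lambda>v. \<zeta> (i, Some v)) ^ D)) P"
    if g: "ring_map g" for g :: "'a \<Rightarrow> 'm::idom" and \<zeta>
  proof -
    interpret g: ring_map g by fact
    interpret e: ring_map "poly_eval g \<zeta>" by (rule g.ring_map_poly_eval)
    interpret m: ring_map "map_coeffs (poly_eval g \<zeta>)" by (rule e.ring_map_map_coeffs)
    have "map_coeffs (poly_eval g \<zeta>) Hgen =
      (\<Sum>i<r. Const (\<zeta> (i, None)) * lin_form V (\<lambda>v. \<zeta> (i, Some v)) ^ D)"
      by (simp add: Hgen_def lin_form_def m.sum m.mult m.power e.map_coeffs_Const e.map_coeffs_Var)
    hence "poly_eval g \<zeta> (lookup Hgen m) =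
        lookup (\<Sum>i<r. Const (\<zeta> (i, None)) * lin_form V (\<lambda>v. \<zeta> (i, Some v)) ^ D) m" for m
      using e.lookup_map_coeffs[of Hgen m] by simp
    thus ?thesis unfolding T_def e.hom_poly_eval by (simp add: fun_eq_iff)
  qed
  have "poly_eval id \<zeta> T = 0" for \<zeta>
    unfolding eval[OF ring_map_id(1)]
  proof (rule vanish)
    have "lin_form V p \<in> forms V 1" for p :: "nat \<Rightarrow> 'a"
    proof (rule formsI)
      fix m assume "lookup (lin_form V p) m \<noteq> 0"
      thus "keys m \<subseteq> V \<and> mon_deg m = 1"
        using lookup_lin_form_power[OF V, of p 1 m] by (auto split: if_splits)
    qed
    thus "(\<Sum>i<r. Const (\<zeta> (i, None)) * lin_form V (\<lambda>v. \<zeta> (i, Some v)) ^ D) \<in> powersum_le V D r"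
      unfolding powersum_le_def
      by (intro CollectI exI[of _ r] conjI exI[of _ "\<lambda>i. \<zeta> (i, None)"] exI[of _ "\<lambda>i. lin_form V (\<lambda>v. \<zeta> (i, Some v))"]) auto
  qed
  from poly_eval_zero_transfer[OF h this]
  have "poly_eval h (\<lambda>(i, v). case v of None \<Rightarrow> c i | Some v \<Rightarrow> u i v) T = 0" .
  thus ?thesis unfolding eval[OF h] by simp
qed

section \<open>The border rank bound\<close>

lemma lookup_tw: "lookup (tw F) m = lookup F m * (1 / fact (lookup m 0))"
  by (simp add: tw_def lookup_mapp when_def in_keys_iff)

text \<open>The twisted homogenisation of an exponential of a linear form L in degree D is (x_0 +
  L)^D / D!. Applied to the deformation of the d-th power of \<open>f\<close>, this exhibits the
  twisted form as a limit of power sums.\<close>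

theorem border_rank_tw_power_le:
  fixes F :: "(nat, 'a::field_char_0) mpoly"
  assumes F: "F \<in> forms {0..k} e" "F \<noteq> 0" and f: "f = dehomogenize F"
    and \<Phi>0: "\<And>\<beta>. keys \<beta> \<subseteq> {1..k} \<Longrightarrow> fps_nth (\<Phi> \<beta>) 0 = apair f (single \<beta> 1)"
    and \<Phi>: "\<And>\<beta>. keys \<beta> \<subseteq> {1..k} \<Longrightarrow> to_ac (fps_to_fls (\<Phi> \<beta>)) = (\<Sum>j<n + 1. l j * mon_eval (\<xi> j) \<beta>)"
  shows "border_rank {0..k} (tw (F ^ d)) \<le> (n + d) choose d"
proof -
  define D where "D = e * d"
  \<comment> \<open>Large enough for both uses: at least e, so that no term of \<open>f\<close> is
    cut off even for d = 0, and at least D, so that all coefficients entering \<open>H\<close> are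
    exact.\<close>
  define D' where "D' = e * d + e"
  define \<iota> :: "'a fps \<Rightarrow> 'a fls alg_closure" where "\<iota> = (\<lambda>a. to_ac (fps_to_fls a))"
  define \<pi> :: "'a fps \<Rightarrow> 'a" where "\<pi> = (\<lambda>a. fps_nth a 0)"
  interpret \<iota>: ring_map \<iota> by unfold_locales (simp_all add: \<iota>_def fls_times_fps_to_fls)
  interpret \<pi>: ring_map \<pi> by unfold_locales (simp_all add: \<pi>_def)
  interpret \<iota>m: ring_map "map_coeffs \<iota>" by (rule \<iota>.ring_map_map_coeffs)
  interpret \<pi>m: ring_map "map_coeffs \<pi>" by (rule \<pi>.ring_map_map_coeffs)
  have const: "ring_map (fps_const :: 'a \<Rightarrow> 'a fps)" by unfold_locales (simp_all add: fps_const_add fps_const_mult)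
  have \<iota>_inj: "a = 0" if "\<iota> a = 0" for a
  proof -
    have "fps_to_fls a = 0"
    proof (rule ccontr)
      assume nz: "fps_to_fls a \<noteq> 0"
      have "to_ac (fps_to_fls a * inverse (fps_to_fls a)) = 0"
        using that unfolding \<iota>_def by (simp only: to_ac_mult mult_zero_left)
      thus False unfolding right_inverse[OF nz] by simp
    qed
    thus ?thesis by simp
  qed
  have \<iota>_const: "\<iota> (fps_const (1 / of_nat j)) = 1 / of_nat j" if "j \<noteq> 0" for j
  proof -
    have "of_nat j * \<iota> (fps_const (1 / of_nat j)) = \<iota> (of_nat j * fps_const (1 / of_nat j))"
      by (simp add: \<iota>.mult \<iota>.of_nat)
    also have "of_nat j * fps_const (1 / of_nat j) = (1 :: 'a fps)"
      using that by (simp add: fps_of_nat[symmetric])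
    finally show ?thesis using that by (simp add: \<iota>.one field_simps)
  qed
  let ?V = "{1..k}" and ?U = "{0..k}"
  have "?U - {0} = ?V" by auto
  moreover have "F \<in> polys ?U" using F(1) by (simp add: forms_def)
  ultimately have fV: "f \<in> polys ?V" using dehomogenize_polys[of F ?U] by (simp add: f)
  have fdeg: "mon_deg m \<le> e" if "lookup f m \<noteq> 0" for m
    using that lookup_dehomogenize[OF F(1), of m] by (auto simp: f split: if_splits)
  \<comment> \<open>The deformation of \<open>f\<close> over K[[t]]: it specialises to
    \<open>f\<close> at t = 0 and agrees up to degree D' with the sum of exponentials over the big
    field.\<close>
  define fR where "fR = (\<Sum>\<beta> | keys \<beta> \<subseteq> ?V \<and> mon_deg \<beta> \<le> D'. single \<beta> (\<Phi> \<beta> * fps_const (1 / of_nat (mfact \<beta>))))"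
  have lfR: "lookup fR m = (if keys m \<subseteq> ?V \<and> mon_deg m \<le> D' then \<Phi> m * fps_const (1 / of_nat (mfact m)) else 0)" for m
    using finite_monomials[of ?V D'] by (simp add: fR_def lookup_sum lookup_single when_def)
  have "map_coeffs \<pi> fR = f"
  proof (rule poly_mapping_eqI)
    fix m
    show "lookup (map_coeffs \<pi> fR) m = lookup f m"
    proof (cases "keys m \<subseteq> ?V \<and> mon_deg m \<le> D'")
      case True
      thus ?thesis using \<Phi>0[of m] unfolding \<pi>.lookup_map_coeffs lfR by (simp add: \<pi>_def)
    next
      case False
      hence "lookup f m = 0" using polys_lookup[OF fV, of m] fdeg[of m] by (fastforce simp: D'_def)
      thus ?thesis using False by (auto simp: \<pi>.lookup_map_coeffs lfR \<pi>.zero)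
    qed
  qed
  hence \<pi>_fR: "map_coeffs \<pi> (fR ^ d) = f ^ d" by (simp add: \<pi>m.power)
  let ?e = "\<lambda>p. texp D' (lin_form ?V p)"
  obtain c where c: "trunc_cong D' ((\<Sum>j<n + 1. Const (l j) * ?e (\<xi> j)) ^ d)
      (\<Sum>J\<in>weights (n + 1) d. Const (c J) * ?e (wsum (n + 1) \<xi> J))"
    using sum_texp_power by blast
  have "trunc_cong D' (map_coeffs \<iota> fR) (\<Sum>j<n + 1. Const (l j) * ?e (\<xi> j))"
  proof (rule trunc_congI)
    fix m :: "nat \<Rightarrow>\<^sub>0 nat" assume m: "mon_deg m \<le> D'"
    have "lookup (\<Sum>j<n + 1. Const (l j) * ?e (\<xi> j)) m =
      (\<Sum>j<n + 1. l j * (if keys m \<subseteq> ?V then mon_eval (\<xi> j) m / of_nat (mfact m) else 0))"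
      using m by (simp only: lookup_sum lookup_Const_mult lookup_texp_lin_form[OF finite_atLeastAtMost])
    also have "\<dots> = \<iota> (lookup fR m)"
    proof (cases "keys m \<subseteq> ?V")
      case True
      have "(\<Sum>j<n + 1. l j * (mon_eval (\<xi> j) m / of_nat (mfact m))) = (\<Sum>j<n + 1. l j * mon_eval (\<xi> j) m) * (1 / of_nat (mfact m))"
        unfolding sum_distrib_right by (intro sum.cong refl) simp
      also have "\<dots> = \<iota> (\<Phi> m) * \<iota> (fps_const (1 / of_nat (mfact m)))"
        unfolding \<iota>_const[OF mfact_nz] using \<Phi>[OF True] by (simp add: \<iota>_def)
      finally show ?thesis using True m by (simp add: lfR \<iota>.mult)
    qed (auto simp: lfR \<iota>.zero)
    finally show "lookup (map_coeffs \<iota> fR) m = lookup (\<Sum>j<n + 1. Const (l j) * ?e (\<xi> j)) m"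
      by (simp add: \<iota>.lookup_map_coeffs)
  qed
  from trunc_cong_trans[OF trunc_cong_power[OF this] c]
  have \<iota>_fR: "trunc_cong D' (map_coeffs \<iota> (fR ^ d)) (\<Sum>J\<in>weights (n + 1) d. Const (c J) * ?e (wsum (n + 1) \<xi> J))"
    by (simp add: \<iota>m.power)
  define H where "H = tw (F ^ d)"
  have Fd: "F ^ d \<in> forms ?U D" unfolding D_def by (rule forms_power[OF F(1)])
  have Hforms: "H \<in> forms ?U D"
    by (rule formsI) (use forms_lookup[OF Fd] in \<open>auto simp: H_def lookup_tw\<close>)
  have "F ^ d \<noteq> 0" using F(2) by simp
  hence "H \<noteq> 0" by (auto simp: H_def lookup_tw poly_mapping_eq_iff fun_eq_iff)
  hence tdegH: "tdeg H = D" by (rule tdeg_forms[OF Hforms])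
  \<comment> \<open>Coefficients over K[[t]] that link the two sides: their values at t = 0 are
    those of \<open>H\<close>, and their images in the big field are those of the power sum
    \<open>Hs\<close>.\<close>
  define Hc where "Hc m = (if keys m \<subseteq> ?U \<and> mon_deg m = D
      then lookup (fR ^ d) (mon_rest m) * fps_const (1 / fact (lookup m 0)) else 0)" for m
  have \<pi>_Hc: "\<pi> (Hc m) = lookup H m" for m
  proof (cases "keys m \<subseteq> ?U \<and> mon_deg m = D")
    case True
    have "lookup (F ^ d) m = lookup (dehomogenize (F ^ d)) (mon_rest m)"
      using True by (intro lookup_form_dehomogenize[OF Fd]) simp
    also have "dehomogenize (F ^ d) = f ^ d" by (simp add: f ring_map.power[OF ring_map_dehomogenize])
    also have "lookup (f ^ d) (mon_rest m) = \<pi> (lookup (fR ^ d) (mon_rest m))"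
      by (simp add: \<pi>_fR[symmetric] \<pi>.lookup_map_coeffs)
    finally show ?thesis using True by (simp add: Hc_def H_def lookup_tw \<pi>_def)
  next
    case False
    hence "lookup H m = 0" using forms_lookup[OF Hforms, of m] by blast
    thus ?thesis using False by (auto simp: Hc_def \<pi>.zero)
  qed
  \<comment> \<open>The coefficient 1 at x_0 produces x_0 + L; the division by D! in
    \<open>Hs\<close> normalises the part of degree D of the exponential.\<close>
  define u where "u J = (wsum (n + 1) \<xi> J)(0 := 1)" for J
  define Hs where "Hs = (\<Sum>J\<in>weights (n + 1) d. Const (c J / fact D) * lin_form ?U (u J) ^ D)"
  have \<iota>_Hc: "\<iota> (Hc m) = lookup Hs m" for m
  proof (cases "keys m \<subseteq> ?U \<and> mon_deg m = D")
    case True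
    let ?r = "mon_rest m"
    have rV: "keys ?r \<subseteq> ?V"
      using True by (auto simp: in_keys_iff lookup_mon_rest subset_iff split: if_splits)
    have "mon_deg m = mon_deg ?r + lookup m 0"
      using arg_cong[OF mon_rest_split[of m], of mon_deg] by (simp add: mon_deg_add)
    hence rD: "mon_deg ?r \<le> D'" using True by (simp add: D'_def D_def)
    have mf: "mfact m = mfact ?r * fact (lookup m 0)"
    proof -
      have "keys ?r \<inter> keys (single 0 (lookup m 0)) = {}" by (auto simp: in_keys_iff lookup_mon_rest lookup_single when_def)
      from mfact_add_disjoint[OF this] show ?thesis by (simp flip: mon_rest_split)
    qed
    have me: "mon_eval (u J) m = mon_eval (wsum (n + 1) \<xi> J) ?r" for J
    proof -
      have "mon_eval (u J) (?r + single 0 (lookup m 0)) = mon_eval (u J) ?r" by (simp add: mon_eval_add u_def)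
      also have "\<dots> = mon_eval (wsum (n + 1) \<xi> J) ?r" by (rule mon_eval_cong) (use rV in \<open>auto simp: u_def\<close>)
      finally show ?thesis by (simp flip: mon_rest_split)
    qed
    have "\<iota> (lookup (fR ^ d) ?r) = lookup (\<Sum>J\<in>weights (n + 1) d. Const (c J) * ?e (wsum (n + 1) \<xi> J)) ?r"
      using trunc_cong_lookup[OF \<iota>_fR rD] by (simp add: \<iota>.lookup_map_coeffs)
    also have "\<dots> = (\<Sum>J\<in>weights (n + 1) d. c J * (mon_eval (wsum (n + 1) \<xi> J) ?r / of_nat (mfact ?r)))"
      using rV rD by (simp add: lookup_sum lookup_texp_lin_form)
    finally have "\<iota> (lookup (fR ^ d) ?r) * (1 / of_nat (fact (lookup m 0))) =
      (\<Sum>J\<in>weights (n + 1) d. c J * (mon_eval (u J) m / of_nat (mfact m)))"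
      by (simp add: sum_distrib_right me mf sum_divide_distrib)
    moreover have "lookup Hs m = (\<Sum>J\<in>weights (n + 1) d. c J * (mon_eval (u J) m / of_nat (mfact m)))"
      unfolding Hs_def lookup_sum lookup_Const_mult using True
      by (intro sum.cong refl) (simp add: lookup_lin_form_power)
    moreover have "\<iota> (Hc m) = \<iota> (lookup (fR ^ d) ?r) * (1 / of_nat (fact (lookup m 0)))"
      using True \<iota>_const[of "fact (lookup m 0)"] by (simp add: Hc_def \<iota>.mult)
    ultimately show ?thesis by simp
  next
    case False
    hence "lookup Hs m = 0" unfolding Hs_def lookup_sum lookup_Const_mult
      by (intro sum.neutral ballI) (auto simp: lookup_lin_form_power)
    thus ?thesis using False by (auto simp: Hc_def \<iota>.zero)
  qed
  let ?r = "(n + d) choose d"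
  obtain b where b: "bij_betw b {..<?r} (weights (n + 1) d)"
    using ex_bij_betw_nat_finite[OF finite_weights[of "n + 1" d]] by (auto simp: card_weights atLeast0LessThan)
  have Hs': "Hs = (\<Sum>i<?r. Const (c (b i) / fact D) * lin_form ?U (u (b i)) ^ D)"
    unfolding Hs_def by (rule sum.reindex_bij_betw[OF b, symmetric])
  have "H \<in> zariski_closure ?U D (powersum_le ?U D ?r)"
    unfolding zariski_closure_def
  proof (intro CollectI conjI Hforms allI impI)
    fix P :: "(nat \<Rightarrow>\<^sub>0 nat, 'a) mpoly"
    assume van: "\<forall>H'\<in>powersum_le ?U D ?r. poly_eval id (lookup H') P = 0"
    \<comment> \<open>\<open>P\<close> vanishes at \<open>Hs\<close> in the big field. Since K[[t]]
      embeds there, it vanishes at \<open>Hc\<close> over K[[t]], where t can be set to 0.\<close>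
    have "poly_eval (\<lambda>c. \<iota> (fps_const c)) (lookup Hs) P = 0"
      unfolding Hs' by (rule powersum_vanish_transfer[OF ring_map_comp[OF \<iota>.ring_map_axioms const]]) (use van in auto)
    also have "lookup Hs = (\<lambda>m. \<iota> (Hc m))" using \<iota>_Hc by auto
    also have "poly_eval (\<lambda>c. \<iota> (fps_const c)) (\<lambda>m. \<iota> (Hc m)) P = \<iota> (poly_eval fps_const Hc P)"
      by (rule \<iota>.hom_poly_eval[symmetric])
    finally have "poly_eval fps_const Hc P = 0" by (rule \<iota>_inj)
    hence "\<pi> (poly_eval fps_const Hc P) = 0" by (simp add: \<pi>.zero)
    hence "poly_eval (\<lambda>c. \<pi> (fps_const c)) (\<lambda>m. \<pi> (Hc m)) P = 0" by (simp add: \<pi>.hom_poly_eval)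
    moreover have "(\<lambda>c. \<pi> (fps_const c)) = id" by (auto simp: \<pi>_def)
    moreover have "(\<lambda>m. \<pi> (Hc m)) = lookup H" using \<pi>_Hc by auto
    ultimately show "poly_eval id (lookup H) P = 0" by simp
  qed
  thus ?thesis unfolding border_rank_def H_def[symmetric] tdegH by (intro Least_le)
qed

theorem theorem1p11:
  fixes F :: "(nat, 'a::{alg_closed_field, field_char_0}) mpoly"
    and f :: "(nat, 'a) mpoly" and k n :: nat
  assumes "F \<in> polys {0..k}" and "homogeneous F" and "concise {0..k} F"
    and "f = dehomogenize F"
    and "smoothable (Ap_scalar {1..k} f) (Ap {1..k} f)"
    and "ring.dimension (Ap {1..k} f) (n + 1) (range (Ap_scalar {1..k} f)) (carrier (Ap {1..k} f))"
  shows "(\<exists>G g. G \<in> polys {0..n} \<and> homogeneous G \<and> concise {0..n} G \<and>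
            F = set_zero {k+1..n} G \<and>
            g = dehomogenize G \<and> encompassing {1..n} g \<and>
            smoothable (Ap_scalar {1..n} g) (Ap {1..n} g) \<and>
            algebra_iso (Ap_scalar {1..n} g) (Ap {1..n} g) (Ap_scalar {1..k} f) (Ap {1..k} f))
       \<and> (\<forall>d. border_rank {0..k} (tw (F ^ d)) \<le> (n + d) choose d)"
proof -
  have F0: "F \<noteq> 0" using assms(3) by (rule concise_nonzero)
  obtain e where e: "F \<in> forms {0..k} e"
    using assms(1,2) by (auto simp: homogeneous_def forms_def)
  have "f \<noteq> 0" using dehomogenize_nonzero[OF e F0] assms(4) by simp
  then obtain \<Phi> l \<xi> where "\<And>\<beta>. keys \<beta> \<subseteq> {1..k} \<Longrightarrow> fps_nth (\<Phi> \<beta>) 0 = apair f (single \<beta> 1)"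
    "\<And>\<beta>. keys \<beta> \<subseteq> {1..k} \<Longrightarrow> to_ac (fps_to_fls (\<Phi> \<beta>)) = (\<Sum>j<n + 1. l j * mon_eval (\<xi> j) \<beta>)"
    by (rule smoothable_imp_points[OF _ assms(5,6)]) (rule that, blast+)
  from border_rank_tw_power_le[OF e F0 assms(4) this]
  have "\<forall>d. border_rank {0..k} (tw (F ^ d)) \<le> (n + d) choose d" by blast
  with encompassing_extension[OF assms]
  show ?thesis by (intro conjI)
qed

end
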